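(* Let $n\ge1$ and $k\ge1$ be integers. The real dimension of the vector space $$V_{n,k}=\left\{\Sigma_{\alpha\beta\cdots\eta}\in Y_k({\mathbb T})\ \middle|\ \Sigma_{\alpha\beta\cdots\eta}\text{ is totally trace-free with respect to }J^{\alpha\beta}\text{ and }(J\Sigma)_{\alpha\beta\cdots\eta}=0\right\}$$ is $$\sum_{p+2q=k}\left(\frac{(n+q-1)!\,(n+p+q)!\,(p+1)}{q!\,(p+q+1)!\,(n-1)!\,n!}\right)^2-\sum_{p+2q=k-1}\left(\frac{(n+q-1)!\,(n+p+q)!\,(p+1)}{q!\,(p+q+1)!\,(n-1)!\,n!}\right)^2,$$ where the sums are over integers $p,q\ge0$.
   Context: ${\mathbb T}$ is a real vector space of dimension $2n+2$ equipped with a positive definite symmetric form $g_{\alpha\beta}$ and a compatible complex structure, i.e. an orthogonal endomorphism $\Omega_\alpha\mapsto J_\alpha{}^\beta\Omega_\beta$ with $J_\alpha{}^\beta J_\beta{}^\gamma=-\delta_\alpha{}^\gamma$; set $J_{\alpha\beta}=J_\alpha{}^\gamma g_{\beta\gamma}$, a nondegenerate skew form, and let $J^{\alpha\beta}$ be obtained from it by raising indices with $g$. $Y_k({\mathbb T})\subset\bigotimes^{2k}{\mathbb T}$ is the irreducible $\mathrm{GL}({\mathbb T})$-module given by the Young diagram with two rows of $k$ boxes each, realised as the space of $2k$-tensors $\Sigma_{\alpha_1\beta_1\alpha_2\beta_2\cdots\alpha_k\beta_k}$ that are skew in each pair $\alpha_i\beta_i$ and such that, for each $1\le i<k$, the total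 skew-symmetrisation over the three indices $\alpha_i,\beta_i,\alpha_{i+1}$ vanishes (for $k=1$, $Y_1({\mathbb T})=\Lambda^2{\mathbb T}$). Totally trace-free with respect to $J^{\alpha\beta}$ means that the contraction of $J^{\alpha\beta}$ into any two indices of $\Sigma$ vanishes. The derivation action is $$(J\Sigma)_{\alpha\beta\cdots\eta}=J_\alpha{}^\lambda\Sigma_{\lambda\beta\cdots\eta}+J_\beta{}^\mu\Sigma_{\alpha\mu\cdots\eta}+\cdots+J_\eta{}^\nu\Sigma_{\alpha\beta\cdots\nu}.$$ *)

theory Defs
  imports "HOL-Analysis.Analysis" "HOL-Library.Function_Algebras"
begin

instantiation "fun" :: (type, real_vector) real_vector
begin

definition scaleR_fun :: "real \<Rightarrow> ('a \<Rightarrow> 'b) \<Rightarrow> 'a \<Rightarrow> 'b"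
  where "scaleR_fun r f = (\<lambda>x. r *\<^sub>R f x)"

instance
  by standard (simp_all add: scaleR_fun_def plus_fun_def fun_eq_iff scaleR_add_right scaleR_add_left)

end

text \<open>
  The type 'a is the space \<open>T\<close>, its inner product is the form \<open>g\<close>.  A tensor in the \<open>m\<close>-th tensor
  power of \<open>T\<close> is identified, by means of \<open>g\<close>, with an \<open>m\<close>-linear form: the
  decomposable tensor \<open>u\<^sub>1 \<otimes> \<dots> \<otimes> u\<^sub>m\<close> is the form \<open>[x\<^sub>1, \<dots>, x\<^sub>m] \<mapsto> (u\<^sub>1 \<bullet> x\<^sub>1) \<cdots> (u\<^sub>m \<bullet> x\<^sub>m)\<close>.
  Arguments are lists of length \<open>m\<close>; forms are \<open>0\<close> on lists of any other length, so that they
  are determined by their values on lists of length \<open>m\<close>.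
\<close>

definition tensors :: "nat \<Rightarrow> ('a::euclidean_space list \<Rightarrow> real) set"
  where "tensors m = {\<Sigma>. (\<forall>xs. length xs \<noteq> m \<longrightarrow> \<Sigma> xs = 0) \<and>
                         (\<forall>xs i. length xs = m \<longrightarrow> i < m \<longrightarrow> linear (\<lambda>x. \<Sigma> (xs[i := x])))}"

definition skew_in :: "nat \<Rightarrow> nat \<Rightarrow> ('a list \<Rightarrow> real) \<Rightarrow> bool"
  where "skew_in i j \<Sigma> \<longleftrightarrow> (\<forall>xs. \<Sigma> (permute_list (Transposition.transpose i j) xs) = - \<Sigma> xs)"

definition skew_symmetrisation :: "nat set \<Rightarrow> ('a list \<Rightarrow> real) \<Rightarrow> 'a list \<Rightarrow> real"
  where "skew_symmetrisation S \<Sigma> xs =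
    (\<Sum>p | p permutes S. of_int (sign p) * \<Sigma> (permute_list p xs)) / fact (card S)"

text \<open>Positions are counted from \<open>0\<close>: \<open>\<alpha>\<^sub>i, \<beta>\<^sub>i\<close> are at positions \<open>2 * (i - 1)\<close> and \<open>2 * (i - 1) + 1\<close>.\<close>

definition young_module :: "nat \<Rightarrow> ('a::euclidean_space list \<Rightarrow> real) set"
  where "young_module k = {\<Sigma> \<in> tensors (2 * k).
    (\<forall>i<k. skew_in (2 * i) (2 * i + 1) \<Sigma>) \<and>
    (\<forall>i. i + 1 < k \<longrightarrow> (\<forall>xs. skew_symmetrisation {2 * i, 2 * i + 1, 2 * i + 2} \<Sigma> xs = 0))}"

definition compatible_complex_structure :: "('a::euclidean_space \<Rightarrow> 'a) \<Rightarrow> bool"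
  where "compatible_complex_structure J \<longleftrightarrow> orthogonal_transformation J \<and> (\<forall>x. J (J x) = - x)"

text \<open>
  In an orthonormal basis, \<open>(J \<Omega>)\<^sub>\<alpha> = J\<^sub>\<alpha>\<^sup>\<beta> \<Omega>\<^sub>\<beta>\<close> has the matrix \<open>J\<^sub>\<alpha>\<^sup>\<beta> = a \<bullet> J b\<close>, where \<open>a\<close> and \<open>b\<close> are the
  basis vectors labelled \<open>\<alpha>\<close> and \<open>\<beta>\<close>.  Since \<open>g\<close> is the identity matrix there, this is also
  the component of \<open>J\<close> with both indices lowered or both raised.
\<close>

definition J_trace :: "('a::euclidean_space \<Rightarrow> 'a) \<Rightarrow> nat \<Rightarrow> nat \<Rightarrow> ('a list \<Rightarrow> real) \<Rightarrow> 'a list \<Rightarrow> real"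
  where "J_trace J i j \<Sigma> xs = (\<Sum>a\<in>Basis. \<Sum>b\<in>Basis. (a \<bullet> J b) * \<Sigma> (xs[i := a, j := b]))"

definition totally_trace_free :: "('a::euclidean_space \<Rightarrow> 'a) \<Rightarrow> nat \<Rightarrow> ('a list \<Rightarrow> real) \<Rightarrow> bool"
  where "totally_trace_free J m \<Sigma> \<longleftrightarrow>
    (\<forall>i<m. \<forall>j<m. i \<noteq> j \<longrightarrow> (\<forall>xs. length xs = m \<longrightarrow> J_trace J i j \<Sigma> xs = 0))"

text \<open>
  Acting with \<open>J\<close> on the \<open>i\<close>-th tensor factor means precomposing the form with the adjoint of
  \<open>J\<close> in the \<open>i\<close>-th argument, because \<open>J u \<bullet> x = u \<bullet> adjoint J x\<close>.
\<close>

definition derivation_action :: "('a::euclidean_space \<Rightarrow> 'a) \<Rightarrow> ('a list \<Rightarrow> real) \<Rightarrow> 'a list \<Rightarrow> real"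
  where "derivation_action J \<Sigma> xs = (\<Sum>i<length xs. \<Sigma> (xs[i := adjoint J (xs ! i)]))"

definition V_space :: "('a::euclidean_space \<Rightarrow> 'a) \<Rightarrow> nat \<Rightarrow> ('a list \<Rightarrow> real) set"
  where "V_space J k = {\<Sigma> \<in> young_module k.
    totally_trace_free J (2 * k) \<Sigma> \<and> (\<forall>xs. derivation_action J \<Sigma> xs = 0)}"

end

theory Submission
  imports Defs
begin

text \<open>
  A tensor \<open>\<Sigma>\<close> in \<open>Y\<^sub>k(T)\<close> is determined by the polynomial \<open>f(x, y) = \<Sigma>(x, y, x, y, \<dots>, x, y)\<close>, and the
  polynomials that occur are those on \<open>T \<times> T\<close> that have degree \<open>k\<close> in each of \<open>x\<close> and \<open>y\<close> and are
  unchanged by the shears \<open>y \<mapsto> y + s x\<close>. On the polynomials on \<open>T \<times> T\<close> there are two commuting copies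
  of \<open>sl(2)\<close>. One contains the polarisation operators \<open>x \<cdot> \<partial>\<^sub>y\<close> and \<open>y \<cdot> \<partial>\<^sub>x\<close>; its commutator is the
  difference of the degrees in \<open>x\<close> and \<open>y\<close>. The other contains the second order operator \<open>\<Delta> = J\<^sup>\<alpha>\<^sup>\<beta> \<partial>\<^sub>\<alpha> \<partial>\<^sub>\<beta>\<close>
  (one derivative in \<open>x\<close>, one in \<open>y\<close>) and the multiplication by the symplectic form \<open>J(x, y)\<close>; its
  commutator is the total degree plus \<open>dim T\<close>, up to a factor. The action of \<open>J\<close> commutes with all of
  them. By the Bianchi symmetry every \<open>J\<close>-trace of \<open>\<Sigma>\<close> is a multiple of the trace over one pair, and
  this trace is \<open>\<Delta> f\<close> up to a nonzero factor. Hence \<open>V\<^sub>n\<^sub>,\<^sub>k\<close> is the space of \<open>J\<close>-invariant \<open>f\<close> of degree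
  \<open>(k, k)\<close> that are killed by \<open>x \<cdot> \<partial>\<^sub>y\<close> and by \<open>\<Delta>\<close> (lemmas \<open>dim_V_space_eq\<close> and \<open>dim_harmonic_young_forms\<close>).

  A raising operator of \<open>sl(2)\<close> is onto as long as the commutator acts by positive scalars; lemma
  \<open>ladder_surjective\<close> proves this by descending induction, without complete reducibility. Applied to
  \<open>\<Delta>\<close> it shows that \<open>dim V\<^sub>n\<^sub>,\<^sub>k\<close> is the dimension of the kernel of \<open>x \<cdot> \<partial>\<^sub>y\<close> on the \<open>J\<close>-invariants of degree
  \<open>(k, k)\<close> minus the one in degree \<open>(k - 1, k - 1)\<close> (lemma \<open>J_laplacian_surjective\<close>). Applied to \<open>x \<cdot> \<partial>\<^sub>y\<close>
  it shows that the dimension of this kernel is the dimension of all \<open>J\<close>-invariant polynomials of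
  degree \<open>(k, k)\<close> minus the one in degree \<open>(k + 1, k - 1)\<close> (lemma \<open>fst_to_snd_surjective\<close>).

  What remains is a count. Over the complex numbers \<open>J\<close> acts diagonally on the monomials in
  holomorphic and antiholomorphic coordinates, and the invariants are spanned by the monomials
  that have as many factors of the one kind as of the other (lemmas \<open>dim_weight_forms\<close> and
  \<open>card_balanced_multisets\<close>). Let \<open>h\<^sub>i\<close> be the binomial coefficient \<open>n + i\<close> over \<open>i\<close>, the number of
  monomials of degree \<open>i\<close> in \<open>n + 1\<close> variables, and \<open>g\<^sub>i = h\<^sub>i h\<^sub>k\<^sub>-\<^sub>i\<close>. The two dimensions are \<open>\<Sum> g\<^sub>i\<^sup>2\<close> and
  \<open>\<Sum> g\<^sub>i g\<^sub>i\<^sub>-\<^sub>1\<close>. Their difference is half of \<open>\<Sum> (g\<^sub>i - g\<^sub>i\<^sub>-\<^sub>1)\<^sup>2\<close>, and in this sum the terms \<open>i\<close> and \<open>k + 1 - i\<close>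
  agree. The surviving numbers \<open>g\<^sub>q - g\<^sub>q\<^sub>-\<^sub>1\<close> with \<open>2 q \<le> k\<close> are the fractions in the claim: they are the
  dimensions of the \<open>GL(n + 1)\<close>-modules whose diagrams have rows of \<open>p + q\<close> and \<open>q\<close> boxes.
\<close>

section \<open>Dimensions of subspaces of function spaces\<close>

lemma injective_image_basis:
  fixes f :: "'v::real_vector \<Rightarrow> 'w::real_vector"
  assumes f: "linear f" and S: "subspace S" and ker: "\<And>x. x \<in> S \<Longrightarrow> f x = 0 \<Longrightarrow> x = 0"
  obtains B where "independent B" "span B = S" "independent (f ` B)" "inj_on f B"
proof -
  interpret f: linear f by fact
  obtain B where B: "B \<subseteq> S" "independent B" "S \<subseteq> span B" "card B = dim S"
    using basis_exists by blast
  have spB: "span B = S"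
    using B S by (meson span_minimal subset_antisym)
  have inj: "inj_on f (span B)"
  proof (rule inj_onI)
    fix x y assume xy: "x \<in> span B" "y \<in> span B" "f x = f y"
    then have "x - y \<in> S" using spB span_diff by blast
    with ker[of "x - y"] xy show "x = y" by (simp add: f.diff)
  qed
  have "independent (f ` B)"
    by (rule real_vector.linear_independent_injective_image[OF f B(2) inj])
  then show ?thesis by (rule that[OF B(2) spB _ inj_on_subset[OF inj span_superset]])
qed

lemma dim_linear_image_inj_on:
  fixes f :: "'v::real_vector \<Rightarrow> 'w::real_vector"
  assumes f: "linear f" and "subspace S" and "\<And>x. x \<in> S \<Longrightarrow> f x = 0 \<Longrightarrow> x = 0"
  shows "dim (f ` S) = dim S"
proof -
  obtain B where B: "independent B" "span B = S" "independent (f ` B)" "inj_on f B"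
    using injective_image_basis[OF assms] by metis
  then show ?thesis
    using dim_span_eq_card_independent[of "f ` B"] dim_span_eq_card_independent[of B]
      linear_span_image[OF f, of B] card_image[of f B] by simp
qed

lemma finite_spanning_if_linear_image:
  fixes f :: "'v::real_vector \<Rightarrow> 'w::real_vector"
  assumes f: "linear f" and "subspace S" and "\<And>x. x \<in> S \<Longrightarrow> f x = 0 \<Longrightarrow> x = 0"
    and fin: "f ` S \<subseteq> span C" "finite C"
  shows "\<exists>B. finite B \<and> S \<subseteq> span B"
proof -
  obtain B where B: "independent B" "span B = S" "independent (f ` B)" "inj_on f B"
    using injective_image_basis[OF assms(1-3)] by metis
  have "f ` B \<subseteq> f ` S" using B(2) span_superset[of B] by (intro image_mono) simp
  then have "f ` B \<subseteq> span C" using fin(1) by (rule order_trans)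
  then have "finite (f ` B)" using independent_span_bound[OF fin(2) B(3)] by blast
  then have "finite B" by (rule finite_imageD) (rule B(4))
  with B(2) show ?thesis by auto
qed

lemma dim_eq_dim_kernel_plus_dim_image:
  fixes f :: "'v::real_vector \<Rightarrow> 'w::real_vector"
  assumes f: "linear f" and S: "subspace S" and fin: "S \<subseteq> span C" "finite C"
  shows "dim S = dim {x \<in> S. f x = 0} + dim (f ` S)"
proof -
  interpret f: linear f by fact
  let ?N = "{x \<in> S. f x = 0}"
  obtain K where K: "K \<subseteq> ?N" "independent K" "?N \<subseteq> span K" "card K = dim ?N"
    using basis_exists by blast
  have "K \<subseteq> S" using K by auto
  obtain B where B: "K \<subseteq> B" "B \<subseteq> S" "independent B" "S \<subseteq> span B"
    using maximal_independent_subset_extend[OF \<open>K \<subseteq> S\<close> K(2)] by blast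
  have finB: "finite B"
    using independent_span_bound[of C B] B fin by auto
  have spB: "span B = S"
    using B S by (meson span_minimal subset_antisym)
  have ker: "x = 0" if x: "x \<in> span (B - K)" and "f x = 0" for x
  proof -
    have "x \<in> S" using x spB span_mono[of "B - K" B] by auto
    then have "x \<in> span K" using K(3) that(2) by auto
    then have "representation B x = representation K x" "representation B x = representation (B - K) x"
      using B x by (auto intro!: representation_extend)
    then have "representation B x b = 0" for b
      using representation_ne_zero[of K x b] representation_ne_zero[of "B - K" x b] by auto
    moreover have "x \<in> span B" using \<open>x \<in> S\<close> spB by simp
    ultimately show ?thesis
      using sum_nonzero_representation_eq[OF B(3), of x] by simp
  qed
  have "f ` S = span (f ` B)" using linear_span_image[OF f, of B] spB by simp
  also have "\<dots> = span (f ` (B - K))"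
    unfolding span_eq
  proof (rule conjI)
    show "f ` B \<subseteq> span (f ` (B - K))"
    proof safe
      fix b assume "b \<in> B"
      then show "f b \<in> span (f ` (B - K))"
        using K(1) by (cases "b \<in> K") (auto intro: span_base simp: span_zero)
    qed
    show "f ` (B - K) \<subseteq> span (f ` B)" by (auto intro: span_base)
  qed
  also have "\<dots> = f ` span (B - K)" by (rule linear_span_image[OF f])
  finally have "dim (f ` S) = dim (span (B - K))"
    using dim_linear_image_inj_on[OF f subspace_span ker] by simp
  also have "\<dots> = card (B - K)"
    by (rule dim_span_eq_card_independent) (use independent_mono[OF B(3)] in auto)
  also have "\<dots> = card B - card K"
    using B(1) finB by (intro card_Diff_subset) (auto intro: finite_subset)
  finally have "dim (f ` S) = card B - card K" .
  moreover have "dim S = card B" using basis_card_eq_dim[OF B(2,4,3)] by simp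
  moreover have "card K \<le> card B" using card_mono[OF finB B(1)] .
  ultimately show ?thesis using K(4) by simp
qed

definition supported_on :: "'i set \<Rightarrow> ('i \<Rightarrow> 'v::zero) set"
  where "supported_on F = {c. \<forall>i. i \<notin> F \<longrightarrow> c i = 0}"

lemma scaleR_fun_apply [simp]: "(r *\<^sub>R f) x = r *\<^sub>R f x"
  by (simp add: scaleR_fun_def)

lemma subspace_supported_on: "subspace (supported_on F :: ('i \<Rightarrow> 'v::real_vector) set)"
  by (auto simp: supported_on_def subspace_def)

lemma sum_fun_apply: "(\<Sum>i\<in>I. g i) x = (\<Sum>i\<in>I. g i x)" 
  for g :: "'i \<Rightarrow> 'x \<Rightarrow> 'v::comm_monoid_add"
  by (induction I rule: infinite_finite_induct) auto

lemma dim_supported_on: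
  assumes "finite F"
  shows "dim (supported_on F :: ('i \<Rightarrow> real) set) = card F"
    and "\<exists>B. finite B \<and> (supported_on F :: ('i \<Rightarrow> real) set) \<subseteq> span B"
proof -
  define e :: "'i \<Rightarrow> 'i \<Rightarrow> real" where "e i = (\<lambda>j. if j = i then 1 else 0)" for i
  have inj: "inj_on e F"
    by (rule inj_onI) (metis e_def zero_neq_one)
  have span: "supported_on F \<subseteq> span (e ` F)"
  proof
    fix c :: "'i \<Rightarrow> real" assume c: "c \<in> supported_on F"
    have "c = (\<Sum>i\<in>F. c i *\<^sub>R e i)"
    proof
      fix j
      have "(\<Sum>i\<in>F. c i *\<^sub>R e i) j = (\<Sum>i\<in>F. if j = i then c i else 0)"
        by (subst sum_fun_apply) (auto simp: e_def intro!: sum.cong)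
      then show "c j = (\<Sum>i\<in>F. c i *\<^sub>R e i) j"
        using c assms by (auto simp: supported_on_def)
    qed
    also have "\<dots> \<in> span (e ` F)" by (auto intro: span_sum span_scale span_base)
    finally show "c \<in> span (e ` F)" .
  qed
  have indep: "independent (e ` F)"
    unfolding dependent_def
  proof safe
    fix i assume i: "i \<in> F" "e i \<in> span (e ` F - {e i})"
    have "span (e ` F - {e i}) \<subseteq> {c. c i = 0}"
    proof (rule span_minimal)
      show "e ` F - {e i} \<subseteq> {c. c i = 0}"
        by (auto simp: e_def)
      show "subspace {c. c i = (0::real)}" by (auto simp: subspace_def)
    qed
    from subsetD[OF this i(2)] have "e i i = 0" by simp
    then show False by (simp add: e_def)
  qed
  have "e ` F \<subseteq> supported_on F" by (auto simp: supported_on_def e_def)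
  from basis_card_eq_dim[OF this span indep]
  have "dim (supported_on F :: ('i \<Rightarrow> real) set) = card (e ` F)" by simp
  then show "dim (supported_on F :: ('i \<Rightarrow> real) set) = card F"
    using card_image[OF inj] by simp
  show "\<exists>B. finite B \<and> (supported_on F :: ('i \<Rightarrow> real) set) \<subseteq> span B"
    using span assms by blast
qed

text \<open>
  The complexification of \<open>S\<close>, realised by complex-valued functions. It is treated as a real vector
  space, so that its dimension is twice that of \<open>S\<close>.
\<close>

definition complexified :: "('i \<Rightarrow> real) set \<Rightarrow> ('i \<Rightarrow> complex) set"
  where "complexified S = {f. Re \<circ> f \<in> S \<and> Im \<circ> f \<in> S}"

lemma linear_Re_comp: "linear (\<lambda>f :: 'i \<Rightarrow> complex. Re \<circ> f)"
  and linear_Im_comp: "linear (\<lambda>f :: 'i \<Rightarrow> complex. Im \<circ> f)"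
  by (auto intro!: linearI simp: fun_eq_iff)

lemma subspace_complexified:
  fixes S :: "('i \<Rightarrow> real) set"
  assumes "subspace S" shows "subspace (complexified S)"
proof (rule subspaceI)
  interpret lRe: linear "\<lambda>f :: 'i \<Rightarrow> complex. Re \<circ> f" by (rule linear_Re_comp)
  interpret lIm: linear "\<lambda>f :: 'i \<Rightarrow> complex. Im \<circ> f" by (rule linear_Im_comp)
  show "0 \<in> complexified S"
    using subspace_0[OF assms] lRe.zero lIm.zero by (simp add: complexified_def)
  show "f + g \<in> complexified S" if "f \<in> complexified S" "g \<in> complexified S" for f g
    using that subspace_add[OF assms] unfolding complexified_def mem_Collect_eq lRe.add lIm.add
    by simp
  show "r *\<^sub>R f \<in> complexified S" if "f \<in> complexified S" for f r
    using that subspace_scale[OF assms] unfolding complexified_def mem_Collect_eq lRe.scale lIm.scale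
    by simp
qed

lemma linear_of_real_comp: "linear (\<lambda>f :: 'i \<Rightarrow> real. \<lambda>x. w * complex_of_real (f x))"
  by (auto intro!: linearI simp: fun_eq_iff algebra_simps scaleR_conv_of_real)

lemma complexified_finite_dimensional:
  fixes S :: "('i \<Rightarrow> real) set"
  assumes fin: "S \<subseteq> span C" "finite C"
  shows "\<exists>C'. finite C' \<and> complexified S \<subseteq> span C'"
proof -
  let ?r = "\<lambda>w. \<lambda>f :: 'i \<Rightarrow> real. \<lambda>x. w * complex_of_real (f x)"
  have span: "complexified S \<subseteq> span (?r 1 ` C \<union> ?r \<i> ` C)"
  proof
    fix f assume f: "f \<in> complexified S"
    have split: "f = ?r 1 (Re \<circ> f) + ?r \<i> (Im \<circ> f)"
      by (rule ext) (simp add: complex_eq_iff)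
    have "?r w g \<in> span (?r w ` C)" if "g \<in> S" for w g
      using linear_span_image[OF linear_of_real_comp, of w C] that fin by auto
    from this[of "Re \<circ> f" 1] this[of "Im \<circ> f" \<i>]
    have "?r 1 (Re \<circ> f) \<in> span (?r 1 ` C)" "?r \<i> (Im \<circ> f) \<in> span (?r \<i> ` C)"
      using f unfolding complexified_def by simp_all
    then have "?r 1 (Re \<circ> f) \<in> span (?r 1 ` C \<union> ?r \<i> ` C)" "?r \<i> (Im \<circ> f) \<in> span (?r 1 ` C \<union> ?r \<i> ` C)"
      by (meson span_mono Un_upper1 Un_upper2 subsetD)+
    then show "f \<in> span (?r 1 ` C \<union> ?r \<i> ` C)"
      by (subst split) (rule span_add)
  qed
  moreover have "finite (?r 1 ` C \<union> ?r \<i> ` C)" using fin(2) by simp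
  ultimately show ?thesis by blast
qed

text \<open>
  Taking real parts maps the complexification onto \<open>S\<close>, with kernel \<open>\<i> S\<close>.
\<close>

lemma dim_complexified:
  fixes S :: "('i \<Rightarrow> real) set"
  assumes S: "subspace S" and fin: "S \<subseteq> span C" "finite C"
  shows "dim (complexified S) = 2 * dim S"
proof -
  let ?r = "\<lambda>w. \<lambda>f :: 'i \<Rightarrow> real. \<lambda>x. w * complex_of_real (f x)"
  have parts: "Re \<circ> ?r 1 f = f" "Im \<circ> ?r 1 f = 0" "Re \<circ> ?r \<i> f = 0" "Im \<circ> ?r \<i> f = f" for f
    by (simp_all add: fun_eq_iff)
  have mem: "?r 1 f \<in> complexified S" "?r \<i> f \<in> complexified S" if "f \<in> S" for f
    unfolding complexified_def mem_Collect_eq parts using that subspace_0[OF S] by simp_all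
  obtain C' where C': "finite C'" "complexified S \<subseteq> span C'"
    using complexified_finite_dimensional[OF fin] by blast
  have "dim (complexified S) = dim {f \<in> complexified S. Re \<circ> f = 0} + dim ((\<lambda>f. Re \<circ> f) ` complexified S)"
    by (rule dim_eq_dim_kernel_plus_dim_image[OF linear_Re_comp subspace_complexified[OF S] C'(2,1)])
  also have "(\<lambda>f. Re \<circ> f) ` complexified S = S"
  proof
    show "(\<lambda>f. Re \<circ> f) ` complexified S \<subseteq> S" by (auto simp: complexified_def)
    show "S \<subseteq> (\<lambda>f. Re \<circ> f) ` complexified S"
    proof
      fix g assume "g \<in> S"
      then show "g \<in> (\<lambda>f. Re \<circ> f) ` complexified S"
        by (intro image_eqI[where x = "?r 1 g"] mem) (simp_all only: parts)
    qed
  qed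
  also have "{f \<in> complexified S. Re \<circ> f = 0} = ?r \<i> ` S"
  proof
    show "?r \<i> ` S \<subseteq> {f \<in> complexified S. Re \<circ> f = 0}"
      using mem(2) parts(3) by (simp add: image_subset_iff fun_eq_iff)
    show "{f \<in> complexified S. Re \<circ> f = 0} \<subseteq> ?r \<i> ` S"
    proof safe
      fix f assume f: "f \<in> complexified S" "Re \<circ> f = 0"
      have "f = ?r \<i> (Im \<circ> f)"
        using fun_cong[OF f(2)] by (simp add: fun_eq_iff complex_eq_iff)
      moreover have "Im \<circ> f \<in> S" using f(1) by (simp add: complexified_def)
      ultimately show "f \<in> ?r \<i> ` S" by (rule image_eqI)
    qed
  qed
  also have "dim (?r \<i> ` S) = dim S"
    by (rule dim_linear_image_inj_on[OF linear_of_real_comp S]) (auto simp: fun_eq_iff)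
  finally show ?thesis by simp
qed

section \<open>Ladder operators\<close>

text \<open>
  The claim is strengthened to: \<open>A B + s\<close> is onto on \<open>U (r + 1)\<close> for every \<open>s \<ge> 0\<close>. In this form it
  descends from \<open>r + 1\<close> to \<open>r\<close>, because \<open>A B + s = B A + s'\<close> there with \<open>s' = c r + s > 0\<close>: if \<open>w\<close> solves
  \<open>(A B + s') w = A v\<close> one level up, then \<open>(v - B w) / s'\<close> solves the equation for \<open>v\<close>. The case \<open>s = 0\<close>,
  \<open>r = 0\<close> is the surjectivity of \<open>A\<close>.
\<close>

lemma ladder_surjective:
  fixes A B :: "'v::real_vector \<Rightarrow> 'v" and U :: "nat \<Rightarrow> 'v set" and c :: "nat \<Rightarrow> real"
  assumes A: "linear A" and B: "linear B" and U: "\<And>r. subspace (U r)"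
    and AU: "\<And>r v. v \<in> U r \<Longrightarrow> A v \<in> U (Suc r)"
    and BU: "\<And>r v. v \<in> U (Suc r) \<Longrightarrow> B v \<in> U r"
    and comm: "\<And>r v. r < N \<Longrightarrow> v \<in> U (Suc r) \<Longrightarrow> A (B v) = B (A v) + c r *\<^sub>R v"
    and pos: "\<And>r. r < N \<Longrightarrow> c r > 0"
    and top: "U (Suc N) = {0}"
  shows "A ` U 0 = U 1"
proof -
  interpret A: linear A by fact
  interpret B: linear B by fact
  have shifted: "\<forall>v\<in>U (Suc r). \<forall>s\<ge>0. \<exists>u\<in>U (Suc r). A (B u) + s *\<^sub>R u = v" if "r \<le> N" for r
    using that
  proof (induction r rule: inc_induct)
    case base
    show ?case using top by (auto simp: A.zero B.zero)
  next
    case (step r)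
    show ?case
    proof (intro ballI allI impI)
      fix v and s :: real assume v: "v \<in> U (Suc r)" and s: "s \<ge> 0"
      define s' where "s' = c r + s"
      have s': "s' > 0" using pos[of r] step.hyps s by (auto simp: s'_def)
      obtain w where w: "w \<in> U (Suc (Suc r))" "A (B w) + s' *\<^sub>R w = A v"
        using step.IH AU[OF v] s' by (meson less_imp_le)
      define u where "u = (1 / s') *\<^sub>R (v - B w)"
      have u: "u \<in> U (Suc r)"
        unfolding u_def using v BU[OF w(1)] U by (intro subspace_scale subspace_diff) auto
      have "A (B u) + s *\<^sub>R u = B (A u) + s' *\<^sub>R u"
        using comm[OF _ u] step.hyps by (simp add: s'_def scaleR_left_distrib)
      also have "A u = (1 / s') *\<^sub>R (A v - A (B w))"
        by (simp add: u_def A.scale A.diff)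
      also have "A v - A (B w) = s' *\<^sub>R w" by (simp add: w(2)[symmetric])
      also have "B ((1 / s') *\<^sub>R s' *\<^sub>R w) + s' *\<^sub>R u = v"
        using s' by (simp add: u_def)
      finally show "\<exists>u\<in>U (Suc r). A (B u) + s *\<^sub>R u = v" using u by blast
    qed
  qed
  show ?thesis
  proof
    show "A ` U 0 \<subseteq> U 1" using AU by auto
    show "U 1 \<subseteq> A ` U 0"
    proof
      fix v assume v: "v \<in> U 1"
      then obtain u where "u \<in> U 1" "A (B u) + 0 *\<^sub>R u = v"
        using shifted[of 0] by force
      then show "v \<in> A ` U 0" using BU[of u 0] by (intro image_eqI[where x = "B u"]) auto
    qed
  qed
qed

section \<open>Symmetric multilinear forms\<close>

text \<open>
  A homogeneous polynomial of degree \<open>d\<close> is represented by its polarisation, a symmetric \<open>d\<close>-linear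
  form; being symmetric, the form is a function of the multiset of its arguments. On multisets of
  a size other than \<open>d\<close> it is \<open>0\<close>, so that forms of different degrees can be told apart.
\<close>

definition multilinear :: "('u::real_vector multiset \<Rightarrow> 'b::real_vector) \<Rightarrow> bool"
  where "multilinear t \<longleftrightarrow> (\<forall>Z. linear (\<lambda>z. t (add_mset z Z)))"

definition symm_forms :: "nat \<Rightarrow> ('u::real_vector multiset \<Rightarrow> 'b::real_vector) set"
  where "symm_forms d = {t. multilinear t \<and> (\<forall>Z. size Z \<noteq> d \<longrightarrow> t Z = 0)}"

text \<open>
  In terms of polynomials, the next four operators are: the directional derivative along \<open>u\<close>; the
  derivation given by the linear vector field \<open>A\<close>; the multiplications by the linear function \<open>l\<close> and
  by the quadratic function \<open>z \<mapsto> q z z\<close>. All but the second carry a factor that depends only on the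
  degree.
\<close>

definition contract :: "'u \<Rightarrow> ('u multiset \<Rightarrow> 'b) \<Rightarrow> 'u multiset \<Rightarrow> 'b"
  where "contract u t = (\<lambda>Z. t (add_mset u Z))"

definition derivation :: "('u \<Rightarrow> 'u) \<Rightarrow> ('u multiset \<Rightarrow> 'b::comm_monoid_add) \<Rightarrow> 'u multiset \<Rightarrow> 'b"
  where "derivation A t = (\<lambda>Z. \<Sum>z\<in>#Z. t (add_mset (A z) (Z - {#z#})))"

definition times_linear :: "('u \<Rightarrow> real) \<Rightarrow> ('u multiset \<Rightarrow> real) \<Rightarrow> 'u multiset \<Rightarrow> real"
  where "times_linear l t = (\<lambda>Z. \<Sum>z\<in>#Z. l z * t (Z - {#z#}))"

definition times_quadratic :: "('u \<Rightarrow> 'u \<Rightarrow> real) \<Rightarrow> ('u multiset \<Rightarrow> real) \<Rightarrow> 'u multiset \<Rightarrow> real"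
  where "times_quadratic q t = (\<lambda>Z. \<Sum>z\<in>#Z. times_linear (q z) t (Z - {#z#}))"

lemma symm_forms_multilinear: "t \<in> symm_forms d \<Longrightarrow> multilinear t"
  and symm_forms_size: "t \<in> symm_forms d \<Longrightarrow> size Z \<noteq> d \<Longrightarrow> t Z = 0"
  by (simp_all add: symm_forms_def)

lemma contract_apply: "contract u t Z = t (add_mset u Z)"
  by (simp add: contract_def)

lemma multilinear_add: "multilinear t \<Longrightarrow> t (add_mset (u + v) Z) = t (add_mset u Z) + t (add_mset v Z)"
  and multilinear_scale: "multilinear t \<Longrightarrow> t (add_mset (r *\<^sub>R u) Z) = r *\<^sub>R t (add_mset u Z)"
  and multilinear_minus: "multilinear t \<Longrightarrow> t (add_mset (- u) Z) = - t (add_mset u Z)"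
  and multilinear_zero: "multilinear t \<Longrightarrow> t (add_mset 0 Z) = 0"
  using linear_add[of "\<lambda>z. t (add_mset z Z)"] linear_scale[of "\<lambda>z. t (add_mset z Z)"]
    linear_neg[of "\<lambda>z. t (add_mset z Z)"] linear_0[of "\<lambda>z. t (add_mset z Z)"]
  by (auto simp: multilinear_def)

lemma multilinear_sum:
  "multilinear t \<Longrightarrow> t (add_mset (\<Sum>i\<in>I. f i) Z) = (\<Sum>i\<in>I. t (add_mset (f i) Z))"
  using linear_sum[of "\<lambda>z. t (add_mset z Z)" f I] by (auto simp: multilinear_def)

lemma linearI_multilinear: "multilinear t \<Longrightarrow> linear A \<Longrightarrow> linear (\<lambda>z. t (add_mset (A z) Z))"
  using linear_compose[of A "\<lambda>z. t (add_mset z Z)"] by (auto simp: multilinear_def o_def)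

lemma multilinear_contract: "multilinear t \<Longrightarrow> multilinear (contract u t)"
  by (simp add: multilinear_def contract_def add_mset_commute[of u])

lemma contract_commute: "contract u (contract v t) = contract v (contract u t)"
  by (simp add: contract_def add_mset_commute)

lemma linear_sum_fun: "(\<And>i. i \<in> I \<Longrightarrow> linear (f i)) \<Longrightarrow> linear (\<lambda>z. \<Sum>i\<in>I. f i z)"
  by (rule linear_compose_sum) auto

lemma subspace_symm_forms: "subspace (symm_forms d :: ('u::real_vector multiset \<Rightarrow> 'b::real_vector) set)"
  unfolding subspace_def symm_forms_def multilinear_def
  by (auto intro!: linear_compose_add linear_compose_scale_right simp: linear_zero)

lemma remove_from_add_mset: "x \<in># Z \<Longrightarrow> add_mset z Z - {#x#} = add_mset z (Z - {#x#})"
  by (auto dest!: multi_member_split simp: add_mset_commute[of z x])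

lemma sum_mset_eq_0:
  fixes f :: "'x \<Rightarrow> 'b::comm_monoid_add"
  assumes "\<And>x. x \<in># X \<Longrightarrow> f x = 0"
  shows "(\<Sum>x\<in>#X. f x) = 0"
proof -
  have "image_mset f X = image_mset (\<lambda>_. 0) X" using assms by (rule image_mset_cong)
  then show ?thesis by simp
qed

lemma derivation_empty [simp]: "derivation A t {#} = 0"
  by (simp add: derivation_def)

text \<open>
  The Leibniz rule. Together with the value \<open>0\<close> at the empty multiset it determines the operator,
  so identities between operators can be proved by induction on the multiset, for all forms at
  once. The operators \<open>times_linear\<close> and \<open>times_quadratic\<close> are handled in the same way.
\<close>

lemma derivation_add_mset:
  "derivation A t (add_mset z Z) = t (add_mset (A z) Z) + derivation A (contract z t) Z"
proof -
  have "(\<Sum>x\<in>#Z. t (add_mset (A x) (add_mset z Z - {#x#})))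
      = (\<Sum>x\<in>#Z. t (add_mset z (add_mset (A x) (Z - {#x#}))))"
    by (intro arg_cong[where f = sum_mset] image_mset_cong)
       (simp add: remove_from_add_mset add_mset_commute[of "A _" z])
  then show ?thesis by (simp add: derivation_def contract_def)
qed

lemma contract_derivation:
  "contract z (derivation A t) = contract (A z) t + derivation A (contract z t)"
  by (rule ext) (simp add: contract_apply derivation_add_mset)

lemma derivation_add: "derivation A (t + s) Z = derivation A t Z + derivation A s Z"
  by (simp add: derivation_def sum_mset.distrib)

lemma linear_sum_mset: "(\<And>x. linear (f x)) \<Longrightarrow> linear (\<lambda>z. \<Sum>x\<in>#X. f x z)"
  by (induction X) (auto intro: linear_compose_add simp: linear_zero)

lemma derivation_scale:
  fixes t :: "'u multiset \<Rightarrow> 'b::real_vector"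
  shows "derivation A (\<lambda>Z. r *\<^sub>R t Z) Z = r *\<^sub>R derivation A t Z"
proof -
  have "(\<Sum>z\<in>#W. r *\<^sub>R f z) = r *\<^sub>R (\<Sum>z\<in>#W. f z)" for f :: "'u \<Rightarrow> 'b" and W
    by (induction W) (auto simp: scaleR_add_right)
  then show ?thesis by (simp add: derivation_def)
qed

lemma linear_derivation: "linear (derivation A :: ('u multiset \<Rightarrow> 'b::real_vector) \<Rightarrow> _)"
  by (rule linearI) (auto simp: fun_eq_iff derivation_add derivation_scale scaleR_fun_def)

lemma symm_forms_derivation:
  assumes "t \<in> symm_forms d" "linear A"
  shows "derivation A t \<in> symm_forms d"
proof -
  have t: "multilinear t" using assms(1) by (auto simp: symm_forms_def)
  have "linear (\<lambda>z. \<Sum>x\<in>#Z. t (add_mset z (add_mset (A x) (Z - {#x#}))))" for Z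
    using t by (intro linear_sum_mset) (auto simp: multilinear_def)
  then have "multilinear (derivation A t)"
    unfolding multilinear_def derivation_add_mset
    using linearI_multilinear[OF t assms(2)]
    by (auto simp: derivation_def contract_def add_mset_commute intro!: linear_compose_add)
  moreover have "derivation A t Z = 0" if Z: "size Z \<noteq> d" for Z
  proof -
    have "t (add_mset (A z) (Z - {#z#})) = 0" if "z \<in># Z" for z
    proof -
      have "size (add_mset (A z) (Z - {#z#})) = size Z" using size_Suc_Diff1[OF that] by simp
      then show ?thesis using symm_forms_size[OF assms(1)] Z by simp
    qed
    then show ?thesis unfolding derivation_def by (rule sum_mset_eq_0)
  qed
  ultimately show ?thesis by (simp add: symm_forms_def)
qed

text \<open>
  Composition appears in reverse order because the vector fields act on arguments of the form.
\<close>

lemma derivation_commutator: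
  fixes t :: "'u multiset \<Rightarrow> 'b::ab_group_add"
  shows "derivation A (derivation B t) Z + derivation (\<lambda>z. A (B z)) t Z
       = derivation B (derivation A t) Z + derivation (\<lambda>z. B (A z)) t Z"
proof (induction Z arbitrary: t)
  case (add z Z)
  have "derivation A (derivation B (contract z t)) Z + derivation (\<lambda>z. A (B z)) (contract z t) Z
      = derivation B (derivation A (contract z t)) Z + derivation (\<lambda>z. B (A z)) (contract z t) Z"
    by (rule add.IH)
  then show ?case
    by (simp add: derivation_add_mset contract_derivation derivation_add contract_apply algebra_simps)
qed simp

lemma derivation_id:
  fixes t :: "'u multiset \<Rightarrow> 'b::real_vector"
  shows "derivation (\<lambda>z. z) t Z = real (size Z) *\<^sub>R t Z"
  by (induction Z arbitrary: t) (simp_all add: derivation_add_mset contract_apply scaleR_left_distrib)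

lemma derivation_plus:
  "multilinear t \<Longrightarrow> derivation (\<lambda>z. A z + B z) t Z = derivation A t Z + derivation B t Z"
  by (simp add: derivation_def multilinear_add sum_mset.distrib)

lemma times_linear_empty [simp]: "times_linear l t {#} = 0"
  by (simp add: times_linear_def)

lemma times_linear_add_mset:
  "times_linear l t (add_mset z Z) = l z * t Z + times_linear l (contract z t) Z"
proof -
  have "(\<Sum>x\<in>#Z. l x * t (add_mset z Z - {#x#})) = (\<Sum>x\<in>#Z. l x * t (add_mset z (Z - {#x#})))"
    by (intro arg_cong[where f = sum_mset] image_mset_cong) (simp add: remove_from_add_mset)
  then show ?thesis by (simp add: times_linear_def contract_def)
qed

lemma contract_times_linear:
  "contract z (times_linear l t) = (\<lambda>Z. l z * t Z) + times_linear l (contract z t)"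
  by (rule ext) (simp add: contract_apply times_linear_add_mset)

lemma times_linear_add: "times_linear l (t + s) Z = times_linear l t Z + times_linear l s Z"
  and times_linear_scale: "times_linear l (\<lambda>Z. r * t Z) Z = r * times_linear l t Z"
  and times_linear_add_left: "times_linear (\<lambda>z. l z + l' z) t Z = times_linear l t Z + times_linear l' t Z"
  and times_linear_scale_left: "times_linear (\<lambda>z. r * l z) t Z = r * times_linear l t Z"
  by (simp_all add: times_linear_def distrib_left distrib_right sum_mset.distrib sum_mset_distrib_left
        mult.left_commute mult.assoc)

lemma linear_times_const: "linear f \<Longrightarrow> linear (\<lambda>z. f z * (c::real))"
  using linear_compose_scale_right[of f c] by (simp add: mult.commute)

lemma symm_forms_times_linear:
  assumes "t \<in> symm_forms d" "linear l"
  shows "times_linear l t \<in> symm_forms (Suc d)"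
proof -
  have t: "multilinear t" using assms(1) by (auto simp: symm_forms_def)
  have "linear (\<lambda>z. \<Sum>x\<in>#Z. l x * t (add_mset z (Z - {#x#})))" for Z
  proof (rule linear_sum_mset)
    fix x
    have "linear (\<lambda>z. t (add_mset z (Z - {#x#})))" using t by (auto simp: multilinear_def)
    from linear_compose_scale_right[OF this, of "l x"]
    show "linear (\<lambda>z. l x * t (add_mset z (Z - {#x#})))" by simp
  qed
  moreover have "linear (\<lambda>z. l z * t Z)" for Z
    by (rule linear_times_const[OF assms(2)])
  ultimately have "multilinear (times_linear l t)"
    unfolding multilinear_def times_linear_add_mset
    by (auto simp: times_linear_def contract_def intro!: linear_compose_add)
  moreover have "times_linear l t Z = 0" if Z: "size Z \<noteq> Suc d" for Z
  proof -
    have "t (Z - {#z#}) = 0" if "z \<in># Z" for z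
    proof -
      have "size (Z - {#z#}) \<noteq> d" using size_Suc_Diff1[OF that] Z by simp
      then show ?thesis by (rule symm_forms_size[OF assms(1)])
    qed
    then show ?thesis unfolding times_linear_def by (intro sum_mset_eq_0) simp
  qed
  ultimately show ?thesis by (simp add: symm_forms_def)
qed

lemma derivation_times_linear:
  "derivation A (times_linear l t) Z = times_linear l (derivation A t) Z + times_linear (\<lambda>z. l (A z)) t Z"
proof (induction Z arbitrary: t)
  case (add z Z)
  have "derivation A (times_linear l (contract z t)) Z
      = times_linear l (derivation A (contract z t)) Z + times_linear (\<lambda>z. l (A z)) (contract z t) Z"
    by (rule add.IH)
  then show ?case
    using derivation_scale[of A "l z" t Z]
    by (simp add: derivation_add_mset times_linear_add_mset contract_times_linear contract_derivation
        derivation_add times_linear_add contract_apply algebra_simps)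
qed simp

lemma times_quadratic_empty [simp]: "times_quadratic q t {#} = 0"
  by (simp add: times_quadratic_def)

lemma times_quadratic_add_mset:
  assumes sym: "\<And>u v. q u v = q v u"
  shows "times_quadratic q t (add_mset z Z) = 2 * times_linear (q z) t Z + times_quadratic q (contract z t) Z"
proof -
  have "(\<Sum>x\<in>#Z. times_linear (q x) t (add_mset z Z - {#x#}))
      = (\<Sum>x\<in>#Z. q z x * t (Z - {#x#}) + times_linear (q x) (contract z t) (Z - {#x#}))"
    by (intro arg_cong[where f = sum_mset] image_mset_cong)
       (simp add: remove_from_add_mset times_linear_add_mset sym)
  then show ?thesis
    by (simp add: times_quadratic_def sum_mset.distrib times_linear_def)
qed

lemma contract_times_quadratic:
  assumes sym: "\<And>u v. q u v = q v u"
  shows "contract z (times_quadratic q t)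
       = (\<lambda>Z. 2 * times_linear (q z) t Z) + times_quadratic q (contract z t)"
  by (rule ext) (simp add: contract_apply times_quadratic_add_mset[of q, OF sym])

lemma times_quadratic_add: "times_quadratic q (t + s) Z = times_quadratic q t Z + times_quadratic q s Z"
  and times_quadratic_scale: "times_quadratic q (\<lambda>Z. r * t Z) Z = r * times_quadratic q t Z"
  by (simp_all add: times_quadratic_def times_linear_add times_linear_scale sum_mset.distrib sum_mset_distrib_left)

lemma linear_times_quadratic: "linear (times_quadratic q)"
  by (rule linearI) (auto simp: fun_eq_iff times_quadratic_add times_quadratic_scale scaleR_fun_def)

lemma symm_forms_times_quadratic:
  assumes "t \<in> symm_forms d" "\<And>z. linear (q z)" and sym: "\<And>u v. q u v = q v u"
  shows "times_quadratic q t \<in> symm_forms (Suc (Suc d))"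
proof -
  have lin: "times_linear (q z) t \<in> symm_forms (Suc d)" for z
    using symm_forms_times_linear assms by blast
  have ml: "linear (\<lambda>z. times_quadratic q t (add_mset z Z))" for Z
  proof -
    have "linear (\<lambda>z. times_linear (q z) t Z)"
    proof -
      have "linear (\<lambda>z. q z x * t (Z - {#x#}))" for x
        using linear_times_const[OF assms(2)[of x], of "t (Z - {#x#})"] by (simp add: sym[of x])
      then show ?thesis unfolding times_linear_def by (rule linear_sum_mset)
    qed
    from linear_compose_scale_right[OF this, of 2]
    have 1: "linear (\<lambda>z. 2 * times_linear (q z) t Z)" by simp
    have 2: "linear (\<lambda>z. \<Sum>x\<in>#Z. times_linear (q x) t (add_mset z (Z - {#x#})))"
      using lin by (intro linear_sum_mset) (auto simp: symm_forms_def multilinear_def)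
    have "(\<lambda>z. times_quadratic q t (add_mset z Z))
        = (\<lambda>z. times_linear (q z) t Z + (\<Sum>x\<in>#Z. times_linear (q x) t (add_mset z (Z - {#x#}))))"
    proof
      fix z
      have "(\<Sum>x\<in>#Z. times_linear (q x) t (add_mset z Z - {#x#}))
      = (\<Sum>x\<in>#Z. times_linear (q x) t (add_mset z (Z - {#x#})))"
        by (intro arg_cong[where f = sum_mset] image_mset_cong) (simp add: remove_from_add_mset)
      then show "times_quadratic q t (add_mset z Z)
        = times_linear (q z) t Z + (\<Sum>x\<in>#Z. times_linear (q x) t (add_mset z (Z - {#x#})))"
        by (simp add: times_quadratic_def)
    qed
    then show ?thesis using linear_compose_add[OF \<open>linear (\<lambda>z. times_linear (q z) t Z)\<close> 2] by simp
  qed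
  have "times_quadratic q t Z = 0" if Z: "size Z \<noteq> Suc (Suc d)" for Z
  proof -
    have "times_linear (q z) t (Z - {#z#}) = 0" if "z \<in># Z" for z
    proof -
      have "size (Z - {#z#}) \<noteq> Suc d" using size_Suc_Diff1[OF that] Z by simp
      then show ?thesis by (rule symm_forms_size[OF lin])
    qed
    then show ?thesis unfolding times_quadratic_def by (rule sum_mset_eq_0)
  qed
  with ml show ?thesis by (simp add: symm_forms_def multilinear_def)
qed

text \<open>
  The hypothesis \<open>inv\<close> says that the vector field \<open>A\<close> rescales the quadratic form infinitesimally by
  \<open>c\<close>.
\<close>

lemma derivation_times_quadratic:
  assumes sym: "\<And>u v. q u v = q v u" and inv: "\<And>u v. q (A u) v + q u (A v) = c * q u v"
  shows "derivation A (times_quadratic q t) Z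
       = times_quadratic q (derivation A t) Z + c * times_quadratic q t Z"
proof (induction Z arbitrary: t)
  case (add z Z)
  have "times_linear (q (A z)) t Z + times_linear (\<lambda>w. q z (A w)) t Z = c * times_linear (q z) t Z"
    by (simp add: times_linear_add_left[symmetric] times_linear_scale_left[symmetric] inv o_def)
  then have "2 * times_linear (q (A z)) t Z + 2 * times_linear (\<lambda>w. q z (A w)) t Z
      = 2 * (c * times_linear (q z) t Z)"
    by simp
  moreover have "derivation A (times_quadratic q (contract z t)) Z
      = times_quadratic q (derivation A (contract z t)) Z + c * times_quadratic q (contract z t) Z"
    by (rule add.IH)
  ultimately show ?case
    using derivation_scale[of A 2 "times_linear (q z) t" Z]
    by (simp add: derivation_add_mset times_quadratic_add_mset[of q, OF sym] contract_times_quadratic[of q, OF sym]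
        contract_derivation derivation_add times_quadratic_add contract_apply derivation_times_linear algebra_simps)
qed simp

section \<open>Polarisation\<close>

lemma has_derivative_power_form:
  fixes t :: "'u::real_vector multiset \<Rightarrow> real"
  assumes t: "multilinear t"
  shows "((\<lambda>s. t (Z + replicate_mset n (z + s *\<^sub>R w))) has_real_derivative
          real n * t (Z + add_mset w (replicate_mset (n - 1) z))) (at 0)"
proof (induction n arbitrary: Z)
  case (Suc n)
  have eq: "(\<lambda>s. t (Z + replicate_mset (Suc n) (z + s *\<^sub>R w))) =
        (\<lambda>s. t (add_mset z Z + replicate_mset n (z + s *\<^sub>R w)) + s * t (add_mset w Z + replicate_mset n (z + s *\<^sub>R w)))"
    using t by (simp add: multilinear_add multilinear_scale)
  have cont: "((\<lambda>s. t (add_mset w Z + replicate_mset n (z + s *\<^sub>R w))) has_real_derivative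
          real n * t (add_mset w Z + add_mset w (replicate_mset (n - 1) z))) (at 0)"
    by (rule Suc.IH)
  show ?case
    unfolding eq
  proof (rule DERIV_cong[OF DERIV_add[OF Suc.IH DERIV_mult[OF DERIV_ident cont]]])
    show "real n * t (add_mset z Z + add_mset w (replicate_mset (n - 1) z)) +
      (1 * t (add_mset w Z + replicate_mset n (z + 0 *\<^sub>R w)) +
       real n * t (add_mset w Z + add_mset w (replicate_mset (n - 1) z)) * 0)
      = real (Suc n) * t (Z + add_mset w (replicate_mset (Suc n - 1) z))"
      by (cases n) (simp_all add: add_mset_commute algebra_simps)
  qed
qed simp

text \<open>
  The derivative at \<open>s = 0\<close> of the vanishing function \<open>s \<mapsto> t (z + s w, \<dots>, z + s w)\<close>.
\<close>

lemma polarise_once: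
  fixes t :: "'u::real_vector multiset \<Rightarrow> real"
  assumes t: "multilinear t" and zero: "\<And>z. t (Z + replicate_mset n z) = 0" and n: "n > 0"
  shows "t (Z + add_mset w (replicate_mset (n - 1) z)) = 0"
proof -
  have "((\<lambda>s::real. 0::real) has_real_derivative real n * t (Z + add_mset w (replicate_mset (n - 1) z))) (at 0)"
    using has_derivative_power_form[OF t, of Z n z w] unfolding zero .
  from DERIV_unique[OF this DERIV_const[of 0]] show ?thesis using n by simp
qed

lemma symm_form_eq_0_if_diagonal_eq_0:
  fixes t :: "'u::real_vector multiset \<Rightarrow> real"
  assumes t: "t \<in> symm_forms d" and diag: "\<And>z. t (replicate_mset d z) = 0"
  shows "t = 0"
proof -
  have ml: "multilinear t" using t by (auto simp: symm_forms_def)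
  have "\<forall>Z z. size Z = d - j \<longrightarrow> t (Z + replicate_mset j z) = 0" if "j \<le> d" for j
    using that
  proof (induction rule: inc_induct)
    case base
    then show ?case using diag by simp
  next
    case (step j)
    show ?case
    proof (intro allI impI)
      fix Z :: "'u multiset" and z :: 'u assume Z: "size Z = d - j"
      then obtain w Z' where Z': "Z = add_mset w Z'" "size Z' = d - Suc j"
        using step.hyps by (metis Suc_diff_Suc size_eq_Suc_imp_eq_union nat.inject size_add_mset)
      have "t (Z' + replicate_mset (Suc j) z) = 0" for z
        using step.IH Z'(2) by blast
      from polarise_once[OF ml this, of w z]
      show "t (Z + replicate_mset j z) = 0" using Z'(1) by simp
    qed
  qed
  from this[of 0] have "t Z = 0" if "size Z = d" for Z using that by simp
  then show ?thesis using t by (auto simp: symm_forms_def fun_eq_iff)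
qed

lemma derivation_diagonal:
  fixes t :: "'u multiset \<Rightarrow> 'b::real_vector"
  shows "derivation A t (replicate_mset d z) = real d *\<^sub>R t (add_mset (A z) (replicate_mset (d - 1) z))"
proof (induction d arbitrary: t)
  case (Suc d)
  have "derivation A t (replicate_mset (Suc d) z)
      = t (add_mset (A z) (replicate_mset d z)) + derivation A (contract z t) (replicate_mset d z)"
    by (simp only: replicate_mset_Suc derivation_add_mset)
  also have "derivation A (contract z t) (replicate_mset d z) = real d *\<^sub>R t (add_mset (A z) (replicate_mset d z))"
    unfolding Suc.IH by (cases d) (simp_all add: contract_apply add_mset_commute)
  finally show ?case by (simp add: scaleR_left_distrib)
qed simp

text \<open>
  The expansion of \<open>(X + s Y)\<^sup>j\<close> for the commuting shifts \<open>X: p \<mapsto> p + 1\<close> and \<open>Y: q \<mapsto> q + 1\<close>.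
\<close>

lemma binomial_recurrence:
  fixes W :: "nat \<Rightarrow> nat \<Rightarrow> nat \<Rightarrow> real"
  assumes "\<And>j p q. W (Suc j) p q = W j (Suc p) q + s * W j p (Suc q)"
  shows "W j p q = (\<Sum>i\<le>j. real (j choose i) * s ^ i * W 0 (p + (j - i)) (q + i))"
proof (induction j arbitrary: p q)
  case (Suc j)
  let ?T = "\<lambda>i. s ^ i * W 0 (p + (Suc j - i)) (q + i)"
  have "W (Suc j) p q = (\<Sum>i\<le>j. real (j choose i) * ?T i) + (\<Sum>i\<le>j. real (j choose i) * ?T (Suc i))"
    unfolding assms Suc.IH sum_distrib_left
    by (intro arg_cong2[where f = "(+)"] sum.cong) (simp_all add: Suc_diff_le algebra_simps)
  also have "(\<Sum>i\<le>j. real (j choose i) * ?T i) = (\<Sum>i\<le>Suc j. real (j choose i) * ?T i)" by simp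
  also have "\<dots> = ?T 0 + (\<Sum>i\<le>j. real (j choose Suc i) * ?T (Suc i))"
    unfolding sum.atMost_Suc_shift by simp
  also have "\<dots> + (\<Sum>i\<le>j. real (j choose i) * ?T (Suc i)) = ?T 0 + (\<Sum>i\<le>j. real (Suc j choose Suc i) * ?T (Suc i))"
    by (simp add: sum.distrib[symmetric] distrib_right[symmetric] add.commute del: power_Suc)
  also have "\<dots> = (\<Sum>i\<le>Suc j. real (Suc j choose i) * ?T i)"
    unfolding sum.atMost_Suc_shift by simp
  finally show ?case by (simp add: mult.assoc)
qed simp

lemma binomial_form:
  fixes t :: "'u::real_vector multiset \<Rightarrow> real"
  assumes t: "multilinear t"
  shows "t (Z + replicate_mset n (u + v)) =
    (\<Sum>i\<le>n. real (n choose i) * t (Z + replicate_mset i u + replicate_mset (n - i) v))"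
proof -
  define W where "W j p q = t (Z + replicate_mset q u + replicate_mset p v + replicate_mset j (u + v))" for j p q
  have "W (Suc j) p q = W j (Suc p) q + 1 * W j p (Suc q)" for j p q
    by (simp add: W_def multilinear_add[OF t])
  from binomial_recurrence[of W 1, OF this, of n 0 0] show ?thesis by (simp add: W_def)
qed

section \<open>The commuting operators on forms in two vectors\<close>

text \<open>
  From here on the polynomials live on pairs \<open>(x, y)\<close>. As vector fields, \<open>proj_fst\<close> and \<open>proj_snd\<close>
  measure the degrees in \<open>x\<close> and \<open>y\<close>, and \<open>fst_to_snd\<close> and \<open>snd_to_fst\<close> are the polarisations \<open>x \<cdot> \<partial>\<^sub>y\<close> and
  \<open>y \<cdot> \<partial>\<^sub>x\<close>, which generate the shears.
\<close>

definition proj_fst :: "'a::zero \<times> 'a \<Rightarrow> 'a \<times> 'a" where "proj_fst z = (fst z, 0)"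
definition proj_snd :: "'a::zero \<times> 'a \<Rightarrow> 'a \<times> 'a" where "proj_snd z = (0, snd z)"
definition fst_to_snd :: "'a::zero \<times> 'a \<Rightarrow> 'a \<times> 'a" where "fst_to_snd z = (0, fst z)"
definition snd_to_fst :: "'a::zero \<times> 'a \<Rightarrow> 'a \<times> 'a" where "snd_to_fst z = (snd z, 0)"
definition on_both :: "('a \<Rightarrow> 'a) \<Rightarrow> 'a \<times> 'a \<Rightarrow> 'a \<times> 'a" where "on_both J z = (J (fst z), J (snd z))"

text \<open>
  The polarisation of the quadratic function \<open>(x, y) \<mapsto> 2 (x \<bullet> J y)\<close>.
\<close>

definition J_pairing :: "('a::real_inner \<Rightarrow> 'a) \<Rightarrow> 'a \<times> 'a \<Rightarrow> 'a \<times> 'a \<Rightarrow> real"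
  where "J_pairing J z w = fst z \<bullet> J (snd w) + fst w \<bullet> J (snd z)"

text \<open>
  Up to a factor that depends on the degree, the operator \<open>J\<^sup>\<alpha>\<^sup>\<beta> \<partial>\<^sub>\<alpha> \<partial>\<^sub>\<beta>\<close> with the first derivative in
  \<open>x\<close> and the second one in \<open>y\<close>: the sum over both basis indices is already contracted with the matrix
  of \<open>J\<close>.
\<close>

definition J_laplacian :: "('a::euclidean_space \<Rightarrow> 'a) \<Rightarrow> (('a \<times> 'a) multiset \<Rightarrow> real) \<Rightarrow> ('a \<times> 'a) multiset \<Rightarrow> real"
  where "J_laplacian J t = (\<lambda>Z. \<Sum>b\<in>Basis. t (add_mset (J b, 0) (add_mset (0, b) Z)))"

text \<open>
  The \<open>J\<close>-invariant polynomials of degree \<open>a\<close> in \<open>x\<close> and \<open>d - a\<close> in \<open>y\<close>. The weight \<open>a\<close> is a real number so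
  that it can be lowered without truncation; the space is \<open>0\<close> unless \<open>a\<close> is one of \<open>0, \<dots>, d\<close>.
\<close>

definition weight_forms :: "('a::real_vector \<Rightarrow> 'a) \<Rightarrow> nat \<Rightarrow> real \<Rightarrow> (('a \<times> 'a) multiset \<Rightarrow> real) set"
  where "weight_forms J d a =
    {t \<in> symm_forms d. derivation proj_fst t = a *\<^sub>R t \<and> derivation (on_both J) t = 0}"

text \<open>
  The polynomial model of the \<open>J\<close>-invariant part of the Young module.
\<close>

definition invariant_forms :: "('a::real_vector \<Rightarrow> 'a) \<Rightarrow> nat \<Rightarrow> (('a \<times> 'a) multiset \<Rightarrow> real) set"
  where "invariant_forms J k = {t \<in> weight_forms J (2 * k) (real k). derivation fst_to_snd t = 0}"

lemma linear_pair_maps: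
  "linear (proj_fst :: 'a::real_vector \<times> 'a \<Rightarrow> _)" "linear (proj_snd :: 'a \<times> 'a \<Rightarrow> _)"
  "linear (fst_to_snd :: 'a \<times> 'a \<Rightarrow> _)" "linear (snd_to_fst :: 'a \<times> 'a \<Rightarrow> _)"
  by (auto intro!: linearI simp: proj_fst_def proj_snd_def fst_to_snd_def snd_to_fst_def)

lemma linear_on_both: "linear J \<Longrightarrow> linear (on_both J)"
  by (auto intro!: linearI simp: on_both_def linear_add linear_scale)

lemma linear_slot_fst: "multilinear t \<Longrightarrow> linear f \<Longrightarrow> linear (\<lambda>x. t (add_mset (f x, 0) Z))"
  and linear_slot_snd: "multilinear t \<Longrightarrow> linear f \<Longrightarrow> linear (\<lambda>x. t (add_mset (0, f x) Z))"
  using linearI_multilinear[of t "\<lambda>x. (f x, 0)" Z] linearI_multilinear[of t "\<lambda>x. (0, f x)" Z]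
  by (auto simp: linear_iff)

lemma derivation_proj_fst_split:
  fixes t :: "('a::real_vector \<times> 'a) multiset \<Rightarrow> real"
  assumes "multilinear t"
  shows "derivation proj_fst t (replicate_mset i (x, 0) + replicate_mset j (0, y))
       = real i * t (replicate_mset i (x, 0) + replicate_mset j (0, y))"
  using assms
proof (induction i arbitrary: t)
  case 0
  have "t (add_mset (0, 0) Z) = 0" for Z
    using multilinear_zero[OF 0] by (simp add: zero_prod_def)
  then show ?case by (simp add: derivation_diagonal proj_fst_def)
next
  case (Suc i)
  have "derivation proj_fst t (add_mset (x, 0) (replicate_mset i (x, 0) + replicate_mset j (0, y)))
     = t (add_mset (x, 0) (replicate_mset i (x, 0) + replicate_mset j (0, y)))
       + derivation proj_fst (contract (x, 0) t) (replicate_mset i (x, 0) + replicate_mset j (0, y))"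
    by (simp add: derivation_add_mset proj_fst_def)
  also have "derivation proj_fst (contract (x, 0) t) (replicate_mset i (x, 0) + replicate_mset j (0, y))
     = real i * contract (x, 0) t (replicate_mset i (x, 0) + replicate_mset j (0, y))"
    by (rule Suc.IH) (rule multilinear_contract[OF Suc.prems])
  finally show ?case by (simp add: contract_apply algebra_simps)
qed

lemma split_form_eq_0:
  fixes t :: "('a::real_vector \<times> 'a) multiset \<Rightarrow> real"
  assumes t: "t \<in> symm_forms d" "derivation proj_fst t = a *\<^sub>R t" and i: "real i \<noteq> a"
  shows "t (replicate_mset i (x, 0) + replicate_mset j (0, y)) = 0"
  using derivation_proj_fst_split[OF symm_forms_multilinear[OF t(1)], of i x j y] i t(2) by simp

lemma derivation_add_fun: "derivation A (s + t) = derivation A s + derivation A t"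
  for t :: "'u multiset \<Rightarrow> real"
  by (rule linear_add[OF linear_derivation])

lemma derivation_scaleR: "derivation A (r *\<^sub>R t) = r *\<^sub>R derivation A t"
  for t :: "'u multiset \<Rightarrow> real"
  by (rule linear_scale[OF linear_derivation])

lemma derivation_0: "derivation A 0 = (0 :: 'u multiset \<Rightarrow> real)"
  by (rule linear_0[OF linear_derivation])

lemma subspace_kernel_derivation:
  "subspace {t :: 'u multiset \<Rightarrow> real. derivation A t = a *\<^sub>R t}"
  by (auto simp: subspace_def scaleR_add_right derivation_0 derivation_add_fun derivation_scaleR)

lemma subspace_weight_forms: "subspace (weight_forms J d a)"
proof -
  have "weight_forms J d a = symm_forms d \<inter> ({t. derivation proj_fst t = a *\<^sub>R t} \<inter> {t. derivation (on_both J) t = 0 *\<^sub>R t})"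
    by (auto simp: weight_forms_def)
  then show ?thesis
    by (simp only:) (intro subspace_inter subspace_symm_forms subspace_kernel_derivation)
qed

lemma subspace_invariant_forms: "subspace (invariant_forms J d)"
proof -
  have "invariant_forms J d = weight_forms J (2 * d) (real d) \<inter> {t. derivation fst_to_snd t = 0 *\<^sub>R t}"
    by (auto simp: invariant_forms_def)
  then show ?thesis
    by (simp only:) (intro subspace_inter subspace_weight_forms subspace_kernel_derivation)
qed

lemma weight_forms_above_degree:
  assumes "real d < a"
  shows "weight_forms J d a = {0}"
proof -
  have "t = 0" if t: "t \<in> symm_forms d" "derivation proj_fst t = a *\<^sub>R t"
    for t :: "('a \<times> 'a) multiset \<Rightarrow> real"
  proof (rule symm_form_eq_0_if_diagonal_eq_0[OF t(1)])
    fix z :: "'a \<times> 'a"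
    have "t ({#} + replicate_mset d ((fst z, 0) + (0, snd z))) = 0"
      unfolding binomial_form[OF symm_forms_multilinear[OF t(1)]]
      using assms by (intro sum.neutral) (auto simp: split_form_eq_0[OF t])
    then show "t (replicate_mset d z) = 0" by simp
  qed
  moreover have "(0 :: ('a \<times> 'a) multiset \<Rightarrow> real) \<in> weight_forms J d a"
    by (rule subspace_0[OF subspace_weight_forms])
  ultimately show ?thesis by (auto simp: weight_forms_def)
qed

text \<open>
  Of the binomial expansion of \<open>t ((x, 0) + (0, y), \<dots>)\<close> only the term with \<open>k\<close> arguments of either
  kind has the right weight.
\<close>

lemma weight_form_diagonal:
  assumes "t \<in> weight_forms J (2 * k) (real k)"
  shows "t (replicate_mset (2 * k) (x, y))
       = real ((2 * k) choose k) * t (replicate_mset k (x, 0) + replicate_mset k (0, y))"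
proof -
  have t: "t \<in> symm_forms (2 * k)" "derivation proj_fst t = real k *\<^sub>R t"
    using assms by (auto simp: weight_forms_def)
  have "t ({#} + replicate_mset (2 * k) ((x, 0) + (0, y))) =
     (\<Sum>i\<le>2 * k. real (2 * k choose i) * t ({#} + replicate_mset i (x, 0) + replicate_mset (2 * k - i) (0, y)))"
    by (rule binomial_form[OF symm_forms_multilinear[OF t(1)]])
  also have "\<dots> = (\<Sum>i\<in>{k}. real (2 * k choose i) * t ({#} + replicate_mset i (x, 0) + replicate_mset (2 * k - i) (0, y)))"
    by (rule sum.mono_neutral_right) (auto simp: split_form_eq_0[OF t])
  finally show ?thesis by (simp add: mult_2)
qed

lemma derivation_commutator_fun:
  fixes t :: "'u multiset \<Rightarrow> real"
  shows "derivation A (derivation B t)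
       = derivation B (derivation A t) + derivation (\<lambda>z. B (A z)) t - derivation (\<lambda>z. A (B z)) t"
  using derivation_commutator[of A B t] by (auto simp: fun_eq_iff algebra_simps)

lemma weight_forms_derivation:
  assumes t: "t \<in> weight_forms J d a" and A: "linear A"
    and shift: "\<And>z. proj_fst (A z) + c *\<^sub>R A z = A (proj_fst z)" and comm: "\<And>z. on_both J (A z) = A (on_both J z)"
  shows "derivation A t \<in> weight_forms J d (a + c)"
proof -
  have t': "t \<in> symm_forms d" "derivation proj_fst t = a *\<^sub>R t" "derivation (on_both J) t = 0"
    using t by (auto simp: weight_forms_def)
  have ml: "multilinear t" by (rule symm_forms_multilinear[OF t'(1)])
  have "derivation (\<lambda>z. A (proj_fst z)) t = derivation (\<lambda>z. proj_fst (A z)) t + c *\<^sub>R derivation A t"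
  proof
    fix Z
    have "derivation (\<lambda>z. c *\<^sub>R A z) t Z = c * derivation A t Z"
      by (simp add: derivation_def multilinear_scale[OF ml] sum_mset_distrib_left)
    then show "derivation (\<lambda>z. A (proj_fst z)) t Z = (derivation (\<lambda>z. proj_fst (A z)) t + c *\<^sub>R derivation A t) Z"
      unfolding shift[symmetric] derivation_plus[OF ml] by simp
  qed
  then have "derivation proj_fst (derivation A t) = (a + c) *\<^sub>R derivation A t"
    unfolding derivation_commutator_fun[of proj_fst A] by (simp add: t'(2) derivation_scaleR scaleR_left_distrib)
  moreover have "derivation (on_both J) (derivation A t) = 0"
    unfolding derivation_commutator_fun[of "on_both J" A] comm by (simp add: t'(3) derivation_0)
  ultimately show ?thesis
    using symm_forms_derivation[OF t'(1) A] by (simp add: weight_forms_def)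
qed

lemma weight_forms_fst_to_snd:
  assumes "linear J" "t \<in> weight_forms J d a"
  shows "derivation fst_to_snd t \<in> weight_forms J d (a + 1)"
  by (rule weight_forms_derivation[OF assms(2) linear_pair_maps(3)])
     (simp_all add: proj_fst_def fst_to_snd_def on_both_def linear_0[OF assms(1)])

lemma weight_forms_snd_to_fst:
  assumes "linear J" "t \<in> weight_forms J d a"
  shows "derivation snd_to_fst t \<in> weight_forms J d (a - 1)"
  using weight_forms_derivation[OF assms(2) linear_pair_maps(4), of "- 1"]
  by (simp add: proj_fst_def snd_to_fst_def on_both_def linear_0[OF assms(1)] zero_prod_def)

lemma derivation_proj_fst_plus_proj_snd:
  fixes t :: "('a::real_vector \<times> 'a) multiset \<Rightarrow> real"
  assumes t: "t \<in> symm_forms d"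
  shows "derivation proj_fst t Z + derivation proj_snd t Z = real d * t Z"
proof -
  have "derivation proj_fst t Z + derivation proj_snd t Z = derivation (\<lambda>z. proj_fst z + proj_snd z) t Z"
    by (rule derivation_plus[OF symm_forms_multilinear[OF t], symmetric])
  also have "(\<lambda>z::'a \<times> 'a. proj_fst z + proj_snd z) = (\<lambda>z. z)"
    by (auto simp: fun_eq_iff proj_fst_def proj_snd_def)
  finally show ?thesis
    using symm_forms_size[OF t, of Z] by (cases "size Z = d") (auto simp: derivation_id)
qed

text \<open>
  The commutator of the two polarisations is the difference \<open>a - (d - a)\<close> of the degrees in \<open>x\<close> and
  \<open>y\<close>.
\<close>

lemma fst_to_snd_snd_to_fst:
  fixes t :: "('a::real_vector \<times> 'a) multiset \<Rightarrow> real"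
  assumes t: "t \<in> symm_forms d" "derivation proj_fst t = a *\<^sub>R t"
  shows "derivation fst_to_snd (derivation snd_to_fst t)
       = derivation snd_to_fst (derivation fst_to_snd t) + (2 * a - real d) *\<^sub>R t"
proof -
  have comp: "(\<lambda>z::'a \<times> 'a. snd_to_fst (fst_to_snd z)) = proj_fst" "(\<lambda>z::'a \<times> 'a. fst_to_snd (snd_to_fst z)) = proj_snd"
    by (auto simp: fun_eq_iff proj_fst_def proj_snd_def snd_to_fst_def fst_to_snd_def)
  have "derivation proj_snd t = (real d - a) *\<^sub>R t"
    using derivation_proj_fst_plus_proj_snd[OF t(1)] by (auto simp: fun_eq_iff t(2) algebra_simps)
  then show ?thesis
    unfolding derivation_commutator_fun[of fst_to_snd snd_to_fst] comp t(2)
    by (auto simp: fun_eq_iff algebra_simps)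
qed

text \<open>
  The ladder consists of the weights \<open>k, k + 1, \<dots>, 2 k + 1\<close> in total degree \<open>2 k\<close>: it ends because
  the weight cannot exceed the degree, and the commutator is \<open>2 (r + 1)\<close> at the weight \<open>k + r + 1\<close>.
\<close>

lemma fst_to_snd_surjective:
  assumes J: "linear J"
  shows "derivation fst_to_snd ` weight_forms J (2 * k) (real k) = weight_forms J (2 * k) (real k + 1)"
proof -
  let ?U = "\<lambda>r. weight_forms J (2 * k) (real k + real r)"
  have "derivation fst_to_snd ` ?U 0 = ?U 1"
  proof (rule ladder_surjective[where N = k and B = "derivation snd_to_fst" and c = "\<lambda>r. 2 * (real r + 1)"])
    fix r and v assume v: "v \<in> ?U (Suc r)"
    then have v': "v \<in> symm_forms (2 * k)" "derivation proj_fst v = (real k + real (Suc r)) *\<^sub>R v"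
      by (simp_all add: weight_forms_def)
    show "derivation fst_to_snd (derivation snd_to_fst v)
        = derivation snd_to_fst (derivation fst_to_snd v) + (2 * (real r + 1)) *\<^sub>R v"
      unfolding fst_to_snd_snd_to_fst[OF v'] by (simp add: algebra_simps)
    show "derivation snd_to_fst v \<in> ?U r"
      using weight_forms_snd_to_fst[OF J v] by (simp add: algebra_simps)
  next
    fix r and v assume v: "v \<in> ?U r"
    show "derivation fst_to_snd v \<in> ?U (Suc r)"
      using weight_forms_fst_to_snd[OF J v] by (simp add: algebra_simps)
  qed (simp_all add: linear_derivation subspace_weight_forms weight_forms_above_degree)
  then show ?thesis by simp
qed

section \<open>The trace and the multiplication by the symplectic form\<close>

lemma sum_sum_mset_swap: "(\<Sum>b\<in>B. \<Sum>z\<in>#Z. f b z) = (\<Sum>z\<in>#Z. \<Sum>b\<in>B. f b z)"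
  for f :: "'b \<Rightarrow> 'z \<Rightarrow> 'r::comm_monoid_add"
  by (induction Z) (simp_all add: sum.distrib)

context
  fixes J :: "'a::euclidean_space \<Rightarrow> 'a"
  assumes J: "compatible_complex_structure J"
begin

lemma J_orthogonal: "orthogonal_transformation J"
  and J_square: "J (J x) = - x"
  and J_linear: "linear J"
  using J by (auto simp: compatible_complex_structure_def orthogonal_transformation_linear)

lemma J_skew: "J x \<bullet> y = - (x \<bullet> J y)"
proof -
  have "J x \<bullet> y = J (J x) \<bullet> J y"
    using J_orthogonal by (simp add: orthogonal_transformation_def)
  then show ?thesis by (simp add: J_square)
qed

lemma J_isometry: "J x \<bullet> J y = x \<bullet> y"
  using J_orthogonal by (simp add: orthogonal_transformation_def)

text \<open>
  The contraction of a bilinear form with the metric does not depend on the orthonormal basis,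
  and \<open>J\<close> maps orthonormal bases to orthonormal bases.
\<close>

lemma sum_Basis_J:
  fixes \<beta> :: "'a::euclidean_space \<Rightarrow> 'a \<Rightarrow> real"
  assumes \<beta>: "\<And>x. linear (\<beta> x)" "\<And>y. linear (\<lambda>x. \<beta> x y)"
  shows "(\<Sum>b\<in>Basis. \<beta> (J b) (J b)) = (\<Sum>b\<in>Basis. \<beta> b b)"
proof -
  have exp: "\<beta> u v = (\<Sum>c\<in>Basis. \<Sum>d\<in>Basis. ((u \<bullet> c) * (v \<bullet> d)) * \<beta> c d)" for u v
  proof -
    have "\<beta> u v = \<beta> (\<Sum>c\<in>Basis. (u \<bullet> c) *\<^sub>R c) v" by (simp add: euclidean_representation)
    also have "\<dots> = (\<Sum>c\<in>Basis. (u \<bullet> c) * \<beta> c v)"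
      by (subst linear_sum[OF \<beta>(2)]) (simp add: linear_scale[OF \<beta>(2)])
    also have "\<dots> = (\<Sum>c\<in>Basis. (u \<bullet> c) * \<beta> c (\<Sum>d\<in>Basis. (v \<bullet> d) *\<^sub>R d))"
      by (simp add: euclidean_representation)
    also have "\<dots> = (\<Sum>c\<in>Basis. \<Sum>d\<in>Basis. ((u \<bullet> c) * (v \<bullet> d)) * \<beta> c d)"
      by (subst linear_sum[OF \<beta>(1)]) (simp add: linear_scale[OF \<beta>(1)] sum_distrib_left mult.assoc)
    finally show ?thesis .
  qed
  have orth: "(\<Sum>b\<in>Basis. (J b \<bullet> c) * (J b \<bullet> d)) = c \<bullet> d" for c d
  proof -
    have "(\<Sum>b\<in>Basis. (J b \<bullet> c) * (J b \<bullet> d)) = (\<Sum>b\<in>Basis. (J c \<bullet> b) * (J d \<bullet> b))"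
    proof (intro sum.cong refl)
      fix b
      have *: "J b \<bullet> v = - (J v \<bullet> b)" for v
        using J_skew[of b v] inner_commute[of b "J v"] by linarith
      show "(J b \<bullet> c) * (J b \<bullet> d) = (J c \<bullet> b) * (J d \<bullet> b)"
        unfolding *[of c] *[of d] by (rule minus_mult_minus)
    qed
    also have "\<dots> = J c \<bullet> J d" by (rule euclidean_inner[symmetric])
    finally show ?thesis by (simp add: J_isometry)
  qed
  have "(\<Sum>b\<in>Basis. \<beta> (J b) (J b)) = (\<Sum>c\<in>Basis. \<Sum>d\<in>Basis. (\<Sum>b\<in>Basis. (J b \<bullet> c) * (J b \<bullet> d)) * \<beta> c d)"
    unfolding exp[of "J _"] sum_distrib_right
    by (subst sum.swap, rule sum.cong[OF refl], rule sum.swap)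
  also have "\<dots> = (\<Sum>c\<in>Basis. \<Sum>d\<in>Basis. if d = c then \<beta> c d else 0)"
    unfolding orth by (intro sum.cong refl) (auto simp: inner_Basis)
  finally show ?thesis by simp
qed

text \<open>
  The contraction with the skew tensor \<open>J\<close> changes sign when the two slots are exchanged.
\<close>

lemma sum_Basis_J_swap:
  fixes \<beta> :: "'a::euclidean_space \<Rightarrow> 'a \<Rightarrow> real"
  assumes \<beta>: "\<And>x. linear (\<beta> x)" "\<And>y. linear (\<lambda>x. \<beta> x y)"
  shows "(\<Sum>b\<in>Basis. \<beta> b (J b)) = - (\<Sum>b\<in>Basis. \<beta> (J b) b)"
proof -
  have "(\<Sum>b\<in>Basis. \<beta> (J b) (J (J b))) = (\<Sum>b\<in>Basis. \<beta> b (J b))"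
    by (rule sum_Basis_J[of "\<lambda>x y. \<beta> x (J y)"])
       (use \<beta> linear_compose[OF J_linear] in \<open>auto simp: o_def\<close>)
  then show ?thesis using linear_neg[OF \<beta>(1)] by (simp add: J_square sum_negf)
qed

lemma linear_J_pairing: "linear (J_pairing J z)"
  by (auto intro!: linearI simp: J_pairing_def linear_add[OF J_linear] linear_scale[OF J_linear] inner_add_left inner_add_right algebra_simps)

lemma J_pairing_commute: "J_pairing J z w = J_pairing J w z"
  by (simp add: J_pairing_def)

lemma linear_J_laplacian: "linear (J_laplacian J)"
  by (rule linearI) (auto simp: fun_eq_iff J_laplacian_def sum.distrib sum_distrib_left)

lemma symm_forms_J_laplacian:
  assumes "t \<in> symm_forms (Suc (Suc d))"
  shows "J_laplacian J t \<in> symm_forms d"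
proof -
  have "linear (\<lambda>z. J_laplacian J t (add_mset z Z))" for Z
  proof -
    have "linear (\<lambda>z. t (add_mset z (add_mset (J b, 0) (add_mset (0, b) Z))))" for b
      using symm_forms_multilinear[OF assms] by (auto simp: multilinear_def)
    then show ?thesis
      unfolding J_laplacian_def by (intro linear_sum_fun) (simp add: add_mset_commute)
  qed
  moreover have "J_laplacian J t Z = 0" if "size Z \<noteq> d" for Z
    using that symm_forms_size[OF assms] by (simp add: J_laplacian_def)
  ultimately show ?thesis by (simp add: symm_forms_def multilinear_def)
qed

lemma J_laplacian_low_degree:
  assumes "t \<in> symm_forms d" "d < 2"
  shows "J_laplacian J t = 0"
  using symm_forms_size[OF assms(1)] assms(2) by (auto simp: J_laplacian_def fun_eq_iff)

text \<open>
  The commutator of the trace with a derivation consists of the terms in which the vector field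
  hits one of the two contracted arguments. In the lemmas below these terms cancel or reproduce
  the trace.
\<close>

lemma J_laplacian_derivation:
  "J_laplacian J (derivation A t) Z = derivation A (J_laplacian J t) Z
    + (\<Sum>b\<in>Basis. t (add_mset (A (J b, 0)) (add_mset (0, b) Z)) + t (add_mset (J b, 0) (add_mset (A (0, b)) Z)))"
proof -
  have sum_swap: "(\<Sum>b\<in>Basis. derivation A (g b) Z) = derivation A (\<lambda>Z. \<Sum>b\<in>Basis. g b Z) Z"
    for g :: "'a \<Rightarrow> ('a \<times> 'a) multiset \<Rightarrow> real"
    unfolding derivation_def by (rule sum_sum_mset_swap)
  have "J_laplacian J (derivation A t) Z = (\<Sum>b\<in>Basis. t (add_mset (A (J b, 0)) (add_mset (0, b) Z))
      + t (add_mset (J b, 0) (add_mset (A (0, b)) Z))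
      + derivation A (contract (0, b) (contract (J b, 0) t)) Z)"
    by (simp add: J_laplacian_def derivation_add_mset contract_apply contract_derivation
        derivation_add add_mset_commute contract_commute algebra_simps)
  also have "\<dots> = (\<Sum>b\<in>Basis. t (add_mset (A (J b, 0)) (add_mset (0, b) Z))
      + t (add_mset (J b, 0) (add_mset (A (0, b)) Z))) + derivation A (J_laplacian J t) Z"
    by (simp only: sum.distrib sum_swap J_laplacian_def contract_def)
  finally show ?thesis by simp
qed

lemma J_laplacian_proj_fst:
  assumes t: "multilinear t"
  shows "J_laplacian J (derivation proj_fst t) = derivation proj_fst (J_laplacian J t) + J_laplacian J t"
proof -
  have "t (add_mset (0, 0) Z) = 0" for Z
    using multilinear_zero[OF t] by (simp add: zero_prod_def)
  then have "t (add_mset u (add_mset (0, 0) Z)) = 0" for u Z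
    by (subst add_mset_commute) simp
  then show ?thesis
    by (auto simp: fun_eq_iff J_laplacian_derivation proj_fst_def sum.distrib) (simp add: J_laplacian_def)
qed

text \<open>
  Here the vector field moves the first contracted argument to the slot of the second one, so
  that \<open>J\<close> is contracted with a symmetric bilinear form.
\<close>

lemma J_laplacian_fst_to_snd:
  fixes t :: "('a \<times> 'a) multiset \<Rightarrow> real"
  assumes t: "multilinear t"
  shows "J_laplacian J (derivation fst_to_snd t) = derivation fst_to_snd (J_laplacian J t)"
proof
  fix Z
  have z: "t (add_mset u (add_mset (0, 0) Z)) = 0" for u
    using multilinear_zero[OF t] by (simp add: zero_prod_def add_mset_commute[of u])
  have "(\<Sum>b\<in>Basis. t (add_mset (0, b) (add_mset (0, J b) Z))) = - (\<Sum>b\<in>Basis. t (add_mset (0, J b) (add_mset (0, b) Z)))"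
  proof (rule sum_Basis_J_swap[of "\<lambda>x y. t (add_mset (0, x) (add_mset (0, y) Z))"])
    show "linear (\<lambda>y. t (add_mset (0, x) (add_mset (0, y) Z)))" for x
      using linear_slot_snd[OF t linear_id, of "add_mset (0, x) Z"] by (simp add: add_mset_commute)
    show "linear (\<lambda>x. t (add_mset (0, x) (add_mset (0, y) Z)))" for y
      using linear_slot_snd[OF t linear_id, of "add_mset (0, y) Z"] by simp
  qed
  then have "(\<Sum>b\<in>Basis. t (add_mset (0, J b) (add_mset (0, b) Z))) = 0"
    by (simp add: add_mset_commute)
  then show "J_laplacian J (derivation fst_to_snd t) Z = derivation fst_to_snd (J_laplacian J t) Z"
    by (simp add: J_laplacian_derivation fst_to_snd_def sum.distrib z)
qed

lemma J_laplacian_on_both: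
  fixes t :: "('a \<times> 'a) multiset \<Rightarrow> real"
  assumes t: "multilinear t"
  shows "J_laplacian J (derivation (on_both J) t) = derivation (on_both J) (J_laplacian J t)"
proof
  fix Z
  have "(\<Sum>b\<in>Basis. t (add_mset (J b, 0) (add_mset (0, J b) Z))) = (\<Sum>b\<in>Basis. t (add_mset (b, 0) (add_mset (0, b) Z)))"
  proof (rule sum_Basis_J[of "\<lambda>x y. t (add_mset (x, 0) (add_mset (0, y) Z))"])
    show "linear (\<lambda>y. t (add_mset (x, 0) (add_mset (0, y) Z)))" for x
      using linear_slot_snd[OF t linear_id, of "add_mset (x, 0) Z"] by (simp add: add_mset_commute)
    show "linear (\<lambda>x. t (add_mset (x, 0) (add_mset (0, y) Z)))" for y
      using linear_slot_fst[OF t linear_id, of "add_mset (0, y) Z"] by simp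
  qed
  moreover have "t (add_mset (- b, 0) W) = - t (add_mset (b, 0) W)" for b W
    using multilinear_minus[OF t, of "(b, 0)" W] by simp
  ultimately show "J_laplacian J (derivation (on_both J) t) Z = derivation (on_both J) (J_laplacian J t) Z"
    by (simp add: J_laplacian_derivation on_both_def sum.distrib sum_negf sum_subtractf J_square linear_0[OF J_linear])
qed

lemma J_pairing_invariant:
  "J_pairing J (on_both J u) v + J_pairing J u (on_both J v) = 0 * J_pairing J u v"
  "J_pairing J (fst_to_snd u) v + J_pairing J u (fst_to_snd v) = 0 * J_pairing J u v"
  "J_pairing J (proj_fst u) v + J_pairing J u (proj_fst v) = 1 * J_pairing J u v"
  using J_skew[of "fst u" "fst v"]
  by (simp_all add: J_pairing_def on_both_def fst_to_snd_def proj_fst_def J_isometry J_square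
      linear_0[OF J_linear] inner_commute)

text \<open>
  The second \<open>sl(2)\<close>. Both derivatives may fall on \<open>t\<close>, one on the quadratic form and one on \<open>t\<close> (this
  gives the degrees in \<open>x\<close> and in \<open>y\<close>, the sums \<open>1\<close> and \<open>2\<close> in the proof), or both on the quadratic form
  (this gives the dimension).
\<close>

lemma J_laplacian_times_quadratic:
  assumes t: "t \<in> symm_forms d"
  shows "J_laplacian J (times_quadratic (J_pairing J) t)
       = times_quadratic (J_pairing J) (J_laplacian J t) + (2 * (real d + DIM('a))) *\<^sub>R t"
proof
  fix Z
  have ml: "multilinear t" by (rule symm_forms_multilinear[OF t])
  let ?q = "J_pairing J"
  have tl: "times_quadratic ?q t (add_mset z (add_mset w Z)) = times_quadratic ?q (contract z (contract w t)) Z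
      + 2 * times_linear (?q z) (contract w t) Z + 2 * times_linear (?q w) (contract z t) Z + 2 * ?q z w * t Z" for z w
    by (simp add: times_quadratic_add_mset[of "J_pairing J", OF J_pairing_commute] times_linear_add_mset contract_def J_pairing_commute add_mset_commute algebra_simps)
  have 1: "(\<Sum>b\<in>Basis. times_linear (?q (0, b)) (contract (J b, 0) t) Z) = derivation proj_fst t Z"
  proof -
    have "(\<Sum>b\<in>Basis. ?q (0, b) w * contract (J b, 0) t W) = t (add_mset (proj_fst w) W)" for w W
    proof -
      have "(\<Sum>b\<in>Basis. ?q (0, b) w * contract (J b, 0) t W) = (\<Sum>b\<in>Basis. t (add_mset ((fst w \<bullet> J b) *\<^sub>R (J b, 0)) W))"
        by (simp add: multilinear_scale[OF ml] J_pairing_def contract_def linear_0[OF J_linear] del: scaleR_Pair)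
      also have "\<dots> = t (add_mset (\<Sum>b\<in>Basis. (fst w \<bullet> J b) *\<^sub>R (J b, 0)) W)"
        by (rule multilinear_sum[OF ml, symmetric])
      also have "(\<Sum>b\<in>Basis. (fst w \<bullet> J b) *\<^sub>R (J b, 0)) = proj_fst w"
      proof -
        have "(\<Sum>b\<in>Basis. (fst w \<bullet> J b) *\<^sub>R J b) = - J (\<Sum>b\<in>Basis. (J (fst w) \<bullet> b) *\<^sub>R b)"
          using J_skew by (simp add: linear_sum[OF J_linear] linear_neg[OF J_linear] linear_scale[OF J_linear] sum_negf del: euclidean_representation)
        also have "\<dots> = fst w" by (simp add: euclidean_representation J_square)
        finally show ?thesis by (simp add: proj_fst_def prod_eq_iff fst_sum snd_sum)
      qed
      finally show ?thesis .
    qed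
    then show ?thesis
      by (simp add: times_linear_def derivation_def sum_sum_mset_swap)
  qed
  have 2: "(\<Sum>b\<in>Basis. times_linear (?q (J b, 0)) (contract (0, b) t) Z) = derivation proj_snd t Z"
  proof -
    have "(\<Sum>b\<in>Basis. ?q (J b, 0) w * contract (0, b) t W) = t (add_mset (proj_snd w) W)" for w W
    proof -
      have "(\<Sum>b\<in>Basis. ?q (J b, 0) w * contract (0, b) t W) = (\<Sum>b\<in>Basis. t (add_mset ((snd w \<bullet> b) *\<^sub>R (0, b)) W))"
        by (simp add: multilinear_scale[OF ml] J_pairing_def contract_def J_isometry inner_commute linear_0[OF J_linear] del: scaleR_Pair)
      also have "\<dots> = t (add_mset (\<Sum>b\<in>Basis. (snd w \<bullet> b) *\<^sub>R (0, b)) W)"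
        by (rule multilinear_sum[OF ml, symmetric])
      also have "(\<Sum>b\<in>Basis. (snd w \<bullet> b) *\<^sub>R (0, b)) = proj_snd w"
        by (simp add: proj_snd_def prod_eq_iff fst_sum snd_sum euclidean_representation)
      finally show ?thesis .
    qed
    then show ?thesis
      by (simp add: times_linear_def derivation_def sum_sum_mset_swap)
  qed
  have 4: "?q (J b, 0) (0, b) = 1" if "b \<in> Basis" for b
    using that by (simp add: J_pairing_def J_isometry linear_0[OF J_linear])
  have 5: "(\<Sum>b\<in>Basis. times_quadratic ?q (contract (J b, 0) (contract (0, b) t)) Z) = times_quadratic ?q (J_laplacian J t) Z"
    by (simp add: times_quadratic_def times_linear_def sum_sum_mset_swap J_laplacian_def sum_distrib_left[symmetric] contract_apply add_mset_commute)
  have "J_laplacian J (times_quadratic ?q t) Z = times_quadratic ?q (J_laplacian J t) Z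
      + 2 * derivation proj_snd t Z + 2 * derivation proj_fst t Z + 2 * (\<Sum>b\<in>(Basis::'a set). 1) * t Z"
    unfolding J_laplacian_def tl sum.distrib 1[symmetric] 2[symmetric] 5[unfolded J_laplacian_def, symmetric]
    by (simp add: sum_distrib_left[symmetric] sum_distrib_right[symmetric] 4)
  then show "J_laplacian J (times_quadratic ?q t) Z = (times_quadratic ?q (J_laplacian J t) + (2 * (real d + DIM('a))) *\<^sub>R t) Z"
    using derivation_proj_fst_plus_proj_snd[OF t, of Z] by (simp add: algebra_simps)
qed

lemma derivation_times_J_pairing:
  "derivation (on_both J) (times_quadratic (J_pairing J) t) = times_quadratic (J_pairing J) (derivation (on_both J) t)"
  "derivation fst_to_snd (times_quadratic (J_pairing J) t) = times_quadratic (J_pairing J) (derivation fst_to_snd t)"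
  "derivation proj_fst (times_quadratic (J_pairing J) t)
    = times_quadratic (J_pairing J) (derivation proj_fst t) + times_quadratic (J_pairing J) t"
  using derivation_times_quadratic[of "J_pairing J", OF J_pairing_commute J_pairing_invariant(1)]
    derivation_times_quadratic[of "J_pairing J", OF J_pairing_commute J_pairing_invariant(2)]
    derivation_times_quadratic[of "J_pairing J", OF J_pairing_commute J_pairing_invariant(3)]
  by (auto simp: fun_eq_iff)

lemma invariant_forms_times_J_pairing:
  assumes "t \<in> invariant_forms J k"
  shows "times_quadratic (J_pairing J) t \<in> invariant_forms J (Suc k)"
proof -
  let ?M = "times_quadratic (J_pairing J)"
  have t: "t \<in> symm_forms (2 * k)" "derivation proj_fst t = real k *\<^sub>R t"
    "derivation (on_both J) t = 0" "derivation fst_to_snd t = 0"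
    using assms by (auto simp: invariant_forms_def weight_forms_def)
  have "?M t \<in> symm_forms (2 * Suc k)"
    using symm_forms_times_quadratic[OF t(1), of "J_pairing J"] linear_J_pairing J_pairing_commute by simp
  then show ?thesis
    by (simp add: invariant_forms_def weight_forms_def derivation_times_J_pairing t
        linear_0[OF linear_times_quadratic] linear_scale[OF linear_times_quadratic] scaleR_left_distrib)
qed

lemma invariant_forms_J_laplacian:
  assumes "t \<in> invariant_forms J (Suc k)"
  shows "J_laplacian J t \<in> invariant_forms J k"
proof -
  have t: "t \<in> symm_forms (2 * Suc k)" "derivation proj_fst t = real (Suc k) *\<^sub>R t"
    "derivation (on_both J) t = 0" "derivation fst_to_snd t = 0"
    using assms by (auto simp: invariant_forms_def weight_forms_def)
  have ml: "multilinear t" by (rule symm_forms_multilinear[OF t(1)])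
  have "J_laplacian J t \<in> symm_forms (2 * k)"
    using symm_forms_J_laplacian[of t "2 * k"] t(1) by simp
  moreover have "derivation proj_fst (J_laplacian J t) = real k *\<^sub>R J_laplacian J t"
    using J_laplacian_proj_fst[OF ml]
    by (simp add: t(2) linear_scale[OF linear_J_laplacian] linear_add[OF linear_J_laplacian] scaleR_left_distrib)
  moreover have "derivation (on_both J) (J_laplacian J t) = 0" "derivation fst_to_snd (J_laplacian J t) = 0"
    by (simp_all add: J_laplacian_on_both[OF ml, symmetric] J_laplacian_fst_to_snd[OF ml, symmetric]
        t linear_0[OF linear_J_laplacian])
  ultimately show ?thesis by (simp add: invariant_forms_def weight_forms_def)
qed

text \<open>
  The ladder runs down the degrees \<open>(k + 1, k + 1), (k, k), \<dots>, (0, 0)\<close> and ends because the trace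
  of a constant is \<open>0\<close>; the commutator is a positive multiple of the total degree plus the
  dimension.
\<close>

lemma J_laplacian_surjective:
  "J_laplacian J ` invariant_forms J (Suc k) = invariant_forms J k"
proof -
  \<comment> \<open>Below degree \<open>0\<close> the ladder continues with the zero space.\<close>
  define U where "U r = (if r \<le> Suc k then invariant_forms J (Suc k - r) else {0})" for r
  let ?M = "times_quadratic (J_pairing J)"
  have "J_laplacian J ` U 0 = U 1"
  proof (rule ladder_surjective[where N = "Suc k" and B = ?M and c = "\<lambda>r. 2 * (2 * real (k - r) + DIM('a))"])
    show "subspace (U r)" for r
      by (simp add: U_def subspace_invariant_forms)
    show "J_laplacian J v \<in> U (Suc r)" if "v \<in> U r" for r v
    proof (cases "r \<le> k")
      case True
      then show ?thesis using that invariant_forms_J_laplacian[of v "k - r"] by (simp add: U_def Suc_diff_le)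
    next
      case False
      have "(0 :: ('a \<times> 'a) multiset \<Rightarrow> real) \<in> symm_forms 0"
        by (rule subspace_0[OF subspace_symm_forms])
      with False have "v \<in> symm_forms 0"
        using that by (auto simp: U_def invariant_forms_def weight_forms_def split: if_splits)
      then show ?thesis using False J_laplacian_low_degree[of v 0] by (simp add: U_def)
    qed
    show "?M v \<in> U r" if "v \<in> U (Suc r)" for r v
    proof (cases "r \<le> k")
      case True
      then show ?thesis using that invariant_forms_times_J_pairing[of v "k - r"] by (simp add: U_def Suc_diff_le)
    next
      case False
      then show ?thesis using that subspace_0[OF subspace_invariant_forms]
        by (auto simp: U_def linear_0[OF linear_times_quadratic])
    qed
    show "J_laplacian J (?M v) = ?M (J_laplacian J v) + (2 * (2 * real (k - r) + DIM('a))) *\<^sub>R v"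
      if "r < Suc k" "v \<in> U (Suc r)" for r v
      using J_laplacian_times_quadratic[of v "2 * (k - r)"] that
      by (simp add: U_def invariant_forms_def weight_forms_def)
  qed (use linear_J_laplacian linear_times_quadratic in \<open>simp_all add: U_def add_nonneg_pos\<close>)
  then show ?thesis by (simp add: U_def)
qed

end

section \<open>Tensors with Young symmetry as functions of a multiset of pairs\<close>

text \<open>
  A tensor in the Young module is symmetric under the exchange of its pairs of arguments (lemma
  \<open>young_module_pair_swap\<close> below) and is therefore a function of the multiset of these pairs. Given
  the skew symmetry in each pair, the last condition says that the skew-symmetrisation over \<open>a\<close>, \<open>b\<close>,
  \<open>c\<close> vanishes.
\<close>

definition young_forms :: "nat \<Rightarrow> (('a::real_vector \<times> 'a) multiset \<Rightarrow> real) set"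
  where "young_forms k = {g.
    (\<forall>P. size P \<noteq> k \<longrightarrow> g P = 0) \<and>
    (\<forall>y P. linear (\<lambda>x. g (add_mset (x, y) P))) \<and>
    (\<forall>x y P. g (add_mset (y, x) P) = - g (add_mset (x, y) P)) \<and>
    (\<forall>a b c d P. g (add_mset (a, b) (add_mset (c, d) P)) + g (add_mset (b, c) (add_mset (a, d) P))
       + g (add_mset (c, a) (add_mset (b, d) P)) = 0)}"

lemma
  assumes "g \<in> young_forms k"
  shows young_forms_size: "size P \<noteq> k \<Longrightarrow> g P = 0"
    and young_forms_linear_fst: "linear (\<lambda>x. g (add_mset (x, y) P))"
    and young_forms_skew: "g (add_mset (y, x) P) = - g (add_mset (x, y) P)"
    and young_forms_Bianchi: "g (add_mset (a, b) (add_mset (c, d) P)) + g (add_mset (b, c) (add_mset (a, d) P))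
       + g (add_mset (c, a) (add_mset (b, d) P)) = 0"
  by (fact assms[unfolded young_forms_def mem_Collect_eq, THEN conjunct1, rule_format]
      assms[unfolded young_forms_def mem_Collect_eq, THEN conjunct2, THEN conjunct1, rule_format]
      assms[unfolded young_forms_def mem_Collect_eq, THEN conjunct2, THEN conjunct2, THEN conjunct1, rule_format]
      assms[unfolded young_forms_def mem_Collect_eq, THEN conjunct2, THEN conjunct2, THEN conjunct2, rule_format])+

lemma young_formsI:
  assumes "\<And>P. size P \<noteq> k \<Longrightarrow> g P = 0"
    and "\<And>y P. linear (\<lambda>x. g (add_mset (x, y) P))"
    and "\<And>x y P. g (add_mset (y, x) P) = - g (add_mset (x, y) P)"
    and "\<And>a b c d P. g (add_mset (a, b) (add_mset (c, d) P)) + g (add_mset (b, c) (add_mset (a, d) P))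
       + g (add_mset (c, a) (add_mset (b, d) P)) = 0"
  shows "g \<in> young_forms k"
  unfolding young_forms_def mem_Collect_eq by (intro conjI allI impI assms)

lemma young_forms_linear_snd:
  assumes "g \<in> young_forms k" shows "linear (\<lambda>y. g (add_mset (x, y) P))"
proof -
  have "(\<lambda>y. g (add_mset (x, y) P)) = (\<lambda>y. - g (add_mset (y, x) P))"
    by (rule ext) (rule young_forms_skew[OF assms])
  then show ?thesis using linear_compose_neg[OF young_forms_linear_fst[OF assms]] by simp
qed

lemma multilinear_fst_slots: "g \<in> young_forms k \<Longrightarrow> multilinear (\<lambda>X. g (P + image_mset (\<lambda>x. (x, y)) X))"
  and multilinear_snd_slots: "g \<in> young_forms k \<Longrightarrow> multilinear (\<lambda>Y. g (P + image_mset (\<lambda>y. (x, y)) Y))"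
  using young_forms_linear_fst[of g k] young_forms_linear_snd[of g k] by (auto simp: multilinear_def)

text \<open>
  The argument by which a curvature tensor is determined by its sectional curvatures, extended to
  \<open>k\<close> pairs: by descending induction on \<open>j\<close>, the form vanishes as soon as \<open>j\<close> of its pairs are equal.
  Polarising in \<open>x\<close> replaces one of the equal pairs \<open>(x, y)\<close> by \<open>(u, y)\<close>. Polarising then in \<open>y\<close> gives a
  relation between the values on \<open>(u, y), (x, v)\<close> and on \<open>(u, v), (x, y)\<close>. This relation, the one with
  \<open>u\<close> and \<open>v\<close> exchanged and the Bianchi identity leave only the value \<open>0\<close>.
\<close>

lemma young_form_eq_0_if_diagonal_eq_0:
  assumes g: "g \<in> young_forms k" and diag: "\<And>z. g (replicate_mset k z) = 0"
  shows "g = 0"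
proof -
  have "\<forall>P z. g (P + replicate_mset j z) = 0" if "j \<le> k" for j
    using that
  proof (induction rule: inc_induct)
    case base
    show ?case
    proof (intro allI)
      fix P z show "g (P + replicate_mset k z) = 0"
        using diag young_forms_size[OF g] by (cases "P = {#}") auto
    qed
  next
    case (step i)
    have IH: "g (P + replicate_mset (Suc i) z) = 0" for P z using step.IH by blast
    have fst_slots: "g (add_mset (u, y) (P + replicate_mset i (x, y))) = 0" for P u x y
      using polarise_once[OF multilinear_fst_slots[OF g], of P y "{#}" "Suc i" u x]
        IH by (simp add: image_replicate_mset del: replicate_mset_Suc)
    have snd_slots: "real i * g (add_mset (u, y) (add_mset (x, v) (P + replicate_mset (i - 1) (x, y))))
        + g (add_mset (u, v) (P + replicate_mset i (x, y))) = 0" for P u v x y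
    proof -
      let ?h = "\<lambda>w s. g (add_mset (u, w) P + image_mset (\<lambda>y. (x, y)) ({#} + replicate_mset i (y + s *\<^sub>R v)))"
      have der: "((\<lambda>s. ?h w s) has_real_derivative
          real i * g (add_mset (u, w) P + image_mset (\<lambda>y. (x, y)) ({#} + add_mset v (replicate_mset (i - 1) y)))) (at 0)" for w
        by (rule has_derivative_power_form[OF multilinear_snd_slots[OF g]])
      have "?h y s + s * ?h v s = 0" for s
        using fst_slots[of u "y + s *\<^sub>R v" P x] linear_add[OF young_forms_linear_snd[OF g]]
          linear_scale[OF young_forms_linear_snd[OF g]]
        by (simp add: image_replicate_mset)
      then have "((\<lambda>s. 0) has_real_derivative
          real i * g (add_mset (u, y) P + image_mset (\<lambda>y. (x, y)) ({#} + add_mset v (replicate_mset (i - 1) y)))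
          + (1 * ?h v 0 + real i * g (add_mset (u, v) P + image_mset (\<lambda>y. (x, y)) ({#} + add_mset v (replicate_mset (i - 1) y))) * 0)) (at 0)"
        using DERIV_add[OF der[of y] DERIV_mult[OF DERIV_ident der[of v]]] by simp
      from DERIV_unique[OF this DERIV_const[of 0]] show ?thesis
        by (simp add: image_replicate_mset add_mset_commute)
    qed
    show ?case
    proof (intro allI)
      fix P and z :: "'a \<times> 'a"
      obtain x y where z: "z = (x, y)" by (cases z)
      show "g (P + replicate_mset i z) = 0"
      proof (cases P)
        case empty
        then show ?thesis using young_forms_size[OF g] step.hyps by simp
      next
        case (add p P')
        obtain u v where p: "p = (u, v)" by (cases p)
        show ?thesis
        proof (cases i)
          case 0
          then show ?thesis using IH[of P' p] add by simp
        next
          case (Suc i')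
          \<comment> \<open>The relations are \<open>i A + C = 0\<close>, \<open>i B - C = 0\<close> and \<open>A = B + C\<close>; they force \<open>(i + 2) C = 0\<close>.\<close>
          define A B C where "A = g (add_mset (x, v) (add_mset (u, y) (P' + replicate_mset i' (x, y))))"
            and "B = g (add_mset (x, u) (add_mset (v, y) (P' + replicate_mset i' (x, y))))"
            and "C = g (add_mset (u, v) (add_mset (x, y) (P' + replicate_mset i' (x, y))))"
          have "real i * A + C = 0"
            using snd_slots[of u y x v P'] Suc by (simp add: A_def C_def add_mset_commute)
          moreover have "real i * B - C = 0"
            using snd_slots[of v y x u P'] Suc young_forms_skew[OF g, of v u]
            by (simp add: B_def C_def add_mset_commute)
          moreover have "A - C - B = 0"
            using young_forms_Bianchi[OF g, of x v u y "P' + replicate_mset i' (x, y)"]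
              young_forms_skew[OF g, of v u] young_forms_skew[OF g, of u x]
            by (simp add: A_def B_def C_def)
          ultimately have "(real i + 2) * C = 0" by algebra
          then have "C = 0" by simp
          then show ?thesis using Suc by (simp add: C_def add p z add_mset_commute)
        qed
      qed
    qed
  qed
  from this[of 0] show ?thesis by (simp add: fun_eq_iff)
qed

text \<open>
  In terms of pairs, the derivation action up to sign and the contraction of \<open>J\<close> into the two
  entries of one pair.
\<close>

definition pair_action :: "('a \<Rightarrow> 'a) \<Rightarrow> (('a \<times> 'a) multiset \<Rightarrow> real) \<Rightarrow> ('a \<times> 'a) multiset \<Rightarrow> real"
  where "pair_action J g = derivation (apfst J) g + derivation (apsnd J) g"

definition pair_trace :: "('a::euclidean_space \<Rightarrow> 'a) \<Rightarrow> (('a \<times> 'a) multiset \<Rightarrow> real) \<Rightarrow> ('a \<times> 'a) multiset \<Rightarrow> real"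
  where "pair_trace J g = (\<lambda>P. \<Sum>b\<in>Basis. g (add_mset (J b, b) P))"

lemma pair_action_add_mset:
  "pair_action J g (add_mset (x, y) P) =
    g (add_mset (J x, y) P) + g (add_mset (x, J y) P) + pair_action J (contract (x, y) g) P"
  by (simp add: pair_action_def derivation_add_mset)

lemma pair_action_sum_mset:
  "pair_action J g P = (\<Sum>p\<in>#P. g (add_mset (J (fst p), snd p) (P - {#p#})) + g (add_mset (fst p, J (snd p)) (P - {#p#})))"
  by (simp add: pair_action_def derivation_def sum_mset.distrib apfst_def apsnd_def map_prod_def case_prod_beta)

lemma young_forms_pair_trace:
  assumes g: "g \<in> young_forms (Suc k)"
  shows "pair_trace J g \<in> young_forms k"
proof -
  have "linear (\<lambda>x. pair_trace J g (add_mset (x, y) P))" for y P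
  proof -
    have "linear (\<lambda>x. g (add_mset p (add_mset (x, y) P)))" for p
      using young_forms_linear_fst[OF g, of y "add_mset p P"] by (simp add: add_mset_commute)
    then show ?thesis unfolding pair_trace_def by (intro linear_sum_fun)
  qed
  moreover have "g (add_mset p (add_mset (y, x) P)) = - g (add_mset p (add_mset (x, y) P))" for p x y P
    using young_forms_skew[OF g, of y x "add_mset p P"] by (simp add: add_mset_commute[of p])
  then have "pair_trace J g (add_mset (y, x) P) = - pair_trace J g (add_mset (x, y) P)" for x y P
    unfolding pair_trace_def sum_negf[symmetric] by (intro sum.cong refl)
  moreover have "g (add_mset p (add_mset (a, b) (add_mset (c, d) P))) + g (add_mset p (add_mset (b, c) (add_mset (a, d) P)))
       + g (add_mset p (add_mset (c, a) (add_mset (b, d) P))) = 0" for p a b c d P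
    using young_forms_Bianchi[OF g, of a b c d "add_mset p P"] by (simp add: add_mset_commute[of p])
  then have "pair_trace J g (add_mset (a, b) (add_mset (c, d) P)) + pair_trace J g (add_mset (b, c) (add_mset (a, d) P))
       + pair_trace J g (add_mset (c, a) (add_mset (b, d) P)) = 0" for a b c d P
    unfolding pair_trace_def sum.distrib[symmetric] by (intro sum.neutral ballI)
  moreover have "pair_trace J g P = 0" if "size P \<noteq> k" for P
    using that young_forms_size[OF g] by (simp add: pair_trace_def)
  ultimately show ?thesis by (intro young_formsI)
qed

text \<open>
  Contracting \<open>J\<close> with the Bianchi identity expresses the trace over one entry each of two pairs by
  the trace over a single pair.
\<close>

lemma cross_trace:
  assumes J: "compatible_complex_structure J" and g: "g \<in> young_forms k"
  shows "2 * (\<Sum>b\<in>Basis. g (add_mset (J b, u) (add_mset (b, v) P))) = pair_trace J g (add_mset (u, v) P)"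
proof -
  have "(\<Sum>b\<in>Basis. g (add_mset (b, u) (add_mset (J b, v) P))) = - (\<Sum>b\<in>Basis. g (add_mset (J b, u) (add_mset (b, v) P)))"
  proof (rule sum_Basis_J_swap[OF J, of "\<lambda>x y. g (add_mset (x, u) (add_mset (y, v) P))"])
    show "linear (\<lambda>y. g (add_mset (x, u) (add_mset (y, v) P)))" for x
      using young_forms_linear_fst[OF g, of v "add_mset (x, u) P"] by (simp add: add_mset_commute)
    show "linear (\<lambda>x. g (add_mset (x, u) (add_mset (y, v) P)))" for y
      by (rule young_forms_linear_fst[OF g])
  qed
  moreover have "(\<Sum>b\<in>Basis. g (add_mset (J b, u) (add_mset (b, v) P)) - g (add_mset (b, u) (add_mset (J b, v) P))
      - g (add_mset (J b, b) (add_mset (u, v) P))) = 0"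
  proof (rule sum.neutral, rule ballI)
    fix b
    show "g (add_mset (J b, u) (add_mset (b, v) P)) - g (add_mset (b, u) (add_mset (J b, v) P))
      - g (add_mset (J b, b) (add_mset (u, v) P)) = 0"
      using young_forms_Bianchi[OF g, of "J b" u b v P] young_forms_skew[OF g, of u b "add_mset (J b, v) P"]
        young_forms_skew[OF g, of b "J b" "add_mset (u, v) P"] by simp
  qed
  ultimately show ?thesis by (simp add: sum_subtractf pair_trace_def)
qed

definition harmonic_young_forms :: "('a::euclidean_space \<Rightarrow> 'a) \<Rightarrow> nat \<Rightarrow> (('a \<times> 'a) multiset \<Rightarrow> real) set"
  where "harmonic_young_forms J k = {g \<in> young_forms k. pair_action J g = 0 \<and> pair_trace J g = 0}"

section \<open>Young symmetry of tensors on lists of arguments\<close>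

fun flatten :: "('a \<times> 'a) list \<Rightarrow> 'a list"
  where "flatten [] = []"
  | "flatten (p # ps) = fst p # snd p # flatten ps"

fun pairs :: "'a list \<Rightarrow> ('a \<times> 'a) list"
  where "pairs (x # y # zs) = (x, y) # pairs zs"
  | "pairs _ = []"

lemma length_flatten [simp]: "length (flatten ps) = 2 * length ps"
  by (induction ps) auto

lemma pairs_flatten [simp]: "pairs (flatten ps) = ps"
  by (induction ps) auto

lemma flatten_append [simp]: "flatten (ps @ qs) = flatten ps @ flatten qs"
  by (induction ps) auto

lemma flatten_pairs: "even (length xs) \<Longrightarrow> flatten (pairs xs) = xs"
  by (induction xs rule: pairs.induct) auto

lemma length_pairs: "even (length xs) \<Longrightarrow> 2 * length (pairs xs) = length xs"
  by (induction xs rule: pairs.induct) auto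

lemma pairs_append: "even (length us) \<Longrightarrow> pairs (us @ vs) = pairs us @ pairs vs"
  by (induction us rule: pairs.induct) auto

definition tensor_of :: "nat \<Rightarrow> (('a \<times> 'a) multiset \<Rightarrow> real) \<Rightarrow> 'a list \<Rightarrow> real"
  where "tensor_of k g xs = (if length xs = 2 * k then g (mset (pairs xs)) else 0)"

lemma function_of_mset_if_swap:
  assumes swap: "\<And>us a b vs. f (us @ a # b # vs) = f (us @ b # a # vs)"
  shows "mset ps = mset qs \<Longrightarrow> f (us @ ps) = f (us @ qs)"
proof (induction ps arbitrary: qs us)
  case (Cons a ps)
  have move: "f (us @ q1 @ a # q2) = f (us @ a # q1 @ q2)" for us q1 q2
  proof (induction q1 arbitrary: us)
    case (Cons b q1)
    have "f (us @ (b # q1) @ a # q2) = f ((us @ [b]) @ a # q1 @ q2)"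
      using Cons.IH[of "us @ [b]"] by simp
    also have "\<dots> = f (us @ a # (b # q1) @ q2)" using swap[of us b a] by simp
    finally show ?case .
  qed simp
  have "a \<in> set qs" using Cons.prems by (metis list.set_intros(1) set_mset_mset)
  then obtain q1 q2 where qs: "qs = q1 @ a # q2" by (auto simp: in_set_conv_decomp)
  then have "mset ps = mset (q1 @ q2)" using Cons.prems by simp
  from Cons.IH[OF this, of "us @ [a]"] show ?case by (simp add: qs move)
qed simp

lemma permute_list_middle:
  fixes f :: "nat \<Rightarrow> nat" and us vs xs :: "'b list"
  assumes us: "length us = m" and fx: "\<And>i. i \<notin> {m, m + 1, m + 2} \<Longrightarrow> f i = i"
    and xs: "xs = us @ a # b # c # vs"
  shows "permute_list f xs = us @ [xs ! f m, xs ! f (m + 1), xs ! f (m + 2)] @ vs"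
proof (rule nth_equalityI)
  show "length (permute_list f xs) = length (us @ [xs ! f m, xs ! f (m + 1), xs ! f (m + 2)] @ vs)"
    by (simp add: xs)
  fix i assume i: "i < length (permute_list f xs)"
  then have "permute_list f xs ! i = xs ! f i" by (simp add: permute_list_def)
  also have "\<dots> = (us @ [xs ! f m, xs ! f (m + 1), xs ! f (m + 2)] @ vs) ! i"
  proof (cases "i \<in> {m, m + 1, m + 2}")
    case True
    then show ?thesis using us by (auto simp: nth_append)
  next
    case False
    then have i': "i < m \<or> m + 3 \<le> i" by auto
    show ?thesis
    proof (cases "i < m")
      case True
      then show ?thesis using fx[OF False] us by (simp add: xs nth_append)
    next
      case ge: False
      then obtain j where "i = m + (3 + j)" using i' by (metis add.assoc le_iff_add)
      then show ?thesis using fx[OF False] us by (simp add: xs nth_append)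
    qed
  qed
  finally show "permute_list f xs ! i = (us @ [xs ! f m, xs ! f (m + 1), xs ! f (m + 2)] @ vs) ! i" .
qed

lemma permute_list_swap:
  assumes "length us = m"
  shows "permute_list (Transposition.transpose m (m + 1)) (us @ a # b # vs) = us @ b # a # vs"
proof (rule nth_equalityI)
  fix i assume i: "i < length (permute_list (Transposition.transpose m (m + 1)) (us @ a # b # vs))"
  then have "permute_list (Transposition.transpose m (m + 1)) (us @ a # b # vs) ! i
      = (us @ a # b # vs) ! Transposition.transpose m (m + 1) i"
    by (simp add: permute_list_def del: upt_Suc)
  also have "\<dots> = (us @ b # a # vs) ! i"
    using assms by (auto simp: nth_append Transposition.transpose_def nth_Cons split: nat.splits)
  finally show "permute_list (Transposition.transpose m (m + 1)) (us @ a # b # vs) ! i = (us @ b # a # vs) ! i" .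
qed simp

lemma skew_symmetrisation_three:
  assumes "length us = m"
  shows "skew_symmetrisation {m, m + 1, m + 2} S (us @ a # b # c # vs) =
    (S (us @ a # b # c # vs) + S (us @ b # c # a # vs) + S (us @ c # a # b # vs)
     - S (us @ b # a # c # vs) - S (us @ a # c # b # vs) - S (us @ c # b # a # vs)) / 6"
proof -
  let ?t = "Transposition.transpose"
  let ?xs = "us @ a # b # c # vs"
  let ?F = "\<lambda>p. of_int (sign p) * S (permute_list p ?xs)"
  have nth: "?xs ! m = a" "?xs ! (m + 1) = b" "?xs ! (m + 2) = c"
    using assms by (simp_all add: nth_append)
  have "(\<Sum>p | p permutes {m, m + 1, m + 2}. ?F p)
     = (\<Sum>i\<in>{m, m + 1, m + 2}. \<Sum>j\<in>{m + 1, m + 2}. ?F (?t m i \<circ> (?t (m + 1) j \<circ> id)))"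
    by (simp add: sum_over_permutations_insert permutes_sing o_assoc)
  also have "\<dots> = ?F id + ?F (?t (m + 1) (m + 2)) + ?F (?t m (m + 1)) + ?F (?t m (m + 1) \<circ> ?t (m + 1) (m + 2))
     + ?F (?t m (m + 2)) + ?F (?t m (m + 2) \<circ> ?t (m + 1) (m + 2))"
    by simp
  also have "?F id = S ?xs" by (simp add: sign_id)
  also have "?F (?t (m + 1) (m + 2)) = - S (us @ a # c # b # vs)"
    by (subst permute_list_middle[OF assms _ refl]) (auto simp: sign_swap_id nth transpose_def nth_append assms[symmetric])
  also have "?F (?t m (m + 1)) = - S (us @ b # a # c # vs)"
    by (subst permute_list_middle[OF assms _ refl]) (auto simp: sign_swap_id nth transpose_def nth_append assms[symmetric])
  also have "?F (?t m (m + 1) \<circ> ?t (m + 1) (m + 2)) = S (us @ b # c # a # vs)"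
    by (subst permute_list_middle[OF assms _ refl]) (auto simp: sign_compose permutation_swap_id sign_swap_id nth transpose_def nth_append assms[symmetric])
  also have "?F (?t m (m + 2)) = - S (us @ c # b # a # vs)"
    by (subst permute_list_middle[OF assms _ refl]) (auto simp: sign_swap_id nth transpose_def nth_append assms[symmetric])
  also have "?F (?t m (m + 2) \<circ> ?t (m + 1) (m + 2)) = S (us @ c # a # b # vs)"
    by (subst permute_list_middle[OF assms _ refl]) (auto simp: sign_compose permutation_swap_id sign_swap_id nth transpose_def nth_append assms[symmetric])
  finally show ?thesis
    by (simp add: skew_symmetrisation_def fact_numeral)
qed

lemma split_at_pair:
  assumes "length xs = 2 * k" "j < k"
  obtains us a b vs where "xs = us @ a # b # vs" "length us = 2 * j" "length vs = 2 * (k - j - 1)"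
proof -
  have "drop (2 * j) xs = xs ! (2 * j) # xs ! (2 * j + 1) # drop (2 * j + 2) xs"
    using assms by (simp add: Cons_nth_drop_Suc)
  then have "xs = take (2 * j) xs @ xs ! (2 * j) # xs ! (2 * j + 1) # drop (2 * j + 2) xs"
    by (metis append_take_drop_id)
  then show ?thesis using assms by (intro that) auto
qed

lemma split_at_two_pairs:
  assumes "length xs = 2 * k" "j + 1 < k"
  obtains us a b c d vs where "xs = us @ a # b # c # d # vs" "length us = 2 * j" "length vs = 2 * (k - j - 2)"
proof -
  obtain us a b vs where 1: "xs = us @ a # b # vs" "length us = 2 * j" "length vs = 2 * (k - j - 1)"
    using split_at_pair[OF assms(1) add_lessD1[OF assms(2)]] by metis
  have "0 < k - j - 1" using assms(2) by simp
  then obtain us' c d ws where "vs = us' @ c # d # ws" "length us' = 2 * 0" "length ws = 2 * (k - j - 1 - 0 - 1)"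
    using split_at_pair[OF 1(3)] by metis
  with 1 show ?thesis by (intro that[of us a b c d ws]) auto
qed

lemma tensor_of_split:
  assumes "length us = 2 * i" "length vs = 2 * (k - i - 1)" "i < k"
  shows "tensor_of k g (us @ a # b # vs) = g (add_mset (a, b) (mset (pairs us) + mset (pairs vs)))"
  using assms by (simp add: tensor_of_def pairs_append)

lemma tensor_of_split_two:
  assumes "length us = 2 * i" "length vs = 2 * (k - i - 2)" "i + 1 < k"
  shows "tensor_of k g (us @ a # b # c # d # vs)
    = g (add_mset (a, b) (add_mset (c, d) (mset (pairs us) + mset (pairs vs))))"
  using assms by (simp add: tensor_of_def pairs_append)

lemma tensor_of_in_young_module:
  assumes g: "g \<in> young_forms k"
  shows "tensor_of k g \<in> young_module k"
proof -
  have "tensor_of k g \<in> tensors (2 * k)"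
    unfolding tensors_def mem_Collect_eq
  proof (intro conjI allI impI)
    fix xs :: "'a list" and i assume xs: "length xs = 2 * k" and i: "i < 2 * k"
    define j where "j = i div 2"
    have j: "j < k" using i by (simp add: j_def)
    obtain us a b vs where sp: "xs = us @ a # b # vs" "length us = 2 * j" "length vs = 2 * (k - j - 1)"
      using split_at_pair[OF xs j] by metis
    show "linear (\<lambda>x. tensor_of k g (xs[i := x]))"
    proof (cases "even i")
      case True
      then have "i = length us" using sp by (simp add: j_def)
      then have "tensor_of k g (xs[i := x]) = g (add_mset (x, b) (mset (pairs us) + mset (pairs vs)))" for x
        using tensor_of_split[OF sp(2,3) j] by (simp add: sp(1))
      then show ?thesis using young_forms_linear_fst[OF g] by simp
    next
      case False
      then have "i = Suc (length us)" using sp by (simp add: j_def)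
      then have "tensor_of k g (xs[i := x]) = g (add_mset (a, x) (mset (pairs us) + mset (pairs vs)))" for x
        using tensor_of_split[OF sp(2,3) j] by (simp add: sp(1) list_update_append)
      then show ?thesis using young_forms_linear_snd[OF g] by simp
    qed
  qed (simp add: tensor_of_def)
  moreover have "skew_in (2 * i) (2 * i + 1) (tensor_of k g)" if i: "i < k" for i
    unfolding skew_in_def
  proof
    fix xs :: "'a list"
    show "tensor_of k g (permute_list (Transposition.transpose (2 * i) (2 * i + 1)) xs) = - tensor_of k g xs"
    proof (cases "length xs = 2 * k")
      case True
      obtain us a b vs where sp: "xs = us @ a # b # vs" "length us = 2 * i" "length vs = 2 * (k - i - 1)"
        using split_at_pair[OF True i] by metis
      show ?thesis
        unfolding sp(1) permute_list_swap[OF sp(2)] tensor_of_split[OF sp(2,3) i]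
        by (rule young_forms_skew[OF g])
    qed (simp add: tensor_of_def)
  qed
  moreover have "skew_symmetrisation {2 * i, 2 * i + 1, 2 * i + 2} (tensor_of k g) xs = 0"
    if i: "i + 1 < k" for i xs
  proof (cases "length xs = 2 * k")
    case True
    obtain us a b c d vs where sp: "xs = us @ a # b # c # d # vs" "length us = 2 * i" "length vs = 2 * (k - i - 2)"
      using split_at_two_pairs[OF True i] by metis
    let ?P = "mset (pairs us) + mset (pairs vs)"
    show ?thesis
      unfolding sp(1) skew_symmetrisation_three[OF sp(2)] tensor_of_split_two[OF sp(2,3) i]
      using young_forms_Bianchi[OF g, of a b c d ?P] young_forms_skew[OF g, of a b "add_mset (c, d) ?P"]
        young_forms_skew[OF g, of b c "add_mset (a, d) ?P"] young_forms_skew[OF g, of c a "add_mset (b, d) ?P"]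
      by simp
  qed (simp add: skew_symmetrisation_def tensor_of_def)
  ultimately show ?thesis by (simp add: young_module_def)
qed

lemma
  assumes S: "S \<in> young_module k" and us: "even (length us)"
  shows young_module_skew: "S (us @ b # a # vs) = - S (us @ a # b # vs)"
    and young_module_Bianchi: "even (length vs) \<Longrightarrow>
      S (us @ a # b # c # d # vs) + S (us @ b # c # a # d # vs) + S (us @ c # a # b # d # vs) = 0"
proof -
  obtain i where i: "length us = 2 * i" using us by auto
  have size: "S xs = 0" if "length xs \<noteq> 2 * k" for xs using S that by (simp add: young_module_def tensors_def)
  have skew: "S (us @ b # a # vs) = - S (us @ a # b # vs)" for a b vs
  proof (cases "length us + 2 + length vs = 2 * k")
    case True
    then have "i < k" using i by simp
    then have "skew_in (2 * i) (2 * i + 1) S" using S by (simp add: young_module_def)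
    from this[unfolded skew_in_def, rule_format, of "us @ a # b # vs"]
    show ?thesis unfolding permute_list_swap[OF i] .
  qed (simp add: size)
  then show "S (us @ b # a # vs) = - S (us @ a # b # vs)" .
  show "S (us @ a # b # c # d # vs) + S (us @ b # c # a # d # vs) + S (us @ c # a # b # d # vs) = 0"
    if "even (length vs)"
  proof (cases "length us + 4 + length vs = 2 * k")
    case True
    then have "i + 1 < k" using i by simp
    then have "skew_symmetrisation {2 * i, 2 * i + 1, 2 * i + 2} S (us @ a # b # c # d # vs) = 0"
      using S by (simp add: young_module_def)
    then show ?thesis
      unfolding skew_symmetrisation_three[OF i]
      using skew[of b a "c # d # vs"] skew[of c b "a # d # vs"] skew[of a c "b # d # vs"] by simp
  qed (simp add: size)
qed

text \<open>
  The pair symmetry of curvature tensors: it is a linear combination of the four Bianchi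
  identities in which each of the four arguments is once the fixed one.
\<close>

lemma young_module_pair_swap:
  assumes S: "S \<in> young_module k" and us: "even (length us)" "even (length vs)"
  shows "S (us @ a # b # c # d # vs) = S (us @ c # d # a # b # vs)"
proof -
  define R where "R a b c d = S (us @ a # b # c # d # vs)" for a b c d
  have sk1: "R b a c d = - R a b c d" for a b c d
    unfolding R_def by (rule young_module_skew[OF S us(1)])
  have sk2: "R a b d c = - R a b c d" for a b c d
    unfolding R_def using young_module_skew[OF S, of "us @ [a, b]" d c vs] us(1) by simp
  have B: "R a b c d + R b c a d + R c a b d = 0" for a b c d
    unfolding R_def by (rule young_module_Bianchi[OF S us])
  have "R a b c d = R c d a b"
    using B[of a b c d] B[of b c d a] B[of c d a b] B[of d a b c]
      sk2[of b c a d] sk2[of c d a b] sk1[of b d c a] sk2[of b d a c] sk2[of d a b c]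
      sk2[of a c b d] sk1[of a c b d] sk2[of a b c d]
    by linarith
  then show ?thesis by (simp add: R_def)
qed

lemma young_module_eq_tensor_of:
  assumes S: "S \<in> young_module k"
  obtains g where "g \<in> young_forms k" "S = tensor_of k g"
proof -
  have S0: "S xs = 0" if "length xs \<noteq> 2 * k" for xs using S that by (simp add: young_module_def tensors_def)
  define g where "g P = S (flatten (SOME ps. mset ps = P))" for P
  have g: "g (mset ps) = S (flatten ps)" for ps
  proof -
    have some: "mset (SOME qs. mset qs = mset ps) = mset ps" by (rule someI) (rule refl)
    have swap: "S (flatten (us @ p # q # vs)) = S (flatten (us @ q # p # vs))" for us p q vs
      using young_module_pair_swap[OF S, of "flatten us" "flatten vs" "fst p" "snd p" "fst q" "snd q"]
      by simp
    from function_of_mset_if_swap[of "\<lambda>ps. S (flatten ps)", OF swap some, of "[]"]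
    show ?thesis unfolding g_def by simp
  qed
  have "g \<in> young_forms k"
  proof (rule young_formsI)
    show "g P = 0" if "size P \<noteq> k" for P
    proof -
      obtain ps where "mset ps = P" using ex_mset by blast
      then show ?thesis using g[of ps] S0[of "flatten ps"] that by auto
    qed
    show "linear (\<lambda>x. g (add_mset (x, y) P))" for y P
    proof -
      obtain ps where ps: "mset ps = P" using ex_mset by blast
      have eq: "g (add_mset (x, y) P) = S ((0 # y # flatten ps)[0 := x])" for x
        using g[of "(x, y) # ps"] ps by simp
      show ?thesis
      proof (cases "Suc (length ps) = k")
        case True
        then have "linear (\<lambda>x. S ((0 # y # flatten ps)[0 := x]))"
          using S unfolding young_module_def tensors_def by (auto simp del: list_update.simps)
        then show ?thesis unfolding eq .
      next
        case False
        then show ?thesis unfolding eq by (subst S0) (auto simp: linear_zero)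
      qed
    qed
    show "g (add_mset (y, x) P) = - g (add_mset (x, y) P)" for x y P
    proof -
      obtain ps where ps: "mset ps = P" using ex_mset by blast
      then show ?thesis
        using g[of "(x, y) # ps"] g[of "(y, x) # ps"] young_module_skew[OF S, of "[]" y x "flatten ps"] by simp
    qed
    show "g (add_mset (a, b) (add_mset (c, d) P)) + g (add_mset (b, c) (add_mset (a, d) P))
       + g (add_mset (c, a) (add_mset (b, d) P)) = 0" for a b c d P
    proof -
      obtain ps where ps: "mset ps = P" using ex_mset by blast
      have "g (add_mset (a, b) (add_mset (c, d) P)) = S (a # b # c # d # flatten ps)" for a b c d
        using g[of "(a, b) # (c, d) # ps"] ps by simp
      then show ?thesis using young_module_Bianchi[OF S, of "[]" "flatten ps" a b c d] by simp
    qed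
  qed
  moreover have "S = tensor_of k g"
  proof
    fix xs show "S xs = tensor_of k g xs"
      using g[of "pairs xs"] S0[of xs] by (auto simp: tensor_of_def flatten_pairs)
  qed
  ultimately show ?thesis by (rule that)
qed

lemma sum_update_flatten:
  assumes "\<And>ps. f (flatten ps) = g (mset ps)"
  shows "(\<Sum>i<length (flatten ps). f ((flatten ps)[i := A (flatten ps ! i)])) = pair_action A g (mset ps)"
  using assms
proof (induction ps arbitrary: f g)
  case Nil
  then show ?case by (simp add: pair_action_def)
next
  case (Cons p ps)
  obtain x y where p: "p = (x, y)" by (cases p)
  have IH: "(\<Sum>i<length (flatten ps). f (x # y # (flatten ps)[i := A (flatten ps ! i)]))
      = pair_action A (contract (x, y) g) (mset ps)"
    by (rule Cons.IH) (use Cons.prems[of "(x, y) # _"] in \<open>simp add: contract_def\<close>)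
  have "(\<Sum>i<length (flatten (p # ps)). f ((flatten (p # ps))[i := A (flatten (p # ps) ! i)]))
     = f (A x # y # flatten ps) + f (x # A y # flatten ps)
       + (\<Sum>i<length (flatten ps). f (x # y # (flatten ps)[i := A (flatten ps ! i)]))"
    by (simp add: p sum.lessThan_Suc_shift del: sum.lessThan_Suc)
  also have "f (A x # y # flatten ps) = g (add_mset (A x, y) (mset ps))"
    using Cons.prems[of "(A x, y) # ps"] by simp
  also have "f (x # A y # flatten ps) = g (add_mset (x, A y) (mset ps))"
    using Cons.prems[of "(x, A y) # ps"] by simp
  finally show ?case unfolding IH by (simp add: p pair_action_add_mset)
qed

lemma tensor_of_flatten: "g \<in> young_forms k \<Longrightarrow> tensor_of k g (flatten ps) = g (mset ps)"
  using young_forms_size[of g k "mset ps"] by (auto simp: tensor_of_def)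

lemma derivation_action_tensor_of:
  assumes J: "compatible_complex_structure J" and g: "g \<in> young_forms k"
  shows "(\<forall>xs. derivation_action J (tensor_of k g) xs = 0) \<longleftrightarrow> pair_action J g = 0"
proof -
  have adj: "adjoint J = (\<lambda>x. - J x)"
    by (rule adjoint_unique) (use J_skew[OF J] in \<open>simp\<close>)
  have neg: "pair_action (adjoint J) g P = - pair_action J g P" for P
  proof -
    have "g (add_mset (- x, y) Q) = - g (add_mset (x, y) Q)" "g (add_mset (x, - y) Q) = - g (add_mset (x, y) Q)" for x y Q
      using linear_neg[OF young_forms_linear_fst[OF g]] linear_neg[OF young_forms_linear_snd[OF g]] by auto
    moreover have sum_neg: "- (\<Sum>p\<in>#P. h p) = (\<Sum>p\<in>#P. - h p)" for h :: "'a \<times> 'a \<Rightarrow> real"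
      by (induction P) auto
    ultimately show ?thesis
      unfolding pair_action_sum_mset adj by (subst sum_neg) simp
  qed
  have eq: "derivation_action J (tensor_of k g) (flatten ps) = - pair_action J g (mset ps)" for ps
    unfolding derivation_action_def neg[symmetric]
    by (rule sum_update_flatten) (rule tensor_of_flatten[OF g])
  show ?thesis
  proof
    assume L: "\<forall>xs. derivation_action J (tensor_of k g) xs = 0"
    show "pair_action J g = 0"
    proof
      fix P :: "('a \<times> 'a) multiset"
      obtain ps where "mset ps = P" using ex_mset by blast
      then show "pair_action J g P = 0 P" using eq[of ps] L by simp
    qed
  next
    assume R: "pair_action J g = 0"
    show "\<forall>xs. derivation_action J (tensor_of k g) xs = 0"
    proof
      fix xs :: "'a list"
      show "derivation_action J (tensor_of k g) xs = 0"
      proof (cases "length xs = 2 * k")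
        case True
        then show ?thesis using eq[of "pairs xs"] R by (simp add: flatten_pairs)
      qed (simp add: derivation_action_def tensor_of_def)
    qed
  qed
qed

lemma sum_Basis_contract_J:
  fixes \<beta> :: "'a::euclidean_space \<Rightarrow> 'a \<Rightarrow> real"
  assumes "\<And>y. linear (\<lambda>x. \<beta> x y)"
  shows "(\<Sum>a\<in>Basis. \<Sum>b\<in>Basis. (a \<bullet> J b) * \<beta> a b) = (\<Sum>b\<in>Basis. \<beta> (J b) b)"
proof -
  have "(\<Sum>a\<in>Basis. (a \<bullet> J b) * \<beta> a b) = \<beta> (J b) b" for b
  proof -
    have "\<beta> (J b) b = \<beta> (\<Sum>a\<in>Basis. (J b \<bullet> a) *\<^sub>R a) b" by (simp add: euclidean_representation)
    also have "\<dots> = (\<Sum>a\<in>Basis. (a \<bullet> J b) * \<beta> a b)"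
      by (subst linear_sum[OF assms]) (simp add: linear_scale[OF assms] inner_commute)
    finally show ?thesis by simp
  qed
  then show ?thesis by (subst sum.swap) simp
qed

lemma pairs_update:
  "even (length xs) \<Longrightarrow> i < length xs \<Longrightarrow> pairs (xs[i := a]) = (pairs xs)[i div 2 :=
    (if even i then (a, snd (pairs xs ! (i div 2))) else (fst (pairs xs ! (i div 2)), a))]"
proof (induction xs arbitrary: i rule: pairs.induct)
  case (1 x y zs)
  consider "i = 0" | "i = 1" | i' where "i = Suc (Suc i')"
    by (metis One_nat_def not0_implies_Suc)
  then show ?case using "1.IH" "1.prems" by cases auto
qed auto

lemma mset_update_two:
  assumes "q < length ps" "r < length ps" "q \<noteq> r"
  shows "\<exists>P. \<forall>a b. mset (ps[q := a, r := b]) = add_mset a (add_mset b P)"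
proof -
  have ordered: "\<exists>P. \<forall>a b. mset (ps[q := a, r := b]) = add_mset a (add_mset b P)"
    if "q < r" "r < length ps" for q r
  proof (intro exI allI)
    fix a b
    have "ps[q := a, r := b] = (take q ps @ a # drop (Suc q) ps)[r := b]"
      using that by (simp add: upd_conv_take_nth_drop)
    also have "\<dots> = take q ps @ a # (drop (Suc q) ps)[r - Suc q := b]"
      using less_imp_Suc_add[OF that(1)] that(2) by (auto simp: list_update_append)
    finally show "mset (ps[q := a, r := b]) =
        add_mset a (add_mset b (mset (take q ps) + (mset (drop (Suc q) ps) - {#drop (Suc q) ps ! (r - Suc q)#})))"
      using that by (simp add: mset_update)
  qed
  show ?thesis
  proof (cases "q < r")
    case True
    then show ?thesis using ordered assms by simp
  next
    case False
    then obtain P where "\<forall>a b. mset (ps[r := a, q := b]) = add_mset a (add_mset b P)"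
      using ordered[of r q] assms by auto
    then show ?thesis
      using assms(3) by (intro exI[of _ P]) (simp add: list_update_swap[of q r] add_mset_commute)
  qed
qed

text \<open>
  Two positions either form a pair, or they lie in two different pairs; up to sign the trace is
  then a trace over a pair or a cross trace.
\<close>

lemma J_trace_tensor_of_eq_0:
  assumes J: "compatible_complex_structure J" and g: "g \<in> young_forms k"
    and tr: "pair_trace J g = 0"
    and xs: "length xs = 2 * k" and ij: "i < 2 * k" "j < 2 * k" "i \<noteq> j"
  shows "J_trace J i j (tensor_of k g) xs = 0"
proof -
  define q r where "q = i div 2" and "r = j div 2"
  define ps where "ps = pairs xs"
  have ps: "length ps = k" using length_pairs[of xs] xs by (simp add: ps_def)
  have qr: "q < length ps" "r < length ps" using ij by (simp_all add: q_def r_def ps)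
  have val: "tensor_of k g (xs[i := a, j := c]) = g (mset (pairs (xs[i := a, j := c])))" for a c
    using xs by (simp add: tensor_of_def)
  have tr0: "(\<Sum>b\<in>Basis. g (add_mset (J b, b) P)) = 0" for P
    using fun_cong[OF tr, of P] by (simp add: pair_trace_def)
  have contracted: "J_trace J i j (tensor_of k g) xs = 0"
    if "\<And>a c. tensor_of k g (xs[i := a, j := c]) = \<epsilon> * \<beta> a c"
      "\<And>y. linear (\<lambda>x. \<beta> x y)" "(\<Sum>b\<in>Basis. \<beta> (J b) b) = 0" for \<beta> :: "'a \<Rightarrow> 'a \<Rightarrow> real" and \<epsilon>
  proof -
    have "J_trace J i j (tensor_of k g) xs = \<epsilon> * (\<Sum>a\<in>Basis. \<Sum>b\<in>Basis. (a \<bullet> J b) * \<beta> a b)"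
      unfolding J_trace_def that(1) by (simp add: sum_distrib_left mult.left_commute)
    then show ?thesis using sum_Basis_contract_J[OF that(2)] that(3) by simp
  qed
  show ?thesis
  proof (cases "q = r")
    case True
    define P where "P = mset ps - {#ps ! q#}"
    have "tensor_of k g (xs[i := a, j := c]) = (if even i then 1 else - 1) * g (add_mset (a, c) P)" for a c
    proof -
      have par: "even i \<longleftrightarrow> odd j" using True ij(3) unfolding q_def r_def by presburger
      have "pairs (xs[i := a, j := c]) = ps[q := (if even i then (a, c) else (c, a))]"
        using xs ij qr True par by (simp add: pairs_update ps_def q_def r_def)
      then have "tensor_of k g (xs[i := a, j := c]) = g (add_mset (if even i then (a, c) else (c, a)) P)"
        using qr by (simp add: val mset_update P_def)
      then show ?thesis using young_forms_skew[OF g, of c a P] by simp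
    qed
    then show ?thesis by (rule contracted) (use young_forms_linear_fst[OF g] tr0 in auto)
  next
    case False
    obtain P where P: "\<And>p p'. mset (ps[q := p, r := p']) = add_mset p (add_mset p' P)"
      using mset_update_two[OF qr False] by metis
    define u where "u = (if even i then snd (ps ! q) else fst (ps ! q))"
    define v where "v = (if even j then snd (ps ! r) else fst (ps ! r))"
    define s where "s = (if even i then 1 else - 1 :: real) * (if even j then 1 else - 1)"
    have "tensor_of k g (xs[i := a, j := c]) = s * g (add_mset (a, u) (add_mset (c, v) P))" for a c
    proof -
      have "pairs (xs[i := a, j := c]) = ps[q := (if even i then (a, u) else (u, a)), r := (if even j then (c, v) else (v, c))]"
        using xs ij qr False by (simp add: pairs_update ps_def q_def r_def u_def v_def)
      then have "tensor_of k g (xs[i := a, j := c])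
          = g (add_mset (if even i then (a, u) else (u, a)) (add_mset (if even j then (c, v) else (v, c)) P))"
        by (simp add: val P)
      also have "\<dots> = (if even i then 1 else - 1) * g (add_mset (if even j then (c, v) else (v, c)) (add_mset (a, u) P))"
        using young_forms_skew[OF g, of u a "add_mset (if even j then (c, v) else (v, c)) P"]
        by (simp add: add_mset_commute)
      also have "\<dots> = s * g (add_mset (c, v) (add_mset (a, u) P))"
        using young_forms_skew[OF g, of v c "add_mset (a, u) P"] by (simp add: s_def)
      finally show ?thesis by (simp add: add_mset_commute)
    qed
    moreover have "(\<Sum>b\<in>Basis. g (add_mset (J b, u) (add_mset (b, v) P))) = 0"
      using cross_trace[OF J g, of u v P] fun_cong[OF tr, of "add_mset (u, v) P"] by simp
    ultimately show ?thesis
      using young_forms_linear_fst[OF g] by (intro contracted[of s "\<lambda>a c. g (add_mset (a, u) (add_mset (c, v) P))"])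
  qed
qed

lemma totally_trace_free_tensor_of:
  assumes J: "compatible_complex_structure J" and g: "g \<in> young_forms k"
  shows "totally_trace_free J (2 * k) (tensor_of k g) \<longleftrightarrow> pair_trace J g = 0"
proof
  assume L: "totally_trace_free J (2 * k) (tensor_of k g)"
  show "pair_trace J g = 0"
  proof
    fix P :: "('a \<times> 'a) multiset"
    show "pair_trace J g P = 0 P"
    proof (cases "Suc (size P) = k")
      case False
      then show ?thesis using young_forms_size[OF g] by (simp add: pair_trace_def)
    next
      case True
      obtain ps where ps: "mset ps = P" using ex_mset by blast
      have len: "length ps = k - 1" "0 < k" using True ps by auto
      have "J_trace J 0 1 (tensor_of k g) (0 # 0 # flatten ps) = 0"
        using L True len unfolding totally_trace_free_def by (auto simp del: One_nat_def)
      moreover have "J_trace J 0 1 (tensor_of k g) (0 # 0 # flatten ps)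
          = (\<Sum>a\<in>Basis. \<Sum>b\<in>Basis. (a \<bullet> J b) * g (add_mset (a, b) P))"
        using tensor_of_flatten[OF g, of "(_, _) # ps"] ps by (simp add: J_trace_def)
      ultimately show ?thesis
        using sum_Basis_contract_J[of "\<lambda>a b. g (add_mset (a, b) P)" J] young_forms_linear_fst[OF g]
        by (simp add: pair_trace_def)
    qed
  qed
next
  assume "pair_trace J g = 0"
  then show "totally_trace_free J (2 * k) (tensor_of k g)"
    unfolding totally_trace_free_def using J_trace_tensor_of_eq_0[OF J g] by blast
qed

lemma V_space_eq_image:
  assumes J: "compatible_complex_structure J"
  shows "V_space J k = tensor_of k ` harmonic_young_forms J k"
proof
  show "V_space J k \<subseteq> tensor_of k ` harmonic_young_forms J k"
  proof
    fix S assume S: "S \<in> V_space J k"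
    then have "S \<in> young_module k" by (simp add: V_space_def)
    then obtain g where g: "g \<in> young_forms k" "S = tensor_of k g"
      by (rule young_module_eq_tensor_of)
    then have "g \<in> harmonic_young_forms J k"
      using S totally_trace_free_tensor_of[OF J g(1)] derivation_action_tensor_of[OF J g(1)]
      by (simp add: V_space_def harmonic_young_forms_def)
    then show "S \<in> tensor_of k ` harmonic_young_forms J k" unfolding g(2) by (rule imageI)
  qed
  show "tensor_of k ` harmonic_young_forms J k \<subseteq> V_space J k"
  proof (rule image_subsetI)
    fix g assume "g \<in> harmonic_young_forms J k"
    then have g: "g \<in> young_forms k" "pair_action J g = 0" "pair_trace J g = 0"
      by (simp_all add: harmonic_young_forms_def)
    then show "tensor_of k g \<in> V_space J k"
      using tensor_of_in_young_module[OF g(1)] totally_trace_free_tensor_of[OF J g(1)]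
        derivation_action_tensor_of[OF J g(1)]
      by (simp add: V_space_def)
  qed
qed

lemma subspace_young_forms: "subspace (young_forms k)"
proof (rule subspaceI)
  show "(0 :: ('a::real_vector \<times> 'a) multiset \<Rightarrow> real) \<in> young_forms k"
    by (rule young_formsI) (simp_all add: linear_zero)
next
  fix g h :: "('a::real_vector \<times> 'a) multiset \<Rightarrow> real" assume g: "g \<in> young_forms k" and h: "h \<in> young_forms k"
  show "g + h \<in> young_forms k"
  proof (rule young_formsI)
    show "(g + h) (add_mset (a, b) (add_mset (c, d) P)) + (g + h) (add_mset (b, c) (add_mset (a, d) P))
       + (g + h) (add_mset (c, a) (add_mset (b, d) P)) = 0" for a b c d P
      using young_forms_Bianchi[OF g, of a b c d P] young_forms_Bianchi[OF h, of a b c d P] by simp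
    show "(g + h) (add_mset (y, x) P) = - (g + h) (add_mset (x, y) P)" for x y P
      using young_forms_skew[OF g, of y x P] young_forms_skew[OF h, of y x P] by simp
    show "linear (\<lambda>x. (g + h) (add_mset (x, y) P))" for y P
      using linear_compose_add[OF young_forms_linear_fst[OF g] young_forms_linear_fst[OF h]] by simp
  qed (simp add: young_forms_size[OF g] young_forms_size[OF h])
next
  fix r and g :: "('a::real_vector \<times> 'a) multiset \<Rightarrow> real" assume g: "g \<in> young_forms k"
  show "r *\<^sub>R g \<in> young_forms k"
  proof (rule young_formsI)
    show "(r *\<^sub>R g) (add_mset (a, b) (add_mset (c, d) P)) + (r *\<^sub>R g) (add_mset (b, c) (add_mset (a, d) P))
       + (r *\<^sub>R g) (add_mset (c, a) (add_mset (b, d) P)) = 0" for a b c d P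
      using young_forms_Bianchi[OF g, of a b c d P] by (simp add: distrib_left[symmetric])
    show "(r *\<^sub>R g) (add_mset (y, x) P) = - (r *\<^sub>R g) (add_mset (x, y) P)" for x y P
      using young_forms_skew[OF g, of y x P] by simp
    show "linear (\<lambda>x. (r *\<^sub>R g) (add_mset (x, y) P))" for y P
      using linear_compose_scale_right[OF young_forms_linear_fst[OF g], of r] by simp
  qed (simp add: young_forms_size[OF g])
qed

lemma subspace_harmonic_young_forms: "subspace (harmonic_young_forms J k)"
  using subspace_young_forms[of k]
  by (auto simp: subspace_def harmonic_young_forms_def pair_action_def pair_trace_def derivation_add_fun
      derivation_scaleR derivation_0 fun_eq_iff sum.distrib scaleR_add_right[symmetric] sum_distrib_left[symmetric]
      distrib_left[symmetric] add_ac)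

lemma dim_V_space_eq:
  assumes J: "compatible_complex_structure J"
  shows "dim (V_space J k) = dim (harmonic_young_forms J k)"
  unfolding V_space_eq_image[OF J]
proof (rule dim_linear_image_inj_on[OF _ subspace_harmonic_young_forms])
  show "linear (tensor_of k)"
    by (rule linearI) (auto simp: tensor_of_def fun_eq_iff)
  fix g assume g: "g \<in> harmonic_young_forms J k" and z: "tensor_of k g = 0"
  show "g = 0"
  proof
    fix P :: "('a \<times> 'a) multiset"
    obtain ps where "mset ps = P" using ex_mset by blast
    then show "g P = 0 P"
      using tensor_of_flatten[of g k ps] g z by (simp add: harmonic_young_forms_def)
  qed
qed

section \<open>Young forms and invariant forms have the same diagonals\<close>

lemma times_linear_diagonal: "times_linear l t (replicate_mset (Suc d) z) = real (Suc d) * (l z * t (replicate_mset d z))"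
proof (induction d arbitrary: t)
  case 0
  then show ?case by (simp add: times_linear_add_mset)
next
  case (Suc d)
  have "times_linear l t (replicate_mset (Suc (Suc d)) z)
      = l z * t (replicate_mset (Suc d) z) + times_linear l (contract z t) (replicate_mset (Suc d) z)"
    by (simp only: replicate_mset_Suc[of "Suc d"] times_linear_add_mset)
  also have "times_linear l (contract z t) (replicate_mset (Suc d) z) = real (Suc d) * (l z * t (replicate_mset (Suc d) z))"
    unfolding Suc.IH by (simp add: contract_apply)
  finally show ?case by (simp add: algebra_simps)
qed

text \<open>
  The diagonals of symmetric forms. They contain the constants and are closed under sums and
  under multiplication by linear functions, so the diagonal of a Young form is among them, without
  an explicit symmetrisation.
\<close>

definition homogeneous_polynomials :: "nat \<Rightarrow> ('u::real_vector \<Rightarrow> real) set"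
  where "homogeneous_polynomials d = {f. \<exists>t\<in>symm_forms d. \<forall>z. f z = t (replicate_mset d z)}"

lemma homogeneous_polynomials_const: "(\<lambda>z. c) \<in> homogeneous_polynomials 0"
proof -
  have "(\<lambda>Z. if Z = {#} then c else 0) \<in> symm_forms 0"
    by (auto simp: symm_forms_def multilinear_def linear_zero)
  then show ?thesis unfolding homogeneous_polynomials_def by (auto intro!: bexI[of _ "\<lambda>Z. if Z = {#} then c else 0"])
qed

lemma homogeneous_polynomials_sum:
  assumes "\<And>i. i \<in> I \<Longrightarrow> f i \<in> homogeneous_polynomials d"
  shows "(\<lambda>z. \<Sum>i\<in>I. f i z) \<in> homogeneous_polynomials d"
proof -
  have "\<forall>i\<in>I. \<exists>t. t \<in> symm_forms d \<and> (\<forall>z. f i z = t (replicate_mset d z))"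
    using assms by (auto simp: homogeneous_polynomials_def)
  then obtain t where t: "\<And>i. i \<in> I \<Longrightarrow> t i \<in> symm_forms d" "\<And>i z. i \<in> I \<Longrightarrow> f i z = t i (replicate_mset d z)"
    by metis
  have "(\<Sum>i\<in>I. t i) \<in> symm_forms d" by (rule subspace_sum[OF subspace_symm_forms t(1)])
  then show ?thesis
    unfolding homogeneous_polynomials_def mem_Collect_eq
    by (rule bexI[rotated]) (simp add: sum_fun_apply t(2))
qed

lemma homogeneous_polynomials_times_linear:
  assumes "f \<in> homogeneous_polynomials d" "linear l"
  shows "(\<lambda>z. l z * f z) \<in> homogeneous_polynomials (Suc d)"
proof -
  obtain t where t: "t \<in> symm_forms d" "\<And>z. f z = t (replicate_mset d z)"
    using assms(1) by (auto simp: homogeneous_polynomials_def)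
  have "(1 / real (Suc d)) *\<^sub>R times_linear l t \<in> symm_forms (Suc d)"
    by (rule subspace_scale[OF subspace_symm_forms symm_forms_times_linear[OF t(1) assms(2)]])
  then show ?thesis
    unfolding homogeneous_polynomials_def mem_Collect_eq
    by (rule bexI[rotated]) (simp add: times_linear_diagonal t(2) del: replicate_mset_Suc of_nat_Suc)
qed

lemma young_form_diagonal_polynomial:
  fixes g :: "('a::euclidean_space \<times> 'a) multiset \<Rightarrow> real"
  assumes g: "g \<in> young_forms k"
  shows "(\<lambda>z. g (P + replicate_mset j z)) \<in> homogeneous_polynomials (2 * j)"
proof (induction j arbitrary: P)
  case 0
  then show ?case by (simp add: homogeneous_polynomials_const)
next
  case (Suc j)
  have expand: "g (add_mset (x, y) Q) = (\<Sum>a\<in>Basis. \<Sum>b\<in>Basis. (x \<bullet> a) * ((y \<bullet> b) * g (add_mset (a, b) Q)))" for x y Q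
  proof -
    have "g (add_mset (x, y) Q) = g (add_mset (\<Sum>a\<in>Basis. (x \<bullet> a) *\<^sub>R a, y) Q)" by (simp add: euclidean_representation)
    also have "\<dots> = (\<Sum>a\<in>Basis. (x \<bullet> a) * g (add_mset (a, y) Q))"
      by (subst linear_sum[OF young_forms_linear_fst[OF g]]) (simp add: linear_scale[OF young_forms_linear_fst[OF g]])
    also have "\<dots> = (\<Sum>a\<in>Basis. (x \<bullet> a) * g (add_mset (a, \<Sum>b\<in>Basis. (y \<bullet> b) *\<^sub>R b) Q))"
      by (simp add: euclidean_representation)
    also have "\<dots> = (\<Sum>a\<in>Basis. (x \<bullet> a) * (\<Sum>b\<in>Basis. (y \<bullet> b) * g (add_mset (a, b) Q)))"
      by (subst linear_sum[OF young_forms_linear_snd[OF g]]) (simp add: linear_scale[OF young_forms_linear_snd[OF g]])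
    finally show ?thesis by (simp add: sum_distrib_left)
  qed
  have "(\<lambda>z. g (P + replicate_mset (Suc j) z)) = (\<lambda>z. \<Sum>a\<in>Basis. \<Sum>b\<in>Basis.
      (fst z \<bullet> a) * ((snd z \<bullet> b) * g (add_mset (a, b) P + replicate_mset j z)))"
  proof
    fix z :: "'a \<times> 'a"
    show "g (P + replicate_mset (Suc j) z) = (\<Sum>a\<in>Basis. \<Sum>b\<in>Basis.
      (fst z \<bullet> a) * ((snd z \<bullet> b) * g (add_mset (a, b) P + replicate_mset j z)))"
      using expand[of "fst z" "snd z" "P + replicate_mset j z"] by simp
  qed
  moreover have "linear (\<lambda>z :: 'a \<times> 'a. fst z \<bullet> a)" "linear (\<lambda>z :: 'a \<times> 'a. snd z \<bullet> a)" for a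
    by (auto intro!: linearI simp: inner_add_left)
  moreover have "(\<lambda>z. g (add_mset (a, b) P + replicate_mset j z)) \<in> homogeneous_polynomials (2 * j)" for a b
    by (rule Suc.IH)
  ultimately show ?case
    by (simp only: mult_Suc_right add_2_eq_Suc)
       (intro homogeneous_polynomials_sum homogeneous_polynomials_times_linear)
qed

lemma power_form_derivative_eq:
  fixes t :: "'u::real_vector multiset \<Rightarrow> real"
  assumes "multilinear t" "\<And>s::real. t (Z + replicate_mset n (z + s *\<^sub>R w)) = h s"
    "(h has_real_derivative D) (at 0)"
  shows "real n * t (Z + add_mset w (replicate_mset (n - 1) z)) = D"
proof -
  have "(\<lambda>s. t (Z + replicate_mset n (z + s *\<^sub>R w))) = h" using assms(2) by auto
  then show ?thesis using has_derivative_power_form[OF assms(1), of Z n z w] assms(3) DERIV_unique by metis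
qed

context
  fixes g t :: "('a::euclidean_space \<times> 'a) multiset \<Rightarrow> real" and k :: nat
  assumes g: "g \<in> young_forms k" and t: "t \<in> symm_forms (2 * k)"
    and diagonal: "\<And>z. t (replicate_mset (2 * k) z) = g (replicate_mset k z)"
begin

lemma multilinear_t: "multilinear t"
  by (rule symm_forms_multilinear[OF t])

text \<open>
  The next three lemmas differentiate the identity \<open>t(z, \<dots>, z) = g(z, \<dots>, z)\<close> with respect to
  \<open>z = (x, y)\<close>, along constant directions: along \<open>u\<close> in the first component, along \<open>v\<close> in the second
  one, and along both.
\<close>

lemma diagonal_fst_derivative:
  "real (2 * k) * t (add_mset (u, 0) (replicate_mset (2 * k - 1) (x, y))) = real k * g (add_mset (u, y) (replicate_mset (k - 1) (x, y)))"
proof -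
  have "real (2 * k) * t ({#} + add_mset (u, 0) (replicate_mset (2 * k - 1) (x, y)))
      = real k * g ({#} + image_mset (\<lambda>x. (x, y)) ({#} + add_mset u (replicate_mset (k - 1) x)))"
    by (rule power_form_derivative_eq[OF multilinear_t _ has_derivative_power_form[OF multilinear_fst_slots[OF g]]])
       (simp add: diagonal image_replicate_mset)
  then show ?thesis by (simp add: image_replicate_mset)
qed

lemma diagonal_snd_derivative:
  "real (2 * k) * t (add_mset (0, v) (replicate_mset (2 * k - 1) (x, y))) = real k * g (add_mset (x, v) (replicate_mset (k - 1) (x, y)))"
proof -
  have "real (2 * k) * t ({#} + add_mset (0, v) (replicate_mset (2 * k - 1) (x, y)))
      = real k * g ({#} + image_mset (\<lambda>y. (x, y)) ({#} + add_mset v (replicate_mset (k - 1) y)))"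
    by (rule power_form_derivative_eq[OF multilinear_t _ has_derivative_power_form[OF multilinear_snd_slots[OF g]]])
       (simp add: diagonal image_replicate_mset)
  then show ?thesis by (simp add: image_replicate_mset)
qed

lemma diagonal_second_derivative:
  "real (2 * k) * (real (2 * k - 1) * t (add_mset (u, 0) (add_mset (0, v) (replicate_mset (2 * k - 2) (x, y)))))
   = real k * (g (add_mset (u, v) (replicate_mset (k - 1) (x, y)))
      + real (k - 1) * g (add_mset (u, y) (add_mset (x, v) (replicate_mset (k - 2) (x, y)))))"
proof (cases "k = 0")
  case False
  let ?h = "\<lambda>w s. g (add_mset (u, w) {#} + image_mset (\<lambda>y. (x, y)) ({#} + replicate_mset (k - 1) (y + s *\<^sub>R v)))"
  have der: "(?h w has_real_derivative real (k - 1) *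
      g (add_mset (u, w) {#} + image_mset (\<lambda>y. (x, y)) ({#} + add_mset v (replicate_mset (k - 1 - 1) y)))) (at 0)" for w
    by (rule has_derivative_power_form[OF multilinear_snd_slots[OF g]])
  have "real (2 * k - 1) * t ({#(u, 0)#} + add_mset (0, v) (replicate_mset (2 * k - 1 - 1) (x, y)))
      = 1 / 2 * (real (k - 1) * g (add_mset (u, y) {#} + image_mset (\<lambda>y. (x, y)) ({#} + add_mset v (replicate_mset (k - 1 - 1) y)))
        + (1 * ?h v 0 + real (k - 1) *
      g (add_mset (u, v) {#} + image_mset (\<lambda>y. (x, y)) ({#} + add_mset v (replicate_mset (k - 1 - 1) y))) * 0))"
  proof (rule power_form_derivative_eq[OF multilinear_t _ DERIV_cmult[OF DERIV_add[OF der[of y] DERIV_mult[OF DERIV_ident der[of v]]]]])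
    fix s :: real
    have "g (add_mset (u, y + s *\<^sub>R v) Q) = g (add_mset (u, y) Q) + s * g (add_mset (u, v) Q)" for Q
      using linear_add[OF young_forms_linear_snd[OF g]] linear_scale[OF young_forms_linear_snd[OF g]] by simp
    then show "t ({#(u, 0)#} + replicate_mset (2 * k - 1) ((x, y) + s *\<^sub>R (0, v))) = 1 / 2 * (?h y s + s * ?h v s)"
      using diagonal_fst_derivative[of u x "y + s *\<^sub>R v"] False by (simp add: image_replicate_mset)
  qed
  then have "real (2 * k - 1) * t (add_mset (u, 0) (add_mset (0, v) (replicate_mset (2 * k - 2) (x, y))))
      = 1 / 2 * (real (k - 1) * g (add_mset (u, y) (add_mset (x, v) (replicate_mset (k - 2) (x, y))))
         + g (add_mset (u, v) (replicate_mset (k - 1) (x, y))))"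
    by (simp add: image_replicate_mset numeral_2_eq_2 add_mset_commute)
  then show ?thesis by (simp only:) (simp add: algebra_simps)
qed simp

lemma derivation_diagonal_eq:
  "derivation A t (replicate_mset (2 * k) (x, y)) = real k * (g (add_mset (fst (A (x, y)), y) (replicate_mset (k - 1) (x, y)))
     + g (add_mset (x, snd (A (x, y))) (replicate_mset (k - 1) (x, y))))"
proof -
  have "t (add_mset (A (x, y)) Z) = t (add_mset (fst (A (x, y)), 0) Z) + t (add_mset (0, snd (A (x, y))) Z)" for Z
    using multilinear_add[OF multilinear_t, of "(fst (A (x, y)), 0)" "(0, snd (A (x, y)))" Z] by simp
  then show ?thesis
    by (simp only: derivation_diagonal real_scaleR_def distrib_left diagonal_fst_derivative diagonal_snd_derivative)
qed

lemma derivation_proj_fst_of_diagonal: "derivation proj_fst t = real k *\<^sub>R t"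
proof -
  have "derivation proj_fst t - real k *\<^sub>R t = 0"
  proof (rule symm_form_eq_0_if_diagonal_eq_0)
    show "derivation proj_fst t - real k *\<^sub>R t \<in> symm_forms (2 * k)"
      by (intro subspace_diff subspace_scale subspace_symm_forms symm_forms_derivation t linear_pair_maps)
    fix z :: "'a \<times> 'a"
    have "g (add_mset (x, 0) P) = 0" for x P using linear_0[OF young_forms_linear_snd[OF g]] .
    then show "(derivation proj_fst t - real k *\<^sub>R t) (replicate_mset (2 * k) z) = 0"
      using derivation_diagonal_eq[of proj_fst "fst z" "snd z"] diagonal[of z]
      by (cases k) (simp_all add: proj_fst_def)
  qed
  then show ?thesis by simp
qed

text \<open>
  The shear replaces \<open>y\<close> by \<open>x\<close> in one pair \<open>(x, y)\<close>, and \<open>g\<close> is skew in this pair.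
\<close>

lemma derivation_fst_to_snd_of_diagonal: "derivation fst_to_snd t = 0"
proof (rule symm_form_eq_0_if_diagonal_eq_0)
  show "derivation fst_to_snd t \<in> symm_forms (2 * k)"
    by (intro symm_forms_derivation t linear_pair_maps)
  fix z :: "'a \<times> 'a"
  have "g (add_mset (x, x) P) = 0" for x P using young_forms_skew[OF g, of x x P] by simp
  moreover have "g (add_mset (0, y) P) = 0" for y P using linear_0[OF young_forms_linear_fst[OF g]] .
  ultimately show "derivation fst_to_snd t (replicate_mset (2 * k) z) = 0"
    using derivation_diagonal_eq[of fst_to_snd "fst z" "snd z"] by (simp add: fst_to_snd_def)
qed

lemma derivation_on_both_of_diagonal:
  assumes J: "linear J" and "pair_action J g = 0"
  shows "derivation (on_both J) t = 0"
proof (rule symm_form_eq_0_if_diagonal_eq_0[OF symm_forms_derivation[OF t linear_on_both[OF J]]])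
  fix z :: "'a \<times> 'a"
  have "derivation (on_both J) t (replicate_mset (2 * k) z) = pair_action J g (replicate_mset k z)"
    using derivation_diagonal_eq[of "on_both J" "fst z" "snd z"]
    by (simp add: pair_action_def derivation_diagonal on_both_def distrib_left apfst_def apsnd_def map_prod_def case_prod_beta)
  then show "derivation (on_both J) t (replicate_mset (2 * k) z) = 0" by (simp add: assms(2))
qed

text \<open>
  The contraction of the second derivatives with \<open>J\<close> is \<open>k\<close> times the trace over a pair, from the two
  derivatives that hit the same pair, plus \<open>k (k - 1)\<close> cross traces, each equal to half of it:
  altogether the nonzero multiple \<open>k (k + 1) / 2\<close>.
\<close>

lemma pair_trace_eq_0_iff:
  assumes J: "compatible_complex_structure J"
  shows "pair_trace J g = 0 \<longleftrightarrow> J_laplacian J t = 0"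
proof (cases k)
  case 0
  then show ?thesis
    using young_forms_size[OF g] symm_forms_size[OF t] by (simp add: pair_trace_def J_laplacian_def fun_eq_iff)
next
  case (Suc k')
  have eq: "real (2 * k) * (real (2 * k - 1) * J_laplacian J t (replicate_mset (2 * k') z))
      = real k * (real k + 1) / 2 * pair_trace J g (replicate_mset k' z)" for z
  proof -
    obtain x y where z: "z = (x, y)" by (cases z)
    have "real (k - 1) * (\<Sum>b\<in>Basis. g (add_mset (J b, y) (add_mset (x, b) (replicate_mset (k - 2) z))))
        = real (k - 1) / 2 * pair_trace J g (replicate_mset k' z)"
    proof (cases k')
      case 0
      then show ?thesis using Suc by simp
    next
      case (Suc k'')
      let ?P = "replicate_mset k'' z"
      have "(\<Sum>b\<in>Basis. g (add_mset (J b, y) (add_mset (x, b) ?P))) = - (\<Sum>b\<in>Basis. g (add_mset (J b, y) (add_mset (b, x) ?P)))"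
        unfolding sum_negf[symmetric]
      proof (rule sum.cong[OF refl])
        fix b
        show "g (add_mset (J b, y) (add_mset (x, b) ?P)) = - g (add_mset (J b, y) (add_mset (b, x) ?P))"
          using young_forms_skew[OF g, of x b "add_mset (J b, y) ?P"] by (simp add: add_mset_commute)
      qed
      also have "\<dots> = - (1 / 2 * pair_trace J g (add_mset (y, x) ?P))"
        unfolding cross_trace[OF J g, symmetric] by simp
      also have "pair_trace J g (add_mset (y, x) ?P) = - pair_trace J g (add_mset (x, y) ?P)"
        by (rule young_forms_skew[OF young_forms_pair_trace]) (use g \<open>k = Suc k'\<close> in simp)
      finally show ?thesis using Suc \<open>k = Suc k'\<close> z by simp
    qed
    moreover have "real (2 * k) * (real (2 * k - 1) * J_laplacian J t (replicate_mset (2 * k') z))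
       = (\<Sum>b\<in>Basis. real k * (g (add_mset (J b, b) (replicate_mset (k - 1) z))
      + real (k - 1) * g (add_mset (J b, y) (add_mset (x, b) (replicate_mset (k - 2) z)))))"
      unfolding diagonal_second_derivative[symmetric, folded z] z
      by (simp add: J_laplacian_def sum_distrib_left Suc)
    moreover have "(\<Sum>b\<in>Basis. real k * (g (add_mset (J b, b) (replicate_mset (k - 1) z))
      + real (k - 1) * g (add_mset (J b, y) (add_mset (x, b) (replicate_mset (k - 2) z)))))
      = real k * (pair_trace J g (replicate_mset k' z)
        + real (k - 1) * (\<Sum>b\<in>Basis. g (add_mset (J b, y) (add_mset (x, b) (replicate_mset (k - 2) z)))))"
      using Suc by (simp add: sum.distrib sum_distrib_left[symmetric] pair_trace_def)
    ultimately have "real (2 * k) * (real (2 * k - 1) * J_laplacian J t (replicate_mset (2 * k') z))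
       = real k * (pair_trace J g (replicate_mset k' z) + real (k - 1) / 2 * pair_trace J g (replicate_mset k' z))"
      by (simp only:)
    also have "\<dots> = real k * (real k + 1) / 2 * pair_trace J g (replicate_mset k' z)"
      using Suc by (simp add: field_simps)
    finally show ?thesis .
  qed
  show ?thesis
  proof
    assume "pair_trace J g = 0"
    then have "real (2 * k) * (real (2 * k - 1) * J_laplacian J t (replicate_mset (2 * k') z)) = 0" for z
      unfolding eq by simp
    then have "J_laplacian J t (replicate_mset (2 * k') z) = 0" for z
      using Suc unfolding mult_eq_0_iff by fastforce
    moreover have "J_laplacian J t \<in> symm_forms (2 * k')"
      using symm_forms_J_laplacian[OF J, of t "2 * k'"] t Suc by simp
    ultimately show "J_laplacian J t = 0" by (intro symm_form_eq_0_if_diagonal_eq_0)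
  next
    assume "J_laplacian J t = 0"
    with eq Suc have "pair_trace J g (replicate_mset k' z) = 0" for z
      by simp
    moreover have "pair_trace J g \<in> young_forms k'"
      using young_forms_pair_trace[of g k'] g Suc by simp
    ultimately show "pair_trace J g = 0" by (intro young_form_eq_0_if_diagonal_eq_0)
  qed
qed

end

section \<open>From invariant forms to Young forms\<close>

text \<open>
  The column part of a Young symmetriser: \<open>skew_pair (x, y)\<close> fills one argument of each kind and
  skew-symmetrises, and \<open>young_symmetrise\<close> does this for all pairs. These operators commute for
  different pairs, so the fold over a multiset is well defined.
\<close>

definition skew_pair :: "'a::zero \<times> 'a \<Rightarrow> (('a \<times> 'a) multiset \<Rightarrow> real) \<Rightarrow> ('a \<times> 'a) multiset \<Rightarrow> real"
  where "skew_pair p t = (\<lambda>Z. t (add_mset (fst p, 0) (add_mset (0, snd p) Z)) - t (add_mset (snd p, 0) (add_mset (0, fst p) Z)))"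

definition young_symmetrise :: "(('a::zero \<times> 'a) multiset \<Rightarrow> real) \<Rightarrow> ('a \<times> 'a) multiset \<Rightarrow> real"
  where "young_symmetrise t P = fold_mset skew_pair t P {#}"

interpretation skew_pair: comp_fun_commute skew_pair
  by unfold_locales (simp add: skew_pair_def fun_eq_iff add_mset_commute)

lemma young_symmetrise_add_mset: "young_symmetrise t (add_mset p P) = young_symmetrise (skew_pair p t) P"
  by (simp add: young_symmetrise_def skew_pair.fold_mset_fun_left_comm del: fun_cong)

lemma skew_pair_add: "skew_pair p (s + t) = skew_pair p s + skew_pair p t"
  and skew_pair_scale: "skew_pair p (r *\<^sub>R t) = r *\<^sub>R skew_pair p t"
  by (simp_all add: skew_pair_def fun_eq_iff algebra_simps)

lemma linear_young_symmetrise: "linear (\<lambda>t. young_symmetrise t P)"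
proof (induction P)
  case empty
  show ?case by (rule linearI) (simp_all add: young_symmetrise_def)
next
  case (add p P)
  have "linear (skew_pair p)" by (rule linearI) (simp_all add: skew_pair_add skew_pair_scale)
  from linear_compose[OF this add.IH] show ?case by (simp add: young_symmetrise_add_mset o_def)
qed

lemma fold_skew_pair_size:
  assumes "t \<in> symm_forms d"
  shows "size Z + 2 * size P \<noteq> d \<Longrightarrow> fold_mset skew_pair t P Z = 0"
  by (induction P arbitrary: Z) (simp_all add: skew_pair_def symm_forms_size[OF assms])

lemma young_symmetrise_in_young_forms:
  assumes t: "t \<in> symm_forms (2 * k)"
  shows "young_symmetrise t \<in> young_forms k"
proof (rule young_formsI)
  have ml: "multilinear t" by (rule symm_forms_multilinear[OF t])
  have lin: "linear (\<lambda>t. young_symmetrise t P)" for P :: "('a \<times> 'a) multiset"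
    by (rule linear_young_symmetrise)
  show "young_symmetrise t P = 0" if "size P \<noteq> k" for P
    unfolding young_symmetrise_def using that by (intro fold_skew_pair_size[OF t]) simp
  show "linear (\<lambda>x. young_symmetrise t (add_mset (x, y) P))" for y P
  proof -
    have "linear (\<lambda>x. t (add_mset (x, 0) Z))" "linear (\<lambda>x. t (add_mset (0, x) Z))" for Z
      using linear_slot_fst[OF ml linear_ident] linear_slot_snd[OF ml linear_ident] by simp_all
    then have "linear (\<lambda>x. skew_pair (x, y) t Z)" for Z
      unfolding skew_pair_def by (intro linear_compose_sub) (simp_all add: add_mset_commute[of "(y, 0)"])
    then have "linear (\<lambda>x. skew_pair (x, y) t)"
      by (intro linearI ext) (simp_all add: linear_iff)
    from linear_compose[OF this lin] show ?thesis by (simp add: young_symmetrise_add_mset o_def)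
  qed
  show "young_symmetrise t (add_mset (y, x) P) = - young_symmetrise t (add_mset (x, y) P)" for x y P
  proof -
    have "skew_pair (y, x) t = - skew_pair (x, y) t" by (simp add: skew_pair_def fun_eq_iff)
    then show ?thesis using linear_neg[OF lin] by (simp add: young_symmetrise_add_mset)
  qed
  show "young_symmetrise t (add_mset (a, b) (add_mset (c, d) P)) + young_symmetrise t (add_mset (b, c) (add_mset (a, d) P))
       + young_symmetrise t (add_mset (c, a) (add_mset (b, d) P)) = 0" for a b c d P
  proof -
    have "skew_pair (c, d) (skew_pair (a, b) t) + skew_pair (a, d) (skew_pair (b, c) t) + skew_pair (b, d) (skew_pair (c, a) t) = 0"
      by (simp add: skew_pair_def fun_eq_iff add_mset_commute)
    from arg_cong[OF this, of "\<lambda>t. young_symmetrise t P"]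
    show ?thesis by (simp add: young_symmetrise_add_mset linear_add[OF lin] linear_0[OF lin])
  qed
qed

lemma pair_action_young_symmetrise:
  fixes t :: "('a::real_vector \<times> 'a) multiset \<Rightarrow> real"
  assumes J: "linear J"
  shows "pair_action J (young_symmetrise t) P = young_symmetrise (derivation (on_both J) t) P"
proof (induction P arbitrary: t)
  case empty
  show ?case by (simp add: pair_action_def young_symmetrise_def)
next
  case (add p P)
  obtain x y where p: "p = (x, y)" by (cases p)
  have slots: "derivation A t (add_mset u (add_mset v Z)) = t (add_mset (A u) (add_mset v Z))
      + t (add_mset u (add_mset (A v) Z)) + derivation A (\<lambda>Z. t (add_mset u (add_mset v Z))) Z" for A u v Z
    by (simp add: derivation_add_mset contract_def add_mset_commute)
  have "derivation (on_both J) (skew_pair (x, y) t) Z = derivation (on_both J) (\<lambda>Z. t (add_mset (x, 0) (add_mset (0, y) Z))) Z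
      - derivation (on_both J) (\<lambda>Z. t (add_mset (y, 0) (add_mset (0, x) Z))) Z" for Z
    using linear_diff[OF linear_derivation, of "on_both J" "\<lambda>Z. t (add_mset (x, 0) (add_mset (0, y) Z))"
        "\<lambda>Z. t (add_mset (y, 0) (add_mset (0, x) Z))"]
    by (simp add: skew_pair_def fun_eq_iff fun_diff_def)
  then have "skew_pair (x, y) (derivation (on_both J) t)
      = skew_pair (J x, y) t + skew_pair (x, J y) t + derivation (on_both J) (skew_pair (x, y) t)"
    by (simp add: skew_pair_def fun_eq_iff slots) (simp add: on_both_def linear_0[OF J])
  moreover have "contract (x, y) (young_symmetrise t) = young_symmetrise (skew_pair (x, y) t)"
    by (simp add: contract_def young_symmetrise_add_mset fun_eq_iff)
  ultimately show ?case
    by (simp add: p pair_action_add_mset young_symmetrise_add_mset add.IH linear_add[OF linear_young_symmetrise])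
qed

lemma derivation_replicate_union:
  fixes t :: "'u multiset \<Rightarrow> real"
  shows "derivation A t (replicate_mset n v + W) = real n * t (add_mset (A v) (replicate_mset (n - 1) v + W))
     + derivation A (\<lambda>X. t (replicate_mset n v + X)) W"
proof (induction n arbitrary: t)
  case (Suc n)
  have "derivation A t (replicate_mset (Suc n) v + W) = t (add_mset (A v) (replicate_mset n v + W))
      + derivation A (contract v t) (replicate_mset n v + W)"
    by (simp add: derivation_add_mset)
  also have "derivation A (contract v t) (replicate_mset n v + W)
      = real n * t (add_mset (A v) (replicate_mset n v + W)) + derivation A (\<lambda>X. t (replicate_mset (Suc n) v + X)) W"
    unfolding Suc.IH by (cases n) (simp_all add: contract_def add_mset_commute)
  finally show ?case by (simp add: algebra_simps)
qed simp

text \<open>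
  On equal pairs the symmetriser is the alternating binomial sum of the values
  \<open>\<tau>\<^sub>i = t (B (k - i) i)\<close>, in which \<open>i\<close> arguments of each kind have been exchanged. Invariance under
  the shear gives \<open>(k - i) \<tau>\<^sub>i\<^sub>+\<^sub>1 + (i + 1) \<tau>\<^sub>i = 0\<close>, which makes all \<open>k + 1\<close> terms of the sum equal to
  \<open>\<tau>\<^sub>0\<close>.
\<close>

lemma young_symmetrise_diagonal:
  assumes t: "t \<in> symm_forms (2 * k)" "derivation fst_to_snd t = 0"
  shows "young_symmetrise t (replicate_mset k (x, y)) = real (k + 1) * t (replicate_mset k (x, 0) + replicate_mset k (0, y))"
proof -
  define B where "B p q = replicate_mset p (x, 0) + (replicate_mset p (0, y) + (replicate_mset q (y, 0) + replicate_mset q (0, x)))" for p q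
  define W where "W j p q = fold_mset skew_pair t (replicate_mset j (x, y)) (B p q)" for j p q
  have "W (Suc j) p q = W j (Suc p) q + (- 1) * W j p (Suc q)" for j p q
    by (simp add: W_def skew_pair_def B_def add_mset_commute)
  from binomial_recurrence[of W "- 1", OF this, of k 0 0]
  have "young_symmetrise t (replicate_mset k (x, y)) = (\<Sum>i\<le>k. real (k choose i) * (- 1) ^ i * t (B (k - i) i))"
    by (simp add: W_def young_symmetrise_def B_def)
  also have "\<dots> = (\<Sum>i\<le>k. t (B k 0))"
  proof (rule sum.cong[OF refl])
    have ml: "multilinear t" by (rule symm_forms_multilinear[OF t(1)])
    have zero: "t Z = 0" if "(0, 0) \<in># Z" for Z
      using multilinear_zero[OF ml] multi_member_split[OF that] by (auto simp: zero_prod_def)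
    fix i assume "i \<in> {..k}"
    then have "i \<le> k" by simp
    then show "real (k choose i) * (- 1) ^ i * t (B (k - i) i) = t (B k 0)"
    proof (induction i)
      case (Suc i)
      then have i: "i < k" by simp
      have step: "real (k - i) * t (B (k - Suc i) (Suc i)) + real (Suc i) * t (B (k - i) i) = 0"
      proof -
        have "derivation fst_to_snd t (replicate_mset (k - i) (x, 0) + (replicate_mset (Suc i) (y, 0)
            + (replicate_mset (k - Suc i) (0, y) + (replicate_mset i (0, x) + {#})))) = 0"
          unfolding t(2) by simp
        moreover obtain m where m: "k = i + Suc m" using i less_imp_Suc_add by auto
        ultimately show ?thesis
          unfolding derivation_replicate_union derivation_empty
          by (simp add: fst_to_snd_def zero B_def add_mset_commute ac_simps)
      qed
      have "Suc i * (k choose Suc i) = (k - i) * (k choose i)"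
        by (simp only: binomial_absorption binomial_absorb_comp)
      then have choose: "real (Suc i) * real (k choose Suc i) = real (k - i) * real (k choose i)"
        by (metis of_nat_mult)
      have "real (Suc i) * (real (k choose Suc i) * (- 1) ^ Suc i * t (B (k - Suc i) (Suc i)))
          = - (real (k choose i) * (- 1) ^ i * (real (k - i) * t (B (k - Suc i) (Suc i))))"
        using choose by simp
      also have "\<dots> = real (k choose i) * (- 1) ^ i * (real (Suc i) * t (B (k - i) i))"
        using step by (simp only: eq_neg_iff_add_eq_0[symmetric])
      also have "\<dots> = real (Suc i) * t (B k 0)"
        using Suc.IH i by (simp add: mult.left_commute mult.assoc)
      finally show ?case by (simp only: mult_cancel_left of_nat_eq_0_iff nat.simps simp_thms)
    qed simp
  qed
  finally show ?thesis by (simp add: B_def)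
qed

definition harmonic_forms :: "('a::euclidean_space \<Rightarrow> 'a) \<Rightarrow> nat \<Rightarrow> (('a \<times> 'a) multiset \<Rightarrow> real) set"
  where "harmonic_forms J k = {t \<in> invariant_forms J k. J_laplacian J t = 0}"

text \<open>
  From the left to the right, the Young symmetriser multiplies the diagonal by a known nonzero
  number; the trace condition is transferred by comparing diagonals, the invariance under \<open>J\<close>
  because the symmetriser commutes with \<open>J\<close>.
\<close>

lemma diagonals_of_harmonic_forms:
  fixes J :: "'a::euclidean_space \<Rightarrow> 'a"
  assumes J: "compatible_complex_structure J"
  shows "(\<lambda>t z. t (replicate_mset (2 * k) z)) ` harmonic_forms J k = (\<lambda>g z. g (replicate_mset k z)) ` harmonic_young_forms J k"
proof (intro equalityI image_subsetI)
  fix t assume t: "t \<in> harmonic_forms J k"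
  then have w: "t \<in> weight_forms J (2 * k) (real k)" and s: "t \<in> symm_forms (2 * k)"
    and ops: "derivation fst_to_snd t = 0" "derivation (on_both J) t = 0" "J_laplacian J t = 0"
    by (simp_all add: harmonic_forms_def invariant_forms_def weight_forms_def)
  \<comment> \<open>The binomial coefficient compares \<open>t(z, \<dots>, z)\<close> with its part of degree \<open>k\<close> in either
      component; \<open>k + 1\<close> is the factor that the symmetriser produces.\<close>
  define g where "g = (real (2 * k choose k) / real (k + 1)) *\<^sub>R young_symmetrise t"
  have g: "g \<in> young_forms k"
    unfolding g_def by (intro subspace_scale subspace_young_forms young_symmetrise_in_young_forms s)
  have diag: "t (replicate_mset (2 * k) z) = g (replicate_mset k z)" for z
  proof -
    obtain x y where z: "z = (x, y)" by (cases z)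
    show ?thesis
      unfolding z weight_form_diagonal[OF w] g_def scaleR_fun_apply young_symmetrise_diagonal[OF s ops(1)]
      by simp
  qed
  have "pair_action J (young_symmetrise t) P = 0" for P
    by (simp only: pair_action_young_symmetrise[OF J_linear[OF J]] ops(2) linear_0[OF linear_young_symmetrise])
  then have "pair_action J (young_symmetrise t) = 0" by (simp add: fun_eq_iff)
  then have "pair_action J g = 0"
    by (simp add: g_def pair_action_def derivation_scaleR scaleR_add_right[symmetric])
  then have "g \<in> harmonic_young_forms J k"
    using g pair_trace_eq_0_iff[OF g s diag J] ops by (simp add: harmonic_young_forms_def)
  moreover have "(\<lambda>z. t (replicate_mset (2 * k) z)) = (\<lambda>z. g (replicate_mset k z))"
    by (rule ext) (rule diag)
  ultimately show "(\<lambda>z. t (replicate_mset (2 * k) z)) \<in> (\<lambda>g z. g (replicate_mset k z)) ` harmonic_young_forms J k"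
    by (intro image_eqI[where x = g])
next
  fix g assume "g \<in> harmonic_young_forms J k"
  then have g: "g \<in> young_forms k" and ops: "pair_action J g = 0" "pair_trace J g = 0"
    by (simp_all add: harmonic_young_forms_def)
  obtain t where s: "t \<in> symm_forms (2 * k)" and diag: "\<And>z. t (replicate_mset (2 * k) z) = g (replicate_mset k z)"
    using young_form_diagonal_polynomial[OF g, of "{#}" k] by (auto simp: homogeneous_polynomials_def)
  have "t \<in> harmonic_forms J k"
    using s ops derivation_proj_fst_of_diagonal[OF g s diag] derivation_fst_to_snd_of_diagonal[OF g s diag]
      derivation_on_both_of_diagonal[OF g s diag J_linear[OF J]] pair_trace_eq_0_iff[OF g s diag J]
    by (simp add: harmonic_forms_def invariant_forms_def weight_forms_def)
  moreover have "(\<lambda>z. g (replicate_mset k z)) = (\<lambda>z. t (replicate_mset (2 * k) z))"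
    by (rule ext) (rule diag[symmetric])
  ultimately show "(\<lambda>z. g (replicate_mset k z)) \<in> (\<lambda>t z. t (replicate_mset (2 * k) z)) ` harmonic_forms J k"
    by (intro image_eqI[where x = t])
qed

lemma subspace_harmonic_forms:
  assumes "compatible_complex_structure J"
  shows "subspace (harmonic_forms J k)"
proof -
  have "subspace {t. J_laplacian J t = 0}"
    using linear_J_laplacian[OF assms] by (simp add: linear_subspace_kernel)
  then have "subspace (invariant_forms J k \<inter> {t. J_laplacian J t = 0})"
    by (intro subspace_inter subspace_invariant_forms)
  moreover have "harmonic_forms J k = invariant_forms J k \<inter> {t. J_laplacian J t = 0}"
    unfolding harmonic_forms_def by blast
  ultimately show ?thesis by (simp only:)
qed

lemma dim_harmonic_young_forms:
  assumes J: "compatible_complex_structure J"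
  shows "dim (harmonic_young_forms J k) = dim (harmonic_forms J k)"
proof -
  have "dim (harmonic_young_forms J k) = dim ((\<lambda>g z. g (replicate_mset k z)) ` harmonic_young_forms J k)"
  proof (rule dim_linear_image_inj_on[OF _ subspace_harmonic_young_forms, symmetric])
    show "linear (\<lambda>g :: ('a \<times> 'a) multiset \<Rightarrow> real. \<lambda>z. g (replicate_mset k z))"
      by (rule linearI) (simp_all add: fun_eq_iff)
    fix g assume g: "g \<in> harmonic_young_forms J k" and zero: "(\<lambda>z. g (replicate_mset k z)) = 0"
    show "g = 0"
    proof (rule young_form_eq_0_if_diagonal_eq_0)
      show "g \<in> young_forms k" using g by (simp add: harmonic_young_forms_def)
      show "g (replicate_mset k z) = 0" for z using fun_cong[OF zero, of z] by simp
    qed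
  qed
  also have "\<dots> = dim ((\<lambda>t z. t (replicate_mset (2 * k) z)) ` harmonic_forms J k)"
    by (simp only: diagonals_of_harmonic_forms[OF J])
  also have "\<dots> = dim (harmonic_forms J k)"
  proof (rule dim_linear_image_inj_on[OF _ subspace_harmonic_forms[OF J]])
    show "linear (\<lambda>g :: ('a \<times> 'a) multiset \<Rightarrow> real. \<lambda>z. g (replicate_mset (2 * k) z))"
      by (rule linearI) (simp_all add: fun_eq_iff)
    fix t assume t: "t \<in> harmonic_forms J k" and zero: "(\<lambda>z. t (replicate_mset (2 * k) z)) = 0"
    show "t = 0"
    proof (rule symm_form_eq_0_if_diagonal_eq_0)
      show "t \<in> symm_forms (2 * k)" using t by (simp add: harmonic_forms_def invariant_forms_def weight_forms_def)
      show "t (replicate_mset (2 * k) z) = 0" for z using fun_cong[OF zero, of z] by simp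
    qed
  qed
  finally show ?thesis .
qed

section \<open>Diagonalising derivations over the complex numbers\<close>

lemma multilinear_complex_combination:
  fixes t :: "'u::real_vector multiset \<Rightarrow> complex"
  assumes "multilinear t"
  shows "t (add_mset (r *\<^sub>R u - s *\<^sub>R v) Z) = of_real r * t (add_mset u Z) - of_real s * t (add_mset v Z)"
    and "t (add_mset (r *\<^sub>R u + s *\<^sub>R v) Z) = of_real r * t (add_mset u Z) + of_real s * t (add_mset v Z)"
  using multilinear_add[OF assms, of "r *\<^sub>R u" "- (s *\<^sub>R v)" Z]
  by (simp_all add: multilinear_add[OF assms] multilinear_scale[OF assms] multilinear_minus[OF assms] scaleR_conv_of_real)

lemma complex_mult_split:
  "w * (x + \<i> * y) = (of_real (Re w) * x - of_real (Im w) * y) + \<i> * (of_real (Im w) * x + of_real (Re w) * y)"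
  by (simp add: complex_eq_iff algebra_simps)

text \<open>
  The vectors \<open>p l + \<i> q l\<close> with \<open>l \<in> L\<close> form a basis of the complexification of the space, with
  coordinates \<open>\<zeta> l\<close>. The complexification itself is avoided: a real-linear map \<open>f\<close> into the complex
  numbers extends to it by \<open>f (p l) + \<i> f (q l)\<close>. The default value \<open>0\<close> outside of \<open>L\<close> makes the
  coefficients of forms vanish there.
\<close>

locale complex_frame =
  fixes L :: "'l set" and p q :: "'l \<Rightarrow> 'u::real_vector" and \<zeta> :: "'l \<Rightarrow> 'u \<Rightarrow> complex"
  assumes finite_L: "finite L"
    and outside: "l \<notin> L \<Longrightarrow> p l = 0" "l \<notin> L \<Longrightarrow> q l = 0"
    and linear_coordinate: "linear (\<zeta> l)"
    and dual: "l \<in> L \<Longrightarrow> l' \<in> L \<Longrightarrow> \<zeta> l (p l') + \<i> * \<zeta> l (q l') = (if l = l' then 1 else 0)"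
    and expand_Re: "(\<Sum>l\<in>L. Re (\<zeta> l z) *\<^sub>R p l - Im (\<zeta> l z) *\<^sub>R q l) = z"
    and expand_Im: "(\<Sum>l\<in>L. Im (\<zeta> l z) *\<^sub>R p l + Re (\<zeta> l z) *\<^sub>R q l) = 0"
begin

text \<open>
  Passing between a form and its coefficients in the monomial basis: \<open>slot l\<close> fills one argument of
  a form with the \<open>l\<close>-th basis vector, and \<open>expand z\<close> fills one index with the coordinates of \<open>z\<close>. The
  operators of each family commute, and folding them over a multiset of labels or of vectors gives
  mutually inverse maps.
\<close>

definition slot :: "'l \<Rightarrow> ('u multiset \<Rightarrow> complex) \<Rightarrow> 'u multiset \<Rightarrow> complex"
  where "slot l t = (\<lambda>Z. t (add_mset (p l) Z) + \<i> * t (add_mset (q l) Z))"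

definition expand :: "'u \<Rightarrow> ('l multiset \<Rightarrow> complex) \<Rightarrow> 'l multiset \<Rightarrow> complex"
  where "expand z c = (\<lambda>W. \<Sum>l\<in>L. \<zeta> l z * c (add_mset l W))"

definition coefficients :: "('u multiset \<Rightarrow> complex) \<Rightarrow> 'l multiset \<Rightarrow> complex"
  where "coefficients t W = fold_mset slot t W {#}"

definition form_of :: "('l multiset \<Rightarrow> complex) \<Rightarrow> 'u multiset \<Rightarrow> complex"
  where "form_of c Z = fold_mset expand c Z {#}"

sublocale slot: comp_fun_commute slot
  by unfold_locales (simp add: slot_def fun_eq_iff add_mset_commute algebra_simps)

sublocale expand: comp_fun_commute expand
proof unfold_locales
  fix z z'
  have "expand z (expand z' c) W = expand z' (expand z c) W" for c W
  proof -
    have "expand z (expand z' c) W = (\<Sum>l\<in>L. \<Sum>l'\<in>L. \<zeta> l z * (\<zeta> l' z' * c (add_mset l' (add_mset l W))))"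
      by (simp add: expand_def sum_distrib_left)
    also have "\<dots> = (\<Sum>l'\<in>L. \<Sum>l\<in>L. \<zeta> l z * (\<zeta> l' z' * c (add_mset l' (add_mset l W))))"
      by (rule sum.swap)
    also have "\<dots> = expand z' (expand z c) W"
      by (simp add: expand_def sum_distrib_left mult.left_commute add_mset_commute)
    finally show ?thesis .
  qed
  then show "expand z' \<circ> expand z = expand z \<circ> expand z'" by (simp add: fun_eq_iff)
qed

lemma coefficients_empty [simp]: "coefficients t {#} = t {#}"
  by (simp add: coefficients_def)

lemma form_of_empty [simp]: "form_of c {#} = c {#}"
  by (simp add: form_of_def)

lemma coefficients_add_mset: "coefficients t (add_mset l W) = coefficients (slot l t) W"
  unfolding coefficients_def slot.fold_mset_add_mset slot.fold_mset_fun_left_comm ..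

lemma form_of_add_mset: "form_of c (add_mset z Z) = form_of (expand z c) Z"
  unfolding form_of_def expand.fold_mset_add_mset expand.fold_mset_fun_left_comm ..

lemma coefficients_sum: "coefficients (\<lambda>Z. \<Sum>i\<in>I. a i * t i Z) W = (\<Sum>i\<in>I. a i * coefficients (t i) W)"
proof (induction W arbitrary: t)
  case (add l W)
  have "slot l (\<lambda>Z. \<Sum>i\<in>I. a i * t i Z) = (\<lambda>Z. \<Sum>i\<in>I. a i * slot l (t i) Z)"
    by (simp add: slot_def fun_eq_iff sum.distrib sum_distrib_left algebra_simps)
  then show ?case by (simp add: coefficients_add_mset add.IH)
qed simp

lemma coefficients_combination:
  "coefficients (\<lambda>Z. a * s Z + t Z) W = a * coefficients s W + coefficients t W"
proof (induction W arbitrary: s t)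
  case (add l W)
  have "slot l (\<lambda>Z. a * s Z + t Z) = (\<lambda>Z. a * slot l s Z + slot l t Z)"
    by (simp add: slot_def fun_eq_iff algebra_simps)
  then show ?case by (simp add: coefficients_add_mset add.IH)
qed simp

lemma form_of_combination:
  "form_of (\<lambda>W. c W + a * c' W) Z = form_of c Z + a * form_of c' Z"
proof (induction Z arbitrary: c c')
  case (add z Z)
  have "expand z (\<lambda>W. c W + a * c' W) = (\<lambda>W. expand z c W + a * expand z c' W)"
    by (simp add: expand_def fun_eq_iff sum.distrib sum_distrib_left algebra_simps)
  then show ?case by (simp add: form_of_add_mset add.IH)
qed simp

lemma form_of_zero: "form_of (\<lambda>W. 0) Z = 0"
proof (induction Z)
  case (add z Z)
  have "expand z (\<lambda>W. 0) = (\<lambda>W. 0)" by (simp add: expand_def)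
  with add show ?case by (simp add: form_of_add_mset)
qed simp

lemma linear_coefficients: "linear coefficients"
proof (rule linearI)
  show "coefficients (s + t) = coefficients s + coefficients t" for s t
    using coefficients_combination[of 1 s t] by (simp add: fun_eq_iff plus_fun_def)
  show "coefficients (r *\<^sub>R t) = r *\<^sub>R coefficients t" for r t
    using coefficients_sum[of "\<lambda>_. complex_of_real r" "\<lambda>_. t" "{()}"]
    by (simp add: fun_eq_iff scaleR_fun_def scaleR_conv_of_real)
qed

lemma multilinear_expand:
  assumes t: "multilinear t"
  shows "(\<Sum>l\<in>L. \<zeta> l z * slot l t Z) = t (add_mset z Z)"
proof -
  have "(\<Sum>l\<in>L. \<zeta> l z * slot l t Z) =
      (\<Sum>l\<in>L. t (add_mset (Re (\<zeta> l z) *\<^sub>R p l - Im (\<zeta> l z) *\<^sub>R q l) Z)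
         + \<i> * t (add_mset (Im (\<zeta> l z) *\<^sub>R p l + Re (\<zeta> l z) *\<^sub>R q l) Z))"
    by (simp only: slot_def complex_mult_split multilinear_complex_combination[OF t])
  also have "\<dots> = t (add_mset z Z) + \<i> * t (add_mset 0 Z)"
    by (simp only: sum.distrib[of _ "\<lambda>l. \<i> * t (_ l)"] sum_distrib_left[symmetric] multilinear_sum[OF t, symmetric] expand_Re expand_Im)
  finally show ?thesis by (simp add: multilinear_zero[OF t])
qed

lemma form_of_coefficients:
  assumes "multilinear t"
  shows "form_of (coefficients t) Z = t Z"
  using assms
proof (induction Z arbitrary: t)
  case (add z Z)
  have "expand z (coefficients t) = coefficients (contract z t)"
  proof
    fix W
    have "expand z (coefficients t) W = coefficients (\<lambda>Z. \<Sum>l\<in>L. \<zeta> l z * slot l t Z) W"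
      by (simp add: expand_def coefficients_add_mset coefficients_sum)
    then show "expand z (coefficients t) W = coefficients (contract z t) W"
      by (simp add: multilinear_expand[OF add.prems] contract_def)
  qed
  moreover have "form_of (coefficients (contract z t)) Z = contract z t Z"
    by (rule add.IH[OF multilinear_contract[OF add.prems]])
  ultimately show ?case by (simp only: form_of_add_mset contract_apply)
qed simp

lemma slot_form_of:
  assumes "\<And>W. \<not> set_mset W \<subseteq> L \<Longrightarrow> c W = 0"
  shows "slot l (form_of c) = form_of (\<lambda>W. c (add_mset l W))"
proof (cases "l \<in> L")
  case True
  have "expand (p l) c W + \<i> * expand (q l) c W = c (add_mset l W)" for W
  proof -
    have "expand (p l) c W + \<i> * expand (q l) c W = (\<Sum>l'\<in>L. (\<zeta> l' (p l) + \<i> * \<zeta> l' (q l)) * c (add_mset l' W))"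
      by (simp add: expand_def sum_distrib_left sum.distrib[symmetric] algebra_simps)
    also have "\<dots> = (\<Sum>l'\<in>L. if l' = l then c (add_mset l' W) else 0)"
      using True by (intro sum.cong) (simp_all add: dual)
    finally show ?thesis using True finite_L by simp
  qed
  then show ?thesis
    by (simp add: slot_def fun_eq_iff form_of_add_mset form_of_combination[symmetric])
next
  case False
  then have c: "(\<lambda>W. c (add_mset l W)) = (\<lambda>W. 0)" using assms by simp
  have e: "expand 0 c = (\<lambda>W. 0)"
    using linear_0[OF linear_coordinate] by (simp add: expand_def)
  show ?thesis
    unfolding slot_def outside[OF False] form_of_add_mset c e form_of_zero by simp
qed

lemma coefficients_form_of:
  assumes "\<And>W. \<not> set_mset W \<subseteq> L \<Longrightarrow> c W = 0"
  shows "coefficients (form_of c) W = c W"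
  using assms
proof (induction W arbitrary: c)
  case (add l W)
  have "coefficients (form_of c) (add_mset l W) = coefficients (form_of (\<lambda>W. c (add_mset l W))) W"
    by (simp add: coefficients_add_mset slot_form_of[OF add.prems])
  also have "\<dots> = c (add_mset l W)"
    by (rule add.IH) (simp add: add.prems)
  finally show ?case .
qed simp

lemma coefficients_outside:
  assumes t: "multilinear t" and W: "\<not> set_mset W \<subseteq> L"
  shows "coefficients t W = 0"
proof -
  obtain l W' where l: "l \<notin> L" "W = add_mset l W'" using W by (metis multi_member_split subsetI)
  have "slot l t = (\<lambda>Z. 0)"
    using l(1) by (simp add: slot_def outside multilinear_zero[OF t])
  moreover have "coefficients (\<lambda>Z. 0) W' = 0"
    using coefficients_sum[of "\<lambda>_. 0" "\<lambda>_ _. 0" "{}"] by simp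
  ultimately show ?thesis by (simp add: l(2) coefficients_add_mset)
qed

lemma coefficients_size:
  assumes t: "t \<in> symm_forms d" and "size W \<noteq> d"
  shows "coefficients t W = 0"
proof -
  have "size Z + size W \<noteq> d \<Longrightarrow> fold_mset slot t W Z = 0" for Z
    by (induction W arbitrary: Z) (simp_all add: slot_def symm_forms_size[OF t])
  from this[of "{#}"] show ?thesis using assms(2) by (simp add: coefficients_def)
qed

lemma form_of_symm_forms:
  assumes c: "\<And>W. size W \<noteq> d \<Longrightarrow> c W = 0"
  shows "form_of c \<in> symm_forms d"
proof -
  have "size W + size Z \<noteq> d \<Longrightarrow> fold_mset expand c Z W = 0" for Z W
    by (induction Z arbitrary: W) (simp_all add: expand_def c)
  then have "form_of c Z = 0" if "size Z \<noteq> d" for Z using that by (simp add: form_of_def)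
  moreover have "linear (\<lambda>z. form_of c (add_mset z Z))" for Z
  proof (rule linearI)
    fix z z' :: 'u and r :: real
    have sum: "expand (z + z') c = (\<lambda>W. expand z c W + 1 * expand z' c W)"
      by (simp add: expand_def linear_add[OF linear_coordinate] sum.distrib distrib_right)
    show "form_of c (add_mset (z + z') Z) = form_of c (add_mset z Z) + form_of c (add_mset z' Z)"
      unfolding form_of_add_mset sum form_of_combination by simp
    have scale: "expand (r *\<^sub>R z) c = (\<lambda>W. 0 + of_real r * expand z c W)"
      by (simp add: expand_def linear_scale[OF linear_coordinate] scaleR_conv_of_real sum_distrib_left mult.assoc)
    show "form_of c (add_mset (r *\<^sub>R z) Z) = r *\<^sub>R form_of c (add_mset z Z)"
      unfolding form_of_add_mset scale form_of_combination form_of_zero by (simp add: scaleR_conv_of_real)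
  qed
  ultimately show ?thesis by (simp add: symm_forms_def multilinear_def)
qed

lemma multilinear_slot: "multilinear t \<Longrightarrow> multilinear (slot l t)"
  unfolding slot_def multilinear_def
proof (intro allI)
  fix Z assume *: "\<forall>Z. linear (\<lambda>z. t (add_mset z Z))"
  have "linear (\<lambda>z. \<i> * t (add_mset z (add_mset (q l) Z)))"
    using linear_compose[OF *[rule_format] bounded_linear.linear[OF bounded_linear_mult_right]] by (simp add: o_def)
  then show "linear (\<lambda>z. t (add_mset (p l) (add_mset z Z)) + \<i> * t (add_mset (q l) (add_mset z Z)))"
    using * by (intro linear_compose_add) (simp_all add: add_mset_commute)
qed

text \<open>
  The hypotheses say that \<open>p l + \<i> q l\<close> is an eigenvector with eigenvalue \<open>\<mu> l\<close> of the complex-linear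
  extension of \<open>A\<close>, so that every monomial is an eigenvector of the derivation.
\<close>

lemma coefficients_derivation:
  assumes A: "\<And>l. A (p l) = Re (\<mu> l) *\<^sub>R p l - Im (\<mu> l) *\<^sub>R q l"
      "\<And>l. A (q l) = Im (\<mu> l) *\<^sub>R p l + Re (\<mu> l) *\<^sub>R q l"
    and t: "multilinear t"
  shows "coefficients (derivation A t) W = (\<Sum>l\<in>#W. \<mu> l) * coefficients t W"
  using t
proof (induction W arbitrary: t)
  case (add l W)
  note t = add.prems
  have "slot l (derivation A t) = (\<lambda>Z. \<mu> l * slot l t Z + derivation A (slot l t) Z)"
  proof
    fix Z
    have "t (add_mset (A (p l)) Z) + \<i> * t (add_mset (A (q l)) Z) = \<mu> l * slot l t Z"
      by (simp only: A slot_def complex_mult_split multilinear_complex_combination[OF t])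
    moreover have "derivation A (slot l t) Z = derivation A (contract (p l) t) Z + \<i> * derivation A (contract (q l) t) Z"
      by (simp add: derivation_def slot_def contract_def sum_mset.distrib sum_mset_distrib_left)
    ultimately show "slot l (derivation A t) Z = \<mu> l * slot l t Z + derivation A (slot l t) Z"
      by (simp add: slot_def derivation_add_mset algebra_simps)
  qed
  then show ?case
    by (simp only: coefficients_add_mset coefficients_combination add.IH[OF multilinear_slot[OF t]])
       (simp add: algebra_simps)
qed simp

definition eigen_msets :: "nat \<Rightarrow> ('l \<Rightarrow> complex) \<Rightarrow> real \<Rightarrow> ('l \<Rightarrow> complex) \<Rightarrow> 'l multiset set"
  where "eigen_msets d \<mu> a \<nu> = {W \<in> multisets_of_size L d. (\<Sum>l\<in>#W. \<mu> l) = of_real a \<and> (\<Sum>l\<in>#W. \<nu> l) = 0}"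

lemma finite_eigen_msets: "finite (eigen_msets d \<mu> a \<nu>)"
  unfolding eigen_msets_def using finite_multisets_of_size[OF finite_L] by simp

lemma coefficients_image:
  assumes A: "\<And>l. A (p l) = Re (\<mu> l) *\<^sub>R p l - Im (\<mu> l) *\<^sub>R q l"
      "\<And>l. A (q l) = Im (\<mu> l) *\<^sub>R p l + Re (\<mu> l) *\<^sub>R q l"
    and B: "\<And>l. B (p l) = Re (\<nu> l) *\<^sub>R p l - Im (\<nu> l) *\<^sub>R q l"
      "\<And>l. B (q l) = Im (\<nu> l) *\<^sub>R p l + Re (\<nu> l) *\<^sub>R q l"
    and lin: "linear A" "linear B"
  shows "coefficients ` {t \<in> symm_forms d. derivation A t = a *\<^sub>R t \<and> derivation B t = 0}
     = supported_on (eigen_msets d \<mu> a \<nu>)"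
proof (intro equalityI image_subsetI subsetI)
  fix t :: "'u multiset \<Rightarrow> complex"
  assume "t \<in> {t \<in> symm_forms d. derivation A t = a *\<^sub>R t \<and> derivation B t = 0}"
  then have t: "t \<in> symm_forms d" "derivation A t = a *\<^sub>R t" "derivation B t = 0" by auto
  have ml: "multilinear t" by (rule symm_forms_multilinear[OF t(1)])
  have "W \<in> eigen_msets d \<mu> a \<nu>" if W: "coefficients t W \<noteq> 0" for W
  proof -
    have "(\<Sum>l\<in>#W. \<mu> l) * coefficients t W = of_real a * coefficients t W"
      using coefficients_derivation[of A \<mu>, OF A ml, of W] t(2) linear_scale[OF linear_coefficients, of a t]
      by (auto simp: scaleR_conv_of_real)
    moreover have "(\<Sum>l\<in>#W. \<nu> l) * coefficients t W = 0"
      using coefficients_derivation[of B \<nu>, OF B ml, of W] t(3) linear_0[OF linear_coefficients]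
      by simp
    moreover have "set_mset W \<subseteq> L" using coefficients_outside[OF ml] W by auto
    moreover have "size W = d" using coefficients_size[OF t(1)] W by auto
    ultimately show ?thesis using W by (simp add: eigen_msets_def multisets_of_size_def)
  qed
  then show "coefficients t \<in> supported_on (eigen_msets d \<mu> a \<nu>)"
    by (auto simp: supported_on_def)
next
  fix c :: "'l multiset \<Rightarrow> complex" assume c: "c \<in> supported_on (eigen_msets d \<mu> a \<nu>)"
  have out: "c W = 0" if "\<not> set_mset W \<subseteq> L" for W
    using c that by (auto simp: supported_on_def eigen_msets_def multisets_of_size_def)
  have sz: "c W = 0" if "size W \<noteq> d" for W
    using c that by (auto simp: supported_on_def eigen_msets_def multisets_of_size_def)
  define t where "t = form_of c"
  have t: "t \<in> symm_forms d" unfolding t_def by (rule form_of_symm_forms[OF sz])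
  have ml: "multilinear t" by (rule symm_forms_multilinear[OF t])
  have ct: "coefficients t = c" unfolding t_def by (rule ext) (rule coefficients_form_of[OF out])
  have eqI: "s = s'" if "multilinear s" "multilinear s'" "\<And>W. coefficients s W = coefficients s' W" for s s'
  proof
    fix Z
    have "coefficients s = coefficients s'" using that(3) by auto
    then show "s Z = s' Z"
      using form_of_coefficients[OF that(1), of Z] form_of_coefficients[OF that(2), of Z] by simp
  qed
  have "derivation A t = a *\<^sub>R t"
  proof (rule eqI)
    show "multilinear (derivation A t)"
      by (rule symm_forms_multilinear[OF symm_forms_derivation[OF t lin(1)]])
    show "multilinear (a *\<^sub>R t)"
      by (rule symm_forms_multilinear[OF subspace_scale[OF subspace_symm_forms t]])
    fix W
    have "(\<Sum>l\<in>#W. \<mu> l) * c W = of_real a * c W"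
      using c by (cases "c W = 0") (auto simp: supported_on_def eigen_msets_def)
    then show "coefficients (derivation A t) W = coefficients (a *\<^sub>R t) W"
      using linear_scale[OF linear_coefficients, of a t]
      by (simp add: coefficients_derivation[of A \<mu>, OF A ml] ct scaleR_conv_of_real)
  qed
  moreover have "derivation B t = 0"
  proof (rule eqI)
    show "multilinear (derivation B t)"
      by (rule symm_forms_multilinear[OF symm_forms_derivation[OF t lin(2)]])
    show "multilinear (0 :: 'u multiset \<Rightarrow> complex)"
      by (rule symm_forms_multilinear[OF subspace_0[OF subspace_symm_forms]])
    fix W
    have "(\<Sum>l\<in>#W. \<nu> l) * c W = 0"
      using c by (cases "c W = 0") (auto simp: supported_on_def eigen_msets_def)
    then show "coefficients (derivation B t) W = coefficients 0 W"
      using linear_0[OF linear_coefficients]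
      by (simp add: coefficients_derivation[of B \<nu>, OF B ml] ct)
  qed
  ultimately show "c \<in> coefficients ` {t \<in> symm_forms d. derivation A t = a *\<^sub>R t \<and> derivation B t = 0}"
    using t ct by (intro image_eqI[where x = t]) simp_all
qed

lemma coefficients_injective:
  assumes "t \<in> symm_forms d" "coefficients t = 0"
  shows "t = 0"
proof
  fix Z
  have "coefficients t = (\<lambda>W. 0)" using assms(2) by (simp add: zero_fun_def)
  then show "t Z = 0 Z"
    using form_of_coefficients[OF symm_forms_multilinear[OF assms(1)], of Z] by (simp add: form_of_zero)
qed

end

lemma linear_complex_iff: "linear f \<longleftrightarrow> linear (\<lambda>x. Re (f x)) \<and> linear (\<lambda>x. Im (f x))"
  by (auto simp: linear_iff complex_eq_iff)

lemma multilinear_complex_iff: "multilinear t \<longleftrightarrow> multilinear (Re \<circ> t) \<and> multilinear (Im \<circ> t)"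
  unfolding multilinear_def o_def by (subst linear_complex_iff) blast

lemma derivation_Re_Im: "derivation A (Re \<circ> t) = Re \<circ> derivation A t" "derivation A (Im \<circ> t) = Im \<circ> derivation A t"
proof -
  have "(\<Sum>z\<in>#Z. Re (f z)) = Re (\<Sum>z\<in>#Z. f z)" "(\<Sum>z\<in>#Z. Im (f z)) = Im (\<Sum>z\<in>#Z. f z)" for f :: "'a \<Rightarrow> complex" and Z
    by (induction Z) auto
  then show "derivation A (Re \<circ> t) = Re \<circ> derivation A t" "derivation A (Im \<circ> t) = Im \<circ> derivation A t"
    by (simp_all add: derivation_def fun_eq_iff)
qed

lemma complexified_symm_forms:
  "complexified {t \<in> symm_forms d. derivation A t = a *\<^sub>R t \<and> derivation B t = 0}
    = {t \<in> symm_forms d. derivation A t = a *\<^sub>R t \<and> derivation B t = 0}"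
proof -
  have "t \<in> symm_forms d \<longleftrightarrow> Re \<circ> t \<in> symm_forms d \<and> Im \<circ> t \<in> symm_forms d" for t :: "'a multiset \<Rightarrow> complex"
    unfolding symm_forms_def mem_Collect_eq multilinear_complex_iff[of t] by (auto simp: complex_eq_iff)
  moreover have "derivation A t = a *\<^sub>R t \<longleftrightarrow> derivation A (Re \<circ> t) = a *\<^sub>R (Re \<circ> t) \<and> derivation A (Im \<circ> t) = a *\<^sub>R (Im \<circ> t)"
    for t :: "'a multiset \<Rightarrow> complex"
    unfolding derivation_Re_Im by (auto simp: fun_eq_iff complex_eq_iff)
  moreover have "derivation B t = 0 \<longleftrightarrow> derivation B (Re \<circ> t) = 0 \<and> derivation B (Im \<circ> t) = 0"
    for t :: "'a multiset \<Rightarrow> complex"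
    unfolding derivation_Re_Im by (auto simp: fun_eq_iff complex_eq_iff)
  ultimately show ?thesis unfolding complexified_def by auto
qed

lemma complexified_supported_on: "complexified (supported_on F) = supported_on F"
  by (auto simp: complexified_def supported_on_def complex_eq_iff)

lemma (in complex_frame) symm_forms_finite_dimensional:
  "\<exists>B. finite B \<and> (symm_forms d :: ('u multiset \<Rightarrow> real) set) \<subseteq> span B"
proof -
  obtain C where C: "finite C" "(supported_on (multisets_of_size L d) :: ('l multiset \<Rightarrow> real) set) \<subseteq> span C"
    using dim_supported_on(2)[OF finite_multisets_of_size[OF finite_L]] by blast
  obtain C' where C': "finite C'" "(supported_on (multisets_of_size L d) :: ('l multiset \<Rightarrow> complex) set) \<subseteq> span C'"
    using complexified_finite_dimensional[OF C(2,1)] by (metis complexified_supported_on)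
  let ?f = "\<lambda>t :: 'u multiset \<Rightarrow> real. coefficients (\<lambda>Z. 1 * complex_of_real (t Z))"
  have sym: "(\<lambda>Z. 1 * complex_of_real (t Z)) \<in> symm_forms d" if "t \<in> symm_forms d" for t
    using that linear_complex_iff[of "\<lambda>z. complex_of_real (t (add_mset z Z))" for Z]
    by (auto simp: symm_forms_def multilinear_def linear_complex_iff linear_zero)
  show ?thesis
  proof (rule finite_spanning_if_linear_image[OF _ subspace_symm_forms])
    show "linear ?f"
      using linear_compose[OF linear_of_real_comp[of 1] linear_coefficients] by (simp add: o_def)
    show "t = 0" if "t \<in> symm_forms d" "?f t = 0" for t
      using coefficients_injective[OF sym[OF that(1)] that(2)] by (simp add: fun_eq_iff)
    show "?f ` symm_forms d \<subseteq> span C'"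
    proof (rule image_subsetI)
      fix t :: "'u multiset \<Rightarrow> real" assume "t \<in> symm_forms d"
      note t = sym[OF this]
      have "?f t \<in> supported_on (multisets_of_size L d)"
        unfolding supported_on_def mem_Collect_eq
      proof (intro allI impI)
        fix W assume "W \<notin> multisets_of_size L d"
        then have "\<not> set_mset W \<subseteq> L \<or> size W \<noteq> d" by (auto simp: multisets_of_size_def)
        then show "?f t W = 0"
          using coefficients_size[OF t] coefficients_outside[OF symm_forms_multilinear[OF t]] by blast
      qed
      then show "?f t \<in> span C'" using C'(2) by (rule subsetD[rotated])
    qed
  qed (rule C'(1))
qed

lemma (in complex_frame) dim_eigenforms:
  assumes A: "\<And>l. A (p l) = Re (\<mu> l) *\<^sub>R p l - Im (\<mu> l) *\<^sub>R q l"
      "\<And>l. A (q l) = Im (\<mu> l) *\<^sub>R p l + Re (\<mu> l) *\<^sub>R q l"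
    and B: "\<And>l. B (p l) = Re (\<nu> l) *\<^sub>R p l - Im (\<nu> l) *\<^sub>R q l"
      "\<And>l. B (q l) = Im (\<nu> l) *\<^sub>R p l + Re (\<nu> l) *\<^sub>R q l"
    and lin: "linear A" "linear B"
  shows "dim {t :: 'u multiset \<Rightarrow> real. t \<in> symm_forms d \<and> derivation A t = a *\<^sub>R t \<and> derivation B t = 0}
    = card (eigen_msets d \<mu> a \<nu>)"
proof -
  let ?F = "eigen_msets d \<mu> a \<nu>"
  let ?V = "{t :: 'u multiset \<Rightarrow> real. t \<in> symm_forms d \<and> derivation A t = a *\<^sub>R t \<and> derivation B t = 0}"
  let ?VC = "{t :: 'u multiset \<Rightarrow> complex. t \<in> symm_forms d \<and> derivation A t = a *\<^sub>R t \<and> derivation B t = 0}"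
  have sub: "subspace ?V"
  proof -
    have "?V = symm_forms d \<inter> ({t. derivation A t = a *\<^sub>R t} \<inter> {t. derivation B t = 0 *\<^sub>R t})" by auto
    then show ?thesis
      by (simp only:) (intro subspace_inter subspace_symm_forms subspace_kernel_derivation)
  qed
  obtain C where C: "finite C" "(symm_forms d :: ('u multiset \<Rightarrow> real) set) \<subseteq> span C"
    using symm_forms_finite_dimensional by blast
  then have "?V \<subseteq> span C" by auto
  from dim_complexified[OF sub this C(1)] have "2 * dim ?V = dim ?VC"
    by (simp only: complexified_symm_forms)
  also have "\<dots> = dim (coefficients ` ?VC)"
  proof (rule dim_linear_image_inj_on[OF linear_coefficients, symmetric])
    show "subspace ?VC"
      using subspace_complexified[OF sub] by (simp only: complexified_symm_forms)
    show "t = 0" if "t \<in> ?VC" "coefficients t = 0" for t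
      using coefficients_injective that by blast
  qed
  also have "coefficients ` ?VC = complexified (supported_on ?F)"
    using coefficients_image[of A \<mu> B \<nu>, OF A B lin] by (simp only: complexified_supported_on)
  also have "dim (complexified (supported_on ?F :: ('l multiset \<Rightarrow> real) set)) = 2 * card ?F"
    using dim_complexified[OF subspace_supported_on] dim_supported_on[OF finite_eigen_msets] by metis
  finally show ?thesis by linarith
qed

section \<open>Unitary bases\<close>

text \<open>
  An orthonormal basis over the complex numbers, for the complex structure \<open>J\<close> and the Hermitian
  form of the metric.
\<close>

definition unitary_basis :: "('a::real_inner \<Rightarrow> 'a) \<Rightarrow> 'a set \<Rightarrow> bool"
  where "unitary_basis J B \<longleftrightarrow> finite B
    \<and> (\<forall>e\<in>B. \<forall>f\<in>B. e \<bullet> f = (if e = f then 1 else 0) \<and> e \<bullet> J f = 0)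
    \<and> (\<forall>x. (\<Sum>e\<in>B. (x \<bullet> e) *\<^sub>R e + (x \<bullet> J e) *\<^sub>R J e) = x)"

text \<open>
  A maximal set that is orthonormal together with its image under \<open>J\<close>: a unit vector orthogonal to
  both could be added to it.
\<close>

lemma unitary_basis_exists:
  fixes J :: "'a::euclidean_space \<Rightarrow> 'a"
  assumes J: "compatible_complex_structure J"
  obtains B where "unitary_basis J B" "DIM('a) = 2 * card B"
proof -
  define U where "U B \<longleftrightarrow> finite B \<and> (\<forall>e\<in>B. \<forall>f\<in>B. e \<bullet> f = (if e = f then 1 else 0)) \<and> (\<forall>e\<in>B. \<forall>f\<in>B. e \<bullet> J f = 0)"
    for B
  have props: "pairwise orthogonal (B \<union> J ` B)" "\<And>i. i \<in> B \<union> J ` B \<Longrightarrow> norm i = 1"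
      "inj_on J B" "B \<inter> J ` B = {}" "independent (B \<union> J ` B)" "finite B" if "U B" for B
  proof -
    note ort = that[unfolded U_def]
    show fin: "finite B" using ort by blast
    show norm1: "norm i = 1" if "i \<in> B \<union> J ` B" for i
      using that ort by (auto simp: norm_eq_1 J_isometry[OF J])
    show "pairwise orthogonal (B \<union> J ` B)"
      using ort J_isometry[OF J] by (auto simp: pairwise_def orthogonal_def inner_commute)
    then show "independent (B \<union> J ` B)"
      by (rule pairwise_orthogonal_independent) (metis norm1 norm_zero zero_neq_one)
    show "inj_on J B"
    proof (rule inj_onI)
      fix e f assume "e \<in> B" "f \<in> B" "J e = J f"
      then have "- e = - f" using J_square[OF J] by metis
      then show "e = f" by simp
    qed
    show "B \<inter> J ` B = {}"
    proof (rule ccontr)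
      assume "B \<inter> J ` B \<noteq> {}"
      then obtain e where "e \<in> B" "J e \<in> B" by auto
      then have "J e \<bullet> J e = 0" using ort by blast
      moreover have "norm (J e) = 1" using norm1[of "J e"] \<open>e \<in> B\<close> by blast
      ultimately show False by simp
    qed
  qed
  have card_le: "2 * card B \<le> DIM('a)" "card (B \<union> J ` B) = 2 * card B" if "U B" for B
  proof -
    show eq: "card (B \<union> J ` B) = 2 * card B"
      using props[OF that] by (simp add: card_Un_disjoint card_image)
    show "2 * card B \<le> DIM('a)"
      using independent_bound[OF props(5)[OF that]] eq by simp
  qed
  have "U {}" by (simp add: U_def)
  moreover have "\<forall>B. U B \<longrightarrow> card B < Suc DIM('a)" using card_le(1) by fastforce
  ultimately obtain B where B: "U B" and max: "\<And>B'. U B' \<Longrightarrow> card B' \<le> card B"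
    using ex_has_greatest_nat[of U "{}" card "Suc DIM('a)"] by (metis less_imp_le)
  have span: "span (B \<union> J ` B) = UNIV"
  proof (rule ccontr)
    assume "span (B \<union> J ` B) \<noteq> UNIV"
    then have "dim (B \<union> J ` B) < DIM('a)"
      using dim_eq_full[of "B \<union> J ` B"] dim_subset_UNIV[of "B \<union> J ` B"] by linarith
    then obtain y where y: "y \<noteq> 0" "\<And>v. v \<in> span (B \<union> J ` B) \<Longrightarrow> orthogonal y v"
      using orthogonal_to_subspace_exists by blast
    define x where "x = y /\<^sub>R norm y"
    have "norm x = 1" using y(1) by (simp add: x_def)
    then have x1: "x \<bullet> x = 1" by (simp add: norm_eq_1)
    have xe: "x \<bullet> e = 0" "x \<bullet> J e = 0" if "e \<in> B" for e
      using y(2)[OF span_base, of e] y(2)[OF span_base, of "J e"] that by (auto simp: x_def orthogonal_def)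
    have ex: "e \<bullet> J x = 0" if "e \<in> B" for e
      using xe(2)[OF that] J_skew[OF J, of e x] by (simp add: inner_commute)
    have xx: "x \<bullet> J x = 0"
      using J_skew[OF J, of x x] by (simp add: inner_commute)
    have "x \<notin> B" using xe(1)[of x] x1 by auto
    have "U (insert x B)"
      using B x1 xe ex xx \<open>x \<notin> B\<close> by (auto simp: U_def inner_commute)
    from max[OF this] show False using \<open>x \<notin> B\<close> props(6)[OF B] by simp
  qed
  have dim: "DIM('a) = 2 * card B"
    using dim_eq_card_independent[OF props(5)[OF B]] card_le(2)[OF B] dim_eq_full[of "B \<union> J ` B"] span by simp
  have exp: "(\<Sum>e\<in>B. (x \<bullet> e) *\<^sub>R e + (x \<bullet> J e) *\<^sub>R J e) = x" for x
  proof -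
    have "(\<Sum>i\<in>B \<union> J ` B. (x \<bullet> i) *\<^sub>R i) = x"
      using props[OF B] span by (intro orthonormal_basis_expand) auto
    then show ?thesis
      using props[OF B] by (simp add: sum.union_disjoint sum.reindex sum.distrib)
  qed
  show ?thesis
    using B exp by (intro that[OF _ dim]) (auto simp: U_def unitary_basis_def)
qed

section \<open>The dimension of the weight spaces\<close>

definition put :: "bool \<Rightarrow> 'a::zero \<Rightarrow> 'a \<times> 'a"
  where "put s x = (if s then (x, 0) else (0, x))"

definition component :: "bool \<Rightarrow> 'a \<times> 'a \<Rightarrow> 'a"
  where "component s z = (if s then fst z else snd z)"

definition sign_of :: "bool \<Rightarrow> real"
  where "sign_of \<epsilon> = (if \<epsilon> then 1 else - 1)"

text \<open>
  The frame consists of \<open>(e - \<i> \<epsilon> J e) / 2\<close> for \<open>e\<close> in the unitary basis and a sign \<open>\<epsilon>\<close>, placed in the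
  first component (if \<open>s\<close>) or in the second one. These are eigenvectors of \<open>J\<close> with eigenvalue \<open>\<i> \<epsilon>\<close>, so
  invariance under \<open>J\<close> means that a monomial has as many factors of either sign.
\<close>

lemma dim_weight_forms:
  fixes J :: "'a::euclidean_space \<Rightarrow> 'a"
  assumes J: "compatible_complex_structure J"
    and B: "unitary_basis J B"
  shows "dim (weight_forms J d a) = card {W \<in> multisets_of_size (B \<times> (UNIV :: (bool \<times> bool) set)) d.
      (\<Sum>(e, s, \<epsilon>)\<in>#W. of_bool s) = complex_of_real a \<and> (\<Sum>(e, s, \<epsilon>)\<in>#W. \<i> * sign_of \<epsilon>) = 0}"
    and "\<exists>C. finite C \<and> (symm_forms d :: (('a \<times> 'a) multiset \<Rightarrow> real) set) \<subseteq> span C"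
proof -
  have fin: "finite B" and orth: "\<And>e f. e \<in> B \<Longrightarrow> f \<in> B \<Longrightarrow> e \<bullet> f = (if e = f then 1 else 0)"
      "\<And>e f. e \<in> B \<Longrightarrow> f \<in> B \<Longrightarrow> e \<bullet> J f = 0"
    and exp: "\<And>x. (\<Sum>e\<in>B. (x \<bullet> e) *\<^sub>R e + (x \<bullet> J e) *\<^sub>R J e) = x"
    using B by (simp_all add: unitary_basis_def)
  let ?L = "B \<times> (UNIV :: (bool \<times> bool) set)"
  define p :: "'a \<times> bool \<times> bool \<Rightarrow> 'a \<times> 'a"
    where "p = (\<lambda>(e, s, \<epsilon>). if e \<in> B then put s ((1 / 2) *\<^sub>R e) else 0)"
  define q :: "'a \<times> bool \<times> bool \<Rightarrow> 'a \<times> 'a"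
    where "q = (\<lambda>(e, s, \<epsilon>). if e \<in> B then put s ((- sign_of \<epsilon> / 2) *\<^sub>R J e) else 0)"
  define \<zeta> :: "'a \<times> bool \<times> bool \<Rightarrow> 'a \<times> 'a \<Rightarrow> complex"
    where "\<zeta> = (\<lambda>(e, s, \<epsilon>) z. Complex (component s z \<bullet> e) (sign_of \<epsilon> * (component s z \<bullet> J e)))"
  have J0: "J 0 = 0" by (rule linear_0[OF J_linear[OF J]])
  have Jhalf: "J (r *\<^sub>R e) = r *\<^sub>R J e" for r e by (rule linear_scale[OF J_linear[OF J]])
  have JB: "J e \<bullet> J f = (if e = f then 1 else 0)" "J e \<bullet> f = 0" if "e \<in> B" "f \<in> B" for e f
    using orth[OF that] J_isometry[OF J] J_skew[OF J, of e f] by auto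
  have sumL: "(\<Sum>l\<in>?L. F l) = (\<Sum>e\<in>B. F (e, True, True) + F (e, True, False) + F (e, False, True) + F (e, False, False))"
    for F :: "'a \<times> bool \<times> bool \<Rightarrow> 'a \<times> 'a"
  proof -
    have "(\<Sum>l\<in>?L. F l) = (\<Sum>e\<in>B. \<Sum>s\<in>UNIV. F (e, s))"
      by (simp add: sum.cartesian_product)
    then show ?thesis
      by (simp add: UNIV_Times_UNIV[symmetric] sum.cartesian_product[symmetric, where g = "\<lambda>s \<epsilon>. F (e, s, \<epsilon>)" for e, simplified] UNIV_bool add_ac del: UNIV_Times_UNIV)
  qed
  interpret complex_frame ?L p q \<zeta>
  proof (rule complex_frame.intro)
    show "finite ?L" using fin by simp
    show "p l = 0" "q l = 0" if "l \<notin> ?L" for l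
      using that by (auto simp: p_def q_def split: prod.splits)
    show "linear (\<zeta> l)" for l
      by (cases l) (auto intro!: linearI simp: \<zeta>_def component_def complex_eq_iff inner_add_left algebra_simps)
    show "\<zeta> l (p l') + \<i> * \<zeta> l (q l') = (if l = l' then 1 else 0)" if "l \<in> ?L" "l' \<in> ?L" for l l'
    proof -
      obtain e s \<epsilon> f r \<eta> where l: "l = (e, s, \<epsilon>)" "l' = (f, r, \<eta>)" by (metis prod_cases3)
      have "e \<in> B" "f \<in> B" using that l by auto
      then show ?thesis
        using orth[of f e] JB[of f e]
        by (auto simp: l p_def q_def \<zeta>_def put_def component_def sign_of_def complex_eq_iff)
    qed
    fix z :: "'a \<times> 'a"
    show "(\<Sum>l\<in>?L. Re (\<zeta> l z) *\<^sub>R p l - Im (\<zeta> l z) *\<^sub>R q l) = z"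
    proof -
      have halves: "(r / 2) *\<^sub>R u + (s / 2) *\<^sub>R v + ((r / 2) *\<^sub>R u + (s / 2) *\<^sub>R v) = r *\<^sub>R u + s *\<^sub>R v"
        for r s and u v :: 'a
      proof -
        have "r *\<^sub>R u = (r / 2) *\<^sub>R u + (r / 2) *\<^sub>R u" for r and u :: 'a
          by (simp add: scaleR_left_distrib[symmetric])
        from this[of r u] this[of s v] show ?thesis by (simp only: add_ac)
      qed
      have "(\<Sum>l\<in>?L. Re (\<zeta> l z) *\<^sub>R p l - Im (\<zeta> l z) *\<^sub>R q l)
          = (\<Sum>e\<in>B. ((fst z \<bullet> e) *\<^sub>R e + (fst z \<bullet> J e) *\<^sub>R J e, (snd z \<bullet> e) *\<^sub>R e + (snd z \<bullet> J e) *\<^sub>R J e))"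
        unfolding sumL
        by (intro sum.cong refl)
           (simp add: \<zeta>_def p_def q_def put_def component_def sign_of_def halves)
      also have "\<dots> = z" by (simp add: prod_eq_iff fst_sum snd_sum exp)
      finally show ?thesis .
    qed
    show "(\<Sum>l\<in>?L. Im (\<zeta> l z) *\<^sub>R p l + Re (\<zeta> l z) *\<^sub>R q l) = 0"
      unfolding sumL by (intro sum.neutral) (simp add: \<zeta>_def p_def q_def put_def component_def sign_of_def zero_prod_def)
  qed
  show "\<exists>C. finite C \<and> (symm_forms d :: (('a \<times> 'a) multiset \<Rightarrow> real) set) \<subseteq> span C"
    by (rule symm_forms_finite_dimensional)
  define \<mu> :: "'a \<times> bool \<times> bool \<Rightarrow> complex" where "\<mu> = (\<lambda>(e, s, \<epsilon>). of_bool s)"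
  define \<nu> :: "'a \<times> bool \<times> bool \<Rightarrow> complex" where "\<nu> = (\<lambda>(e, s, \<epsilon>). \<i> * sign_of \<epsilon>)"
  have "dim {t :: ('a \<times> 'a) multiset \<Rightarrow> real. t \<in> symm_forms d \<and> derivation proj_fst t = a *\<^sub>R t \<and> derivation (on_both J) t = 0}
      = card (eigen_msets d \<mu> a \<nu>)"
  proof (rule dim_eigenforms)
    fix l :: "'a \<times> bool \<times> bool"
    obtain e s \<epsilon> where l: "l = (e, s, \<epsilon>)" by (metis prod_cases3)
    show "proj_fst (p l) = Re (\<mu> l) *\<^sub>R p l - Im (\<mu> l) *\<^sub>R q l" "proj_fst (q l) = Im (\<mu> l) *\<^sub>R p l + Re (\<mu> l) *\<^sub>R q l"
      by (auto simp: l p_def q_def \<mu>_def put_def proj_fst_def zero_prod_def)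
    show "on_both J (p l) = Re (\<nu> l) *\<^sub>R p l - Im (\<nu> l) *\<^sub>R q l" "on_both J (q l) = Im (\<nu> l) *\<^sub>R p l + Re (\<nu> l) *\<^sub>R q l"
      by (auto simp: l p_def q_def \<nu>_def put_def on_both_def zero_prod_def sign_of_def J0 Jhalf J_square[OF J] linear_neg[OF J_linear[OF J]])
  qed (rule linear_pair_maps linear_on_both[OF J_linear[OF J]])+
  then show "dim (weight_forms J d a) = card {W \<in> multisets_of_size ?L d.
      (\<Sum>(e, s, \<epsilon>)\<in>#W. of_bool s) = complex_of_real a \<and> (\<Sum>(e, s, \<epsilon>)\<in>#W. \<i> * sign_of \<epsilon>) = 0}"
    by (simp only: weight_forms_def eigen_msets_def \<mu>_def \<nu>_def)
qed

section \<open>Counting\<close>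

text \<open>
  A multiset of labelled vectors amounts to one multiset of vectors for each of the four labels.
\<close>

definition assemble :: "'b multiset \<times> 'b multiset \<times> 'b multiset \<times> 'b multiset \<Rightarrow> ('b \<times> bool \<times> bool) multiset"
  where "assemble = (\<lambda>(M1, M2, M3, M4). image_mset (\<lambda>e. (e, True, True)) M1 + image_mset (\<lambda>e. (e, True, False)) M2
    + image_mset (\<lambda>e. (e, False, True)) M3 + image_mset (\<lambda>e. (e, False, False)) M4)"

lemma inj_assemble: "inj assemble"
proof (rule injI)
  fix X Y :: "'b multiset \<times> 'b multiset \<times> 'b multiset \<times> 'b multiset"
  assume eq: "assemble X = assemble Y"
  obtain M1 M2 M3 M4 N1 N2 N3 N4 where XY: "X = (M1, M2, M3, M4)" "Y = (N1, N2, N3, N4)"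
    by (metis prod_cases4)
  have "image_mset fst (filter_mset (\<lambda>l. snd l = \<tau>) (assemble X)) = image_mset fst (filter_mset (\<lambda>l. snd l = \<tau>) (assemble Y))" for \<tau>
    by (simp add: eq)
  from this[of "(True, True)"] this[of "(True, False)"] this[of "(False, True)"] this[of "(False, False)"]
  show "X = Y"
    by (simp add: XY assemble_def filter_mset_image_mset image_mset.compositionality o_def)
qed

lemma assemble_surj:
  "set_mset W \<subseteq> B \<times> UNIV \<Longrightarrow> \<exists>M1 M2 M3 M4. W = assemble (M1, M2, M3, M4) \<and>
     set_mset M1 \<subseteq> B \<and> set_mset M2 \<subseteq> B \<and> set_mset M3 \<subseteq> B \<and> set_mset M4 \<subseteq> B"
proof (induction W)
  case empty
  show ?case by (rule exI[of _ "{#}"])+ (simp add: assemble_def)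
next
  case (add l W)
  then obtain M1 M2 M3 M4 where M: "W = assemble (M1, M2, M3, M4)"
     "set_mset M1 \<subseteq> B" "set_mset M2 \<subseteq> B" "set_mset M3 \<subseteq> B" "set_mset M4 \<subseteq> B" by auto
  obtain e s \<epsilon> where l: "l = (e, s, \<epsilon>)" by (metis prod_cases3)
  have e: "e \<in> B" using add.prems l by auto
  have eq: "add_mset l W = assemble (if s \<and> \<epsilon> then add_mset e M1 else M1, if s \<and> \<not> \<epsilon> then add_mset e M2 else M2,
      if \<not> s \<and> \<epsilon> then add_mset e M3 else M3, if \<not> s \<and> \<not> \<epsilon> then add_mset e M4 else M4)"
    by (simp add: M(1) l assemble_def)
  show ?case
    by (intro exI conjI, rule eq) (use M(2-) e in auto)
qed

lemma assemble_weights: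
  assumes "W = assemble (M1, M2, M3, M4)"
  shows "size W = size M1 + size M2 + size M3 + size M4"
    and "(\<Sum>(e, s, \<epsilon>)\<in>#W. of_bool s) = complex_of_nat (size M1 + size M2)"
    and "(\<Sum>(e, s, \<epsilon>)\<in>#W. \<i> * sign_of \<epsilon>) = \<i> * (of_nat (size M1 + size M3) - of_nat (size M2 + size M4))"
  unfolding assms by (simp_all add: assemble_def image_mset.compositionality o_def sign_of_def algebra_simps)

text \<open>
  Let \<open>i\<close> be the number of positive labels in the first component. The conditions on the total
  size, on the first component and on the signs determine the other three sizes.
\<close>

lemma card_balanced_multisets:
  assumes B: "finite B" "card B = Suc n" and a: "a \<le> k + 1"
  shows "card {W \<in> multisets_of_size (B \<times> (UNIV :: (bool \<times> bool) set)) (2 * k).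
      (\<Sum>(e, s, \<epsilon>)\<in>#W. of_bool s) = complex_of_real (real a) \<and> (\<Sum>(e, s, \<epsilon>)\<in>#W. \<i> * sign_of \<epsilon>) = 0}
    = (\<Sum>i\<in>{a - k..min a k}. ((n + i) choose i) * (((n + (a - i)) choose (a - i)) * (((n + (k - i)) choose (k - i)) * ((n + (k + i - a)) choose (k + i - a)))))"
proof -
  let ?M = "multisets_of_size B"
  let ?I = "{a - k..min a k}"
  let ?T = "\<lambda>i. ?M i \<times> ?M (a - i) \<times> ?M (k - i) \<times> ?M (k + i - a)"
  have "{W \<in> multisets_of_size (B \<times> (UNIV :: (bool \<times> bool) set)) (2 * k).
      (\<Sum>(e, s, \<epsilon>)\<in>#W. of_bool s) = complex_of_real (real a) \<and> (\<Sum>(e, s, \<epsilon>)\<in>#W. \<i> * sign_of \<epsilon>) = 0}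
     = assemble ` (\<Union>i\<in>?I. ?T i)" (is "?L = ?R")
  proof (intro equalityI subsetI)
    fix W assume "W \<in> ?L"
    then have W: "set_mset W \<subseteq> B \<times> UNIV" "size W = 2 * k"
       "(\<Sum>(e, s, \<epsilon>)\<in>#W. of_bool s) = complex_of_nat a" "(\<Sum>(e, s, \<epsilon>)\<in>#W. \<i> * complex_of_real (sign_of \<epsilon>)) = 0"
      by (auto simp: multisets_of_size_def)
    obtain M1 M2 M3 M4 where M: "W = assemble (M1, M2, M3, M4)"
      "set_mset M1 \<subseteq> B" "set_mset M2 \<subseteq> B" "set_mset M3 \<subseteq> B" "set_mset M4 \<subseteq> B"
      using assemble_surj[OF W(1)] by blast
    have "complex_of_nat (size M1 + size M2) = of_nat a"
      using W(3) assemble_weights(2)[OF M(1)] by simp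
    then have 2: "size M1 + size M2 = a" by (simp only: of_nat_eq_iff)
    have "complex_of_nat (size M1 + size M3) = of_nat (size M2 + size M4)"
      using W(4) assemble_weights(3)[OF M(1)] by simp
    then have 3: "size M1 + size M3 = size M2 + size M4" by (simp only: of_nat_eq_iff)
    have 1: "size M1 + size M2 + size M3 + size M4 = 2 * k" using W(2) assemble_weights(1)[OF M(1)] by simp
    have "size M1 \<in> ?I" "size M2 = a - size M1" "size M3 = k - size M1" "size M4 = k + size M1 - a"
      using 1 2 3 by auto
    then have "(M1, M2, M3, M4) \<in> (\<Union>i\<in>?I. ?T i)"
      using M(2-) by (auto simp: multisets_of_size_def intro!: bexI[of _ "size M1"])
    then show "W \<in> ?R" unfolding M(1) by (rule imageI)
  next
    fix W assume "W \<in> ?R"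
    then obtain M1 M2 M3 M4 i where M: "W = assemble (M1, M2, M3, M4)" "i \<in> ?I"
      "M1 \<in> ?M i" "M2 \<in> ?M (a - i)" "M3 \<in> ?M (k - i)" "M4 \<in> ?M (k + i - a)" by auto
    then have sz: "size M1 = i" "size M2 = a - i" "size M3 = k - i" "size M4 = k + i - a"
      by (auto simp: multisets_of_size_def)
    have "set_mset W \<subseteq> B \<times> UNIV" using M by (auto simp: assemble_def multisets_of_size_def)
    moreover have "size M1 + size M2 + size M3 + size M4 = 2 * k" "size M1 + size M2 = a" "size M1 + size M3 = size M2 + size M4"
      using M(2) sz by auto
    ultimately show "W \<in> ?L"
      using assemble_weights[OF M(1)] by (simp add: multisets_of_size_def)
  qed
  also have "card (assemble ` (\<Union>i\<in>?I. ?T i)) = card (\<Union>i\<in>?I. ?T i)"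
    by (rule card_image) (rule inj_on_subset[OF inj_assemble subset_UNIV])
  also have "\<dots> = (\<Sum>i\<in>?I. card (?T i))"
  proof (rule card_UN_disjoint)
    show "\<forall>i\<in>?I. finite (?T i)"
      using finite_multisets_of_size[OF B(1)] by simp
    show "\<forall>i\<in>?I. \<forall>j\<in>?I. i \<noteq> j \<longrightarrow> ?T i \<inter> ?T j = {}"
      by (auto simp: multisets_of_size_def)
  qed simp
  finally show ?thesis
    by (simp add: card_cartesian_product card_multisets_of_size[OF B(1)] B(2))
qed

lemma binomial_product_difference:
  assumes n: "n \<ge> 1"
  defines "h \<equiv> \<lambda>i. real ((n + i) choose i)"
  shows "(fact (n + q - 1) * fact (n + p + q) * (real p + 1) / (fact q * fact (p + q + 1) * fact (n - 1) * fact n) :: real)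
    = h (p + q) * h q - (if q = 0 then 0 else h (p + q + 1) * h (q - 1))"
proof -
  have h: "h i = fact (n + i) / (fact n * fact i)" for i
    unfolding h_def using binomial_fact[of i "n + i", where 'a = real] by (simp add: mult.commute)
  obtain n' where n': "n = Suc n'" using n by (cases n) auto
  show ?thesis
  proof (cases q)
    case 0
    have "(fact (p + 1) :: real) = (real p + 1) * fact p" by (simp add: algebra_simps)
    moreover have "real p + 1 \<noteq> 0" by (simp add: add_nonneg_eq_0_iff)
    ultimately show ?thesis unfolding h 0 by (simp add: divide_simps del: fact_Suc)
  next
    case (Suc r)
    have rational: "V * U * (x + 1) / (y * Y * ((x + y + 1) * X) * Z * (w * Z))
      = U / (w * Z * X) * ((w + y) * V / (w * Z * (y * Y)))
        - (w + x + y + 1) * U / (w * Z * ((x + y + 1) * X)) * (V / (w * Z * Y))"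
      if "X \<noteq> 0" "Y \<noteq> 0" "Z \<noteq> 0" "w \<noteq> 0" "y \<noteq> 0" "x + y + 1 \<noteq> 0" for U V X Y Z w x y :: real
      using that by (simp add: divide_simps) (simp add: algebra_simps)
    have facts: "(fact (p + q + 1) :: real) = (real p + real q + 1) * fact (p + q)" "(fact q :: real) = real q * fact (q - 1)"
      "(fact n :: real) = real n * fact (n - 1)" "(fact (n + q) :: real) = (real n + real q) * fact (n + q - 1)"
      "(fact (n + (p + q + 1)) :: real) = (real n + real p + real q + 1) * fact (n + p + q)"
      by (simp_all add: Suc n' algebra_simps)
    have idx: "n + (p + q) = n + p + q" "n + (q - 1) = n + q - 1" using Suc by simp_all
    have "real p + real q + 1 \<noteq> 0" by (simp add: add_nonneg_eq_0_iff)
    then show ?thesis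
      using rational[of "fact (p + q)" "fact (q - 1)" "fact (n - 1)" "real n" "real q" "real p" "fact (n + q - 1)" "fact (n + p + q)"] Suc n
      unfolding h facts idx by simp
  qed
qed

text \<open>
  Twice the left-hand side is the sum of the squared increments of the sequence
  \<open>G = (0, g 0, \<dots>, g k, 0)\<close>. The sequence of squared increments is a palindrome, and if it has a
  middle term, this term is \<open>0\<close>.
\<close>

lemma sum_squares_of_symmetric_sequence:
  fixes g :: "nat \<Rightarrow> real"
  assumes sym: "\<And>i. i \<le> k \<Longrightarrow> g (k - i) = g i"
  shows "(\<Sum>i\<le>k. (g i)\<^sup>2) - (\<Sum>i\<in>{1..k}. g i * g (i - 1)) = (\<Sum>q\<le>k div 2. (g q - (if q = 0 then 0 else g (q - 1)))\<^sup>2)"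
proof -
  define G where "G i = (if i = 0 \<or> i > Suc k then 0 else g (i - 1))" for i
  define e where "e i = (G (Suc i) - G i)\<^sup>2" for i
  have e_sym: "e (Suc k - i) = e i" if "i \<le> Suc k" for i
  proof -
    have "G (Suc (Suc k) - j) = G j" if "j \<le> Suc (Suc k)" for j
    proof (cases "j = 0 \<or> j > Suc k")
      case False
      then have "g (k - (j - 1)) = g (j - 1)" by (intro sym) auto
      then show ?thesis using False by (auto simp: G_def Suc_diff_le)
    qed (use that in \<open>auto simp: G_def\<close>)
    from this[of i] this[of "Suc i"] that show ?thesis
      by (simp add: e_def Suc_diff_le power2_commute)
  qed
  have "(\<Sum>i\<le>Suc k. e i) = (\<Sum>i\<le>Suc k. (G (Suc i))\<^sup>2) + (\<Sum>i\<le>Suc k. (G i)\<^sup>2) - 2 * (\<Sum>i\<le>Suc k. G (Suc i) * G i)"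
    by (simp add: e_def power2_diff sum.distrib sum_subtractf sum_distrib_left mult.assoc)
  also have "(\<Sum>i\<le>Suc k. (G (Suc i))\<^sup>2) = (\<Sum>i\<le>k. (g i)\<^sup>2)" by (simp add: G_def)
  also have "(\<Sum>i\<le>Suc k. (G i)\<^sup>2) = (\<Sum>i\<le>k. (g i)\<^sup>2)"
    unfolding sum.atMost_Suc_shift by (simp add: G_def)
  also have "(\<Sum>i\<le>Suc k. G (Suc i) * G i) = (\<Sum>i\<in>{1..k}. g i * g (i - 1))"
  proof -
    have "(\<Sum>i\<le>Suc k. G (Suc i) * G i) = (\<Sum>i\<in>{1..k}. G (Suc i) * G i)"
      by (rule sum.mono_neutral_right) (auto simp: G_def)
    then show ?thesis by (simp add: G_def)
  qed
  finally have twice: "(\<Sum>i\<le>Suc k. e i) = 2 * ((\<Sum>i\<le>k. (g i)\<^sup>2) - (\<Sum>i\<in>{1..k}. g i * g (i - 1)))"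
    by simp
  have split: "{..Suc k} = {..k div 2} \<union> {k div 2 <.. Suc k}" by auto
  have "(\<Sum>i\<le>Suc k. e i) = (\<Sum>i\<le>k div 2. e i) + (\<Sum>i\<in>{k div 2 <.. Suc k}. e i)"
    unfolding split by (rule sum.union_disjoint) auto
  \<comment> \<open>The reflection \<open>i \<mapsto> k + 1 - i\<close>; for odd \<open>k\<close> its range exceeds \<open>{..k div 2}\<close> by the fixed point.\<close>
  also have "(\<Sum>i\<in>{k div 2 <.. Suc k}. e i) = (\<Sum>i\<le>k - k div 2. e i)"
    by (rule sum.reindex_bij_witness[of _ "\<lambda>i. Suc k - i" "\<lambda>i. Suc k - i"]) (auto simp: e_sym)
  also have "\<dots> = (\<Sum>i\<le>k div 2. e i)"
  proof (rule sum.mono_neutral_right)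
    show "\<forall>i\<in>{..k - k div 2} - {..k div 2}. e i = 0"
    proof
      fix i assume "i \<in> {..k - k div 2} - {..k div 2}"
      then have "k div 2 < i" "i \<le> k - k div 2" by auto
      then have i: "k = 2 * i - 1" "i > 0" by presburger+
      then have "g (k - i) = g i" by (intro sym) auto
      then show "e i = 0" using i by (simp add: e_def G_def)
    qed
  qed auto
  finally have "(\<Sum>i\<le>Suc k. e i) = 2 * (\<Sum>i\<le>k div 2. e i)" by simp
  moreover have "e q = (g q - (if q = 0 then 0 else g (q - 1)))\<^sup>2" if "q \<le> k div 2" for q
  proof -
    have "q \<le> k" using that by simp
    then show ?thesis by (auto simp: e_def G_def)
  qed
  ultimately show ?thesis using twice by simp
qed

section \<open>The dimension formula\<close>

lemma dim_invariant_forms: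
  fixes J :: "'a::euclidean_space \<Rightarrow> 'a"
  assumes J: "compatible_complex_structure J" and n: "n \<ge> 1" and dim: "DIM('a) = 2 * n + 2"
  shows "real (dim (invariant_forms J k)) = (\<Sum>(p, q) \<in> {(p, q). p + 2 * q = k}.
       (fact (n + q - 1) * fact (n + p + q) * (real p + 1) /
        (fact q * fact (p + q + 1) * fact (n - 1) * fact n))\<^sup>2)"
    and "\<exists>C. finite C \<and> invariant_forms J k \<subseteq> span C"
proof -
  obtain B where B: "unitary_basis J B" "DIM('a) = 2 * card B"
    by (rule unitary_basis_exists[OF J])
  have fin: "finite B" using B(1) by (simp add: unitary_basis_def)
  have card: "card B = Suc n" using B(2) dim by simp
  obtain C where C: "finite C" "(symm_forms (2 * k) :: (('a \<times> 'a) multiset \<Rightarrow> real) set) \<subseteq> span C"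
    using dim_weight_forms(2)[OF J B(1)] by blast
  then have sub: "weight_forms J (2 * k) a \<subseteq> span C" for a
    by (auto simp: weight_forms_def)
  then show "\<exists>C. finite C \<and> invariant_forms J k \<subseteq> span C"
    using C(1) by (auto simp: invariant_forms_def)
  define h where "h i = real ((n + i) choose i)" for i
  define g where "g i = h i * h (k - i)" for i
  have "dim (weight_forms J (2 * k) (real k)) = dim {t \<in> weight_forms J (2 * k) (real k). derivation fst_to_snd t = 0}
      + dim (derivation fst_to_snd ` weight_forms J (2 * k) (real k))"
    by (rule dim_eq_dim_kernel_plus_dim_image[OF linear_derivation subspace_weight_forms sub C(1)])
  then have "real (dim (invariant_forms J k)) = real (dim (weight_forms J (2 * k) (real k)))
      - real (dim (weight_forms J (2 * k) (real k + 1)))"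
    by (simp add: fst_to_snd_surjective[OF J_linear[OF J]] invariant_forms_def)
  also have "real (dim (weight_forms J (2 * k) (real k))) = (\<Sum>i\<le>k. (g i)\<^sup>2)"
  proof -
    have "real (dim (weight_forms J (2 * k) (real k))) = (\<Sum>i\<in>{k - k..min k k}. h i * (h (k - i) * (h (k - i) * h (k + i - k))))"
      unfolding dim_weight_forms(1)[OF J B(1)] card_balanced_multisets[OF fin card le_add1] h_def by simp
    then show ?thesis by (simp add: g_def power2_eq_square atMost_atLeast0 mult_ac)
  qed
  also have "real (dim (weight_forms J (2 * k) (real k + 1))) = (\<Sum>i\<in>{1..k}. g i * g (i - 1))"
  proof -
    have "real (dim (weight_forms J (2 * k) (real (k + 1))))
        = (\<Sum>i\<in>{k + 1 - k..min (k + 1) k}. h i * (h (k + 1 - i) * (h (k - i) * h (k + i - (k + 1)))))"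
      unfolding dim_weight_forms(1)[OF J B(1)] card_balanced_multisets[OF fin card order_refl] h_def by simp
    also have "\<dots> = (\<Sum>i\<in>{1..k}. g i * g (i - 1))"
      by (rule sum.cong) (auto simp: g_def Suc_diff_le)
    finally show ?thesis by (simp add: add.commute)
  qed
  also have "(\<Sum>i\<le>k. (g i)\<^sup>2) - (\<Sum>i\<in>{1..k}. g i * g (i - 1)) = (\<Sum>q\<le>k div 2. (g q - (if q = 0 then 0 else g (q - 1)))\<^sup>2)"
    by (rule sum_squares_of_symmetric_sequence) (simp add: g_def mult.commute)
  also have "\<dots> = (\<Sum>(p, q) \<in> {(p, q). p + 2 * q = k}.
       (fact (n + q - 1) * fact (n + p + q) * (real p + 1) /
        (fact q * fact (p + q + 1) * fact (n - 1) * fact n))\<^sup>2)"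
  proof (rule sum.reindex_bij_witness[of _ snd "\<lambda>q. (k - 2 * q, q)"])
    fix q assume "q \<in> {..k div 2}"
    then have q: "2 * q \<le> k" by auto
    then have "g q - (if q = 0 then 0 else g (q - 1)) = h (k - 2 * q + q) * h q - (if q = 0 then 0 else h (k - 2 * q + q + 1) * h (q - 1))"
      by (auto simp: g_def mult.commute Suc_diff_le intro!: arg_cong2[where f = "(*)"] arg_cong[where f = h])
    then show "(case (k - 2 * q, q) of (p, q) \<Rightarrow> (fact (n + q - 1) * fact (n + p + q) * (real p + 1) /
        (fact q * fact (p + q + 1) * fact (n - 1) * fact n))\<^sup>2) = (g q - (if q = 0 then 0 else g (q - 1)))\<^sup>2"
      unfolding prod.case binomial_product_difference[OF n] h_def by simp
  qed auto
  finally show "real (dim (invariant_forms J k)) = (\<Sum>(p, q) \<in> {(p, q). p + 2 * q = k}.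
       (fact (n + q - 1) * fact (n + p + q) * (real p + 1) /
        (fact q * fact (p + q + 1) * fact (n - 1) * fact n))\<^sup>2)" .
qed

theorem theorem4:
  fixes J :: "'a::euclidean_space \<Rightarrow> 'a" and n k :: nat
  assumes "n \<ge> 1" and "k \<ge> 1"
    and "DIM('a) = 2 * n + 2"
    and "compatible_complex_structure J"
  shows "real (dim (V_space J k)) =
    (\<Sum>(p, q) \<in> {(p, q). p + 2 * q = k}.
       (fact (n + q - 1) * fact (n + p + q) * (real p + 1) /
        (fact q * fact (p + q + 1) * fact (n - 1) * fact n))\<^sup>2) -
    (\<Sum>(p, q) \<in> {(p, q). p + 2 * q = k - 1}.
       (fact (n + q - 1) * fact (n + p + q) * (real p + 1) /
        (fact q * fact (p + q + 1) * fact (n - 1) * fact n))\<^sup>2)"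
proof -
  obtain k' where k: "k = Suc k'" using \<open>k \<ge> 1\<close> by (cases k) auto
  note J = assms(4)
  obtain C where C: "finite C" "invariant_forms J k \<subseteq> span C"
    using dim_invariant_forms(2)[OF J assms(1,3)] by blast
  have "dim (invariant_forms J k) = dim (harmonic_forms J k) + dim (J_laplacian J ` invariant_forms J k)"
    unfolding harmonic_forms_def
    by (rule dim_eq_dim_kernel_plus_dim_image[OF linear_J_laplacian[OF J] subspace_invariant_forms C(2,1)])
  also have "J_laplacian J ` invariant_forms J k = invariant_forms J (k - 1)"
    using J_laplacian_surjective[OF J, of k'] by (simp add: k)
  finally have "real (dim (V_space J k)) = real (dim (invariant_forms J k)) - real (dim (invariant_forms J (k - 1)))"
    by (simp add: dim_V_space_eq[OF J] dim_harmonic_young_forms[OF J])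
  then show ?thesis unfolding dim_invariant_forms(1)[OF J assms(1,3)] .
qed

end
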